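(* Consider a quantum circuit of depth $D$ with gates of range $r$, on a system of sites with control space $X$. Assume that there are constants $0<c\le c'$ and $d>0$, and some $\ell_0$ which depends only on the range and depth of the quantum circuit and on $c,c',d$, such that for every point $x$ and for any $\ell\le\ell_0$: (i) the number of physical qudits within distance $\ell$ of $x$ is at least $\lfloor c\,\ell^{d}\rfloor$; and (ii) the number of ancilla qudits with distance from $x$ in the interval $[\ell-1,\ell]$ is at most $\lfloor c'\,\ell^{d-1}\rfloor$. Then, for sufficiently large $\ell_0$ depending only on $c,c',d$ and on the range and depth of the quantum circuit, there is a borrowing function $f$ (with respect to a causal time function for the circuit) with $\mathrm{dist}(j,f(j))\le\ell_0$, and so ancillas may be removed.
   Context: Sites: a discrete set of sites, each carrying a finite-dimensional Hilbert space that is a tensor product of qudits, each labelled "physical" or "ancilla"; all qudits have the same dimension. Sites are mapped by a locally finite map to a control space $X$ (a manifold with a metric, or a simplicial complex), and distances are measured in $X$. Quantum circuit of depth $D$: a unitary $U$ with a decomposition $U=U_D\circ\cdots\circ U_1$, $U_a=\prod_{S\in G_a}U_{S,a}$, where $G_a$ is a collection of disjoint sets of sites and each gate $U_{S,a}$ is a unitary supported on $S$. The range of the gates is an upper bound on the diameters of all the sets $S$; the range of the circuit is the gate range times the depth. Causal time function: a function $\tau$ from pairs $(S,a)$ to integers such that for any two gates $U_{S,a},U_{T,b}$ with $b>a$ and $S\cap T\ne\emptyset$ one has $\tau(T,b)>\tau(S,a)$. Borrowing function (for a circuit and a causal time function $\tau$): a function $f$ from sites to sites whose image is contained in the set of sites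 having a physical qudit, such that, writing $T_j$ for the set of times $\tau(S,a)$ of gates $U_{S,a}$ with $j\in S$, and writing $T_j<T_k$ when every element of $T_j$ is smaller than every element of $T_k$: for every site $i$, (1) for any $j,k\ne i$ with $j\ne k$ and $f(j)=f(k)=i$, either $T_j<T_k$ or $T_k<T_j$; (2) for any $j\ne i$ with $f(j)=i$, either $T_j<T_i$ or $T_i<T_j$. "Ancillas may be removed": if the circuit implements $U=V\otimes I$, with $V$ acting on the physical qudits and $I$ the identity on the ancillas, then there is a quantum circuit acting only on the physical qudits that implements $V$, obtained by replacing, in every gate, the action on the ancilla of each site $j$ by the same action on the physical qudit of site $f(j)$; its depth and range are increased, but bounded in terms of those of the original circuit and the constants $c,c',d$.
   Formalization: Adds that every point of X has a point of its connected component at distance more than ℓ0 (on a one-point X a single gate can act on all sites and nothing can be borrowed); sites carry at most one physical and one ancilla qudit; the constants are stated per choice of underlying sets. *)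

theory Defs
  imports "HOL-Analysis.Analysis"
begin

section \<open>Qudits and operators\<close>

text \<open>
  A system of sites is given by the set \<open>P\<close> of sites carrying a physical qudit and the set \<open>A\<close> of
  sites carrying an ancilla qudit; the set of all sites is \<open>P \<union> A\<close>, and \<open>P\<close>, \<open>A\<close> may overlap.
  Every qudit has the same dimension \<open>q\<close>. Since borrowing refers to \<^emph>\<open>the\<close> ancilla and \<^emph>\<open>the\<close>
  physical qudit of a site, a site has at most one qudit of each label (a site with several qudits
  is to be regarded as several sites at the same point of the control space).
\<close>

datatype label = Phys | Anc

type_synonym 's qudit = "'s \<times> label"

definition phys_qudits :: "'s set \<Rightarrow> 's qudit set" where
  "phys_qudits P = P \<times> {Phys}"

definition anc_qudits :: "'s set \<Rightarrow> 's qudit set" where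
  "anc_qudits A = A \<times> {Anc}"

definition qudits :: "'s set \<Rightarrow> 's set \<Rightarrow> 's set \<Rightarrow> 's qudit set" where
  "qudits P A S = phys_qudits (S \<inter> P) \<union> anc_qudits (S \<inter> A)"

text \<open>
  The product basis of the qudits in \<open>Q\<close> is indexed by configurations, and an operator is given by
  its matrix in that basis, with zero entries outside the configurations of \<open>Q\<close>. The set \<open>Q\<close> may be
  infinite; all products formed below then have a left factor with finitely many nonzero entries in
  each row, so that the sum in \<open>op_mult\<close> is finite.
\<close>

type_synonym 's config = "'s qudit \<Rightarrow> nat"

type_synonym 's operator = "'s config \<Rightarrow> 's config \<Rightarrow> complex"

definition configs :: "nat \<Rightarrow> 's qudit set \<Rightarrow> 's config set" where
  "configs q Q = Q \<rightarrow>\<^sub>E {..<q}"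

definition is_op :: "nat \<Rightarrow> 's qudit set \<Rightarrow> 's operator \<Rightarrow> bool" where
  "is_op q Q K \<longleftrightarrow> (\<forall>\<sigma> \<tau>. K \<sigma> \<tau> \<noteq> 0 \<longrightarrow> \<sigma> \<in> configs q Q \<and> \<tau> \<in> configs q Q)"

definition op_id :: "nat \<Rightarrow> 's qudit set \<Rightarrow> 's operator" where
  "op_id q Q = (\<lambda>\<sigma> \<tau>. if \<sigma> \<in> configs q Q \<and> \<sigma> = \<tau> then 1 else 0)"

definition op_mult :: "nat \<Rightarrow> 's qudit set \<Rightarrow> 's operator \<Rightarrow> 's operator \<Rightarrow> 's operator" where
  "op_mult q Q K L = (\<lambda>\<sigma> \<tau>. \<Sum>\<rho>\<in>{\<rho> \<in> configs q Q. K \<sigma> \<rho> \<noteq> 0}. K \<sigma> \<rho> * L \<rho> \<tau>)"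

definition op_adj :: "'s operator \<Rightarrow> 's operator" where
  "op_adj K = (\<lambda>\<sigma> \<tau>. cnj (K \<tau> \<sigma>))"

definition unitary_op :: "nat \<Rightarrow> 's qudit set \<Rightarrow> 's operator \<Rightarrow> bool" where
  "unitary_op q Q K \<longleftrightarrow> is_op q Q K \<and>
     op_mult q Q K (op_adj K) = op_id q Q \<and> op_mult q Q (op_adj K) K = op_id q Q"

text \<open>\<open>K \<otimes> I\<close>, for an operator \<open>K\<close> on the qudits \<open>R \<subseteq> Q\<close> and the identity on \<open>Q - R\<close>.\<close>

definition op_ext :: "nat \<Rightarrow> 's qudit set \<Rightarrow> 's qudit set \<Rightarrow> 's operator \<Rightarrow> 's operator" where
  "op_ext q Q R K = (\<lambda>\<sigma> \<tau>.
     if \<sigma> \<in> configs q Q \<and> \<tau> \<in> configs q Q \<and> (\<forall>k\<in>Q - R. \<sigma> k = \<tau> k)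
     then K (restrict \<sigma> R) (restrict \<tau> R) else 0)"

definition local_op :: "nat \<Rightarrow> 's qudit set \<Rightarrow> 's operator \<Rightarrow> bool" where
  "local_op q Q K \<longleftrightarrow> (\<exists>F L. finite F \<and> F \<subseteq> Q \<and> is_op q F L \<and> K = op_ext q Q F L)"


section \<open>Quantum circuits\<close>

text \<open>
  The rounds are \<open>1, \<dots>, depth C\<close>; \<open>layer C a\<close> is the collection \<open>G\<^sub>a\<close> of disjoint sets of sites, and
  \<open>gate C S a\<close> is the unitary \<open>U\<^bsub>S,a\<^esub>\<close>, as an operator on the qudits of the sites in \<open>S\<close>.
\<close>

record 's circuit =
  depth :: nat
  layer :: "nat \<Rightarrow> 's set set"
  gate :: "'s set \<Rightarrow> nat \<Rightarrow> 's operator"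

definition is_circuit ::
  "nat \<Rightarrow> 's set \<Rightarrow> 's set \<Rightarrow> ('x \<Rightarrow> 'x \<Rightarrow> real) \<Rightarrow> ('s \<Rightarrow> 'x) \<Rightarrow> real \<Rightarrow> 's circuit \<Rightarrow> bool" where
  "is_circuit q P A \<delta> loc r C \<longleftrightarrow>
     (\<forall>a\<in>{1..depth C}. pairwise disjnt (layer C a) \<and>
        (\<forall>S\<in>layer C a. S \<noteq> {} \<and> finite S \<and> S \<subseteq> P \<union> A \<and>
           unitary_op q (qudits P A S) (gate C S a) \<and>
           (\<forall>i\<in>S. \<forall>j\<in>S. \<delta> (loc i) (loc j) \<le> r)))"

text \<open>
  The product of the gates of round \<open>a\<close> with support in \<open>G \<subseteq> layer C a\<close> (\<open>G\<close> finite). The supports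
  being disjoint, this is the tensor product of these gates and of the identity on all other qudits.
\<close>

definition layer_op ::
  "nat \<Rightarrow> 's set \<Rightarrow> 's set \<Rightarrow> 's circuit \<Rightarrow> nat \<Rightarrow> 's set set \<Rightarrow> 's operator" where
  "layer_op q P A C a G = (\<lambda>\<sigma> \<tau>.
     if \<sigma> \<in> configs q (qudits P A (P \<union> A)) \<and> \<tau> \<in> configs q (qudits P A (P \<union> A)) \<and>
        (\<forall>k\<in>qudits P A (P \<union> A) - qudits P A (\<Union>G). \<sigma> k = \<tau> k)
     then \<Prod>S\<in>G. gate C S a (restrict \<sigma> (qudits P A S)) (restrict \<tau> (qudits P A S)) else 0)"

text \<open>
  For finitely many sites: the unitary implemented by the first \<open>n\<close> rounds, so that
  \<open>circuit_op q P A C (depth C)\<close> is \<open>U = U\<^sub>D \<circ> \<dots> \<circ> U\<^sub>1\<close>.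
\<close>

primrec circuit_op ::
  "nat \<Rightarrow> 's set \<Rightarrow> 's set \<Rightarrow> 's circuit \<Rightarrow> nat \<Rightarrow> 's operator" where
  "circuit_op q P A C 0 = op_id q (qudits P A (P \<union> A))"
| "circuit_op q P A C (Suc n) =
     op_mult q (qudits P A (P \<union> A)) (layer_op q P A C (Suc n) (layer C (Suc n)))
       (circuit_op q P A C n)"

text \<open>
  For infinitely many sites the infinite product of gates is not an operator; the circuit acts on
  local operators \<open>K\<close> by \<open>K \<mapsto> U K U\<^sup>*\<close>. For one round this is the value at which conjugation by
  finite subproducts stabilises.
\<close>

definition layer_act ::
  "nat \<Rightarrow> 's set \<Rightarrow> 's set \<Rightarrow> 's circuit \<Rightarrow> nat \<Rightarrow> 's operator \<Rightarrow> 's operator" where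
  "layer_act q P A C a K = (THE L. \<forall>\<^sub>F G in finite_subsets_at_top (layer C a).
     op_mult q (qudits P A (P \<union> A))
       (op_mult q (qudits P A (P \<union> A)) (layer_op q P A C a G) K)
       (op_adj (layer_op q P A C a G)) = L)"

primrec circuit_act ::
  "nat \<Rightarrow> 's set \<Rightarrow> 's set \<Rightarrow> 's circuit \<Rightarrow> nat \<Rightarrow> 's operator \<Rightarrow> 's operator" where
  "circuit_act q P A C 0 K = K"
| "circuit_act q P A C (Suc n) K = layer_act q P A C (Suc n) (circuit_act q P A C n K)"

text \<open>
  The circuit implements \<open>V \<otimes> I\<close>, with \<open>V\<close> acting on the physical qudits: for finitely many sites,
  as an equation between unitaries; in general, as \<open>\<alpha> = \<beta> \<otimes> id\<close>, where \<open>\<alpha>\<close> is the action of the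
  circuit on local operators and \<open>\<beta>\<close> (conjugation by \<open>V\<close>) acts on local operators of the physical
  qudits. For finitely many sites the latter determines \<open>V\<close> only up to a phase.
\<close>

definition implements_unitary ::
  "nat \<Rightarrow> 's set \<Rightarrow> 's set \<Rightarrow> 's circuit \<Rightarrow> 's operator \<Rightarrow> bool" where
  "implements_unitary q P A C V \<longleftrightarrow> unitary_op q (phys_qudits P) V \<and>
     circuit_op q P A C (depth C) = op_ext q (qudits P A (P \<union> A)) (phys_qudits P) V"

definition implements_action ::
  "nat \<Rightarrow> 's set \<Rightarrow> 's set \<Rightarrow> 's circuit \<Rightarrow> ('s operator \<Rightarrow> 's operator) \<Rightarrow> bool" where
  "implements_action q P A C \<beta> \<longleftrightarrow>
     (\<forall>K. local_op q (phys_qudits P) K \<longrightarrow> local_op q (phys_qudits P) (\<beta> K)) \<and>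
     (\<forall>K L. local_op q (phys_qudits P) K \<longrightarrow> local_op q (anc_qudits A) L \<longrightarrow>
        (let Q = qudits P A (P \<union> A) in
           circuit_act q P A C (depth C)
             (op_mult q Q (op_ext q Q (phys_qudits P) K) (op_ext q Q (anc_qudits A) L)) =
           op_mult q Q (op_ext q Q (phys_qudits P) (\<beta> K)) (op_ext q Q (anc_qudits A) L)))"


section \<open>Causal time functions and borrowing\<close>

definition causal_time :: "'s circuit \<Rightarrow> ('s set \<Rightarrow> nat \<Rightarrow> int) \<Rightarrow> bool" where
  "causal_time C \<tau> \<longleftrightarrow>
     (\<forall>a\<in>{1..depth C}. \<forall>b\<in>{1..depth C}. \<forall>S\<in>layer C a. \<forall>T\<in>layer C b.
        a < b \<and> S \<inter> T \<noteq> {} \<longrightarrow> \<tau> S a < \<tau> T b)"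

definition site_times :: "'s circuit \<Rightarrow> ('s set \<Rightarrow> nat \<Rightarrow> int) \<Rightarrow> 's \<Rightarrow> int set" where
  "site_times C \<tau> j = {\<tau> S a |S a. a \<in> {1..depth C} \<and> S \<in> layer C a \<and> j \<in> S}"

definition all_before :: "int set \<Rightarrow> int set \<Rightarrow> bool" where
  "all_before T T' \<longleftrightarrow> (\<forall>s\<in>T. \<forall>t\<in>T'. s < t)"

definition borrowing_function ::
  "'s set \<Rightarrow> 's set \<Rightarrow> 's circuit \<Rightarrow> ('s set \<Rightarrow> nat \<Rightarrow> int) \<Rightarrow> ('s \<Rightarrow> 's) \<Rightarrow> bool" where
  "borrowing_function P A C \<tau> f \<longleftrightarrow>
     (\<forall>j\<in>P \<union> A. f j \<in> P) \<and>
     (\<forall>i\<in>P \<union> A.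
        (\<forall>j\<in>P \<union> A. \<forall>k\<in>P \<union> A. j \<noteq> i \<and> k \<noteq> i \<and> j \<noteq> k \<and> f j = i \<and> f k = i \<longrightarrow>
           all_before (site_times C \<tau> j) (site_times C \<tau> k) \<or>
           all_before (site_times C \<tau> k) (site_times C \<tau> j)) \<and>
        (\<forall>j\<in>P \<union> A. j \<noteq> i \<and> f j = i \<longrightarrow>
           all_before (site_times C \<tau> j) (site_times C \<tau> i) \<or>
           all_before (site_times C \<tau> i) (site_times C \<tau> j)))"

fun borrow_qudit :: "('s \<Rightarrow> 's) \<Rightarrow> 's qudit \<Rightarrow> 's qudit" where
  "borrow_qudit f (j, Phys) = (j, Phys)"
| "borrow_qudit f (j, Anc) = (f j, Phys)"

definition borrow_sites :: "'s set \<Rightarrow> 's set \<Rightarrow> ('s \<Rightarrow> 's) \<Rightarrow> 's set \<Rightarrow> 's set" where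
  "borrow_sites P A f S = (S \<inter> P) \<union> f ` (S \<inter> A)"

text \<open>The operator \<open>K\<close> on the qudits \<open>Q\<close>, transported along the renaming \<open>borrow_qudit f\<close>.\<close>

definition borrow_op :: "nat \<Rightarrow> 's qudit set \<Rightarrow> ('s \<Rightarrow> 's) \<Rightarrow> 's operator \<Rightarrow> 's operator" where
  "borrow_op q Q f K = (\<lambda>\<sigma> \<tau>.
     if \<sigma> \<in> configs q (borrow_qudit f ` Q) \<and> \<tau> \<in> configs q (borrow_qudit f ` Q)
     then K (restrict (\<sigma> \<circ> borrow_qudit f) Q) (restrict (\<tau> \<circ> borrow_qudit f) Q) else 0)"

text \<open>
  \<open>C'\<close> arises from \<open>C\<close> by letting every gate act on the physical qudit of \<open>f j\<close> in place of the
  ancilla of \<open>j\<close>, the gate at time \<open>t\<close> becoming part of round \<open>t\<close>. The injectivity condition says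
  that the replacement never identifies two qudits of the same gate.
\<close>

definition borrowed_circuit ::
  "nat \<Rightarrow> 's set \<Rightarrow> 's set \<Rightarrow> 's circuit \<Rightarrow> ('s set \<Rightarrow> nat \<Rightarrow> int) \<Rightarrow> ('s \<Rightarrow> 's) \<Rightarrow> 's circuit \<Rightarrow> bool" where
  "borrowed_circuit q P A C \<tau> f C' \<longleftrightarrow>
     (\<forall>t\<in>{1..depth C'}. layer C' t =
        {borrow_sites P A f S |S a. a \<in> {1..depth C} \<and> S \<in> layer C a \<and> \<tau> S a = int t}) \<and>
     (\<forall>a\<in>{1..depth C}. \<forall>S\<in>layer C a.
        1 \<le> \<tau> S a \<and> \<tau> S a \<le> int (depth C') \<and>
        inj_on (borrow_qudit f) (qudits P A S) \<and>
        gate C' (borrow_sites P A f S) (nat (\<tau> S a)) = borrow_op q (qudits P A S) f (gate C S a))"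


section \<open>Control space\<close>

definition locally_finite_map ::
  "'x set \<Rightarrow> ('x \<Rightarrow> 'x \<Rightarrow> real) \<Rightarrow> 's set \<Rightarrow> ('s \<Rightarrow> 'x) \<Rightarrow> bool" where
  "locally_finite_map X \<delta> I loc \<longleftrightarrow> loc ` I \<subseteq> X \<and>
     (\<forall>x\<in>X. \<exists>e>0. finite {s\<in>I. \<delta> x (loc s) < e})"

text \<open>
  The control space is large compared with the length \<open>R\<close>: no connected component lies within
  distance \<open>R\<close> of one of its points. (If \<open>X\<close> were, say, a single point, then one gate could
  act on all sites at once, and nothing could be borrowed.)
\<close>

definition large_space :: "'x set \<Rightarrow> ('x \<Rightarrow> 'x \<Rightarrow> real) \<Rightarrow> real \<Rightarrow> bool" where
  "large_space X \<delta> R \<longleftrightarrow>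
     (\<forall>x\<in>X. \<exists>y. connected_component_of (Metric_space.mtopology X \<delta>) x y \<and> R < \<delta> x y)"

text \<open>
  The radii are \<open>n = 1, 2, \<dots>\<close> with \<open>n \<le> R\<close>. (A real radius close to \<open>0\<close> would, for \<open>d > 1\<close>, make
  the second condition exclude all ancillas.) As \<open>card\<close> of an infinite set
  is \<open>0\<close>, infinite sets are treated explicitly.
\<close>

definition many_physical ::
  "'x set \<Rightarrow> ('x \<Rightarrow> 'x \<Rightarrow> real) \<Rightarrow> 's set \<Rightarrow> ('s \<Rightarrow> 'x) \<Rightarrow> real \<Rightarrow> real \<Rightarrow> real \<Rightarrow> bool" where
  "many_physical X \<delta> P loc c d R \<longleftrightarrow>
     (\<forall>x\<in>X. \<forall>n::nat. 1 \<le> n \<and> real n \<le> R \<longrightarrow>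
        (let N = {(s, l) \<in> phys_qudits P. \<delta> x (loc s) \<le> real n} in
           infinite N \<or> \<lfloor>c * real n powr d\<rfloor> \<le> int (card N)))"

definition few_ancillas ::
  "'x set \<Rightarrow> ('x \<Rightarrow> 'x \<Rightarrow> real) \<Rightarrow> 's set \<Rightarrow> ('s \<Rightarrow> 'x) \<Rightarrow> real \<Rightarrow> real \<Rightarrow> real \<Rightarrow> bool" where
  "few_ancillas X \<delta> A loc c' d R \<longleftrightarrow>
     (\<forall>x\<in>X. \<forall>n::nat. 1 \<le> n \<and> real n \<le> R \<longrightarrow>
        (let N = {(s, l) \<in> anc_qudits A. \<delta> x (loc s) \<in> {real n - 1..real n}} in
           finite N \<and> int (card N) \<le> \<lfloor>c' * real n powr (d - 1)\<rfloor>))"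

end

theory Submission
  imports Defs "HOL-Real_Asymp.Real_Asymp"
begin

text \<open>
  Borrowing works because an ancilla is useless during its own time window. Suppose that \<open>U\<close> commutes
  with all operators on the ancilla of \<open>j\<close> (as \<open>V \<otimes> I\<close> does), and order the gates by \<open>\<tau>\<close>. By the
  separation of times, \<open>U = U\<^sub>1 U\<^sub>2 U\<^sub>3\<close>, where \<open>U\<^sub>1\<close> and \<open>U\<^sub>3\<close> do not touch the ancilla and \<open>U\<^sub>2\<close>
  does not touch the borrowed qudit. Then \<open>U\<^sub>2\<close> also commutes with the operators on the ancilla, so it acts
  on neither of the two qudits, although its gates do, and is unchanged when they are swapped. Thus the
  ancillas are replaced one at a time without changing \<open>U\<close>. For infinitely many sites this is applied to
  finite sets of gates containing the relevant light cones.

  The borrowing function comes from a maximal separated net in the control space. The distance \<open>h\<close> to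
  the net is a delay: \<open>\<tau>\<close> is \<open>h\<close> plus a large multiple of the round, so sites whose values of \<open>h\<close> differ
  by a constant \<open>w\<close> are used at separate times. Near a net point there are of order \<open>m\<^sup>d\<close> physical
  qudits, but only of order \<open>w m\<^bsup>d-1\<^esup>\<close> ancillas compete with a given one, so a greedy choice succeeds.
\<close>

section \<open>Operators and their supports\<close>

text \<open>Three obstacles shape the proof. With infinitely many qudits a product of matrices can
  fail to be associative, because a sum over an infinite index set has the value 0; the algebra is
  therefore done with operators of finite support, where each identity reduces to finite matrices.
  That the ancillas are left alone is known only for the complete product, not for its gates.
  Replacing one ancilla at a time keeps the product equal to \<open>U\<close>, so this knowledge
  remains available for the next ancilla. With infinitely many ancillas only those in a cone of the
  new circuit are replaced, and the product is enlarged by the old cones of these ancillas; gates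
  added in this way may still act on other ancillas, which stay in place. Finally, a lender must
  itself be idle while it is borrowed, so its delay has to differ from that of the ancilla. An
  ancilla far from its net point finds such lenders close to the net point. One close to it needs
  lenders elsewhere, and that the space extends far enough to have such a place is what
  \<open>large_space\<close> provides.\<close>

definition transport ::
  "nat \<Rightarrow> 's qudit set \<Rightarrow> ('s qudit \<Rightarrow> 's qudit) \<Rightarrow> 's qudit set \<Rightarrow> 's operator \<Rightarrow> 's operator" where
  "transport q Q m F L = (\<lambda>\<sigma> \<tau>.
     if \<sigma> \<in> configs q Q \<and> \<tau> \<in> configs q Q \<and> (\<forall>k\<in>Q - m ` F. \<sigma> k = \<tau> k)
     then L (restrict (\<sigma> \<circ> m) F) (restrict (\<tau> \<circ> m) F) else 0)"

text \<open>\<open>transport\<close> combines two operations: along the identity it is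
  \<open>K \<otimes> I\<close>, along \<open>borrow_qudit f\<close> it renames qudits. Extension,
  borrowing and the swap of two qudits thus obey the same laws, proved once.\<close>

lemma op_ext_eq_transport: "op_ext q Q F L = transport q Q id F L"
  by (simp add: op_ext_def transport_def cong: if_cong)

lemma borrow_op_eq_transport:
  "borrow_op q F f L = transport q (borrow_qudit f ` F) (borrow_qudit f) F L"
  by (simp add: borrow_op_def transport_def cong: if_cong)

lemma transport_nonzeroD:
  assumes "transport q Q m F L \<sigma> \<tau> \<noteq> 0"
  shows "\<sigma> \<in> configs q Q" "\<tau> \<in> configs q Q" "\<And>k. k \<in> Q - m ` F \<Longrightarrow> \<sigma> k = \<tau> k"
proof -
  have "\<sigma> \<in> configs q Q \<and> \<tau> \<in> configs q Q \<and> (\<forall>k\<in>Q - m ` F. \<sigma> k = \<tau> k)"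
    by (rule ccontr) (use assms in \<open>simp only: transport_def if_False\<close>)
  then show "\<sigma> \<in> configs q Q" "\<tau> \<in> configs q Q" "\<And>k. k \<in> Q - m ` F \<Longrightarrow> \<sigma> k = \<tau> k" by blast+
qed

lemma transport_cong: "(\<And>k. k \<in> F \<Longrightarrow> m k = n k) \<Longrightarrow> transport q Q m F L = transport q Q n F L"
proof -
  assume a: "\<And>k. k \<in> F \<Longrightarrow> m k = n k"
  have "m ` F = n ` F" using a by (intro image_cong) auto
  moreover have "restrict (\<sigma> \<circ> m) F = restrict (\<sigma> \<circ> n) F" for \<sigma> :: "'a qudit \<Rightarrow> nat"
    using a by (auto simp: restrict_def)
  ultimately show ?thesis by (simp add: transport_def cong: if_cong)
qed

lemma pull_configs: "\<sigma> \<in> configs q Q \<Longrightarrow> m ` F \<subseteq> Q \<Longrightarrow> restrict (\<sigma> \<circ> m) F \<in> configs q F"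
  unfolding configs_def
proof (rule PiE_I)
  fix k assume "\<sigma> \<in> Q \<rightarrow>\<^sub>E {..<q}" "m ` F \<subseteq> Q" "k \<in> F"
  then show "restrict (\<sigma> \<circ> m) F k \<in> {..<q}" using PiE_mem[of \<sigma> Q "\<lambda>_. {..<q}" "m k"] by auto
qed simp

lemma configs_eqI:
  "\<sigma> \<in> configs q Q \<Longrightarrow> \<tau> \<in> configs q Q \<Longrightarrow> (\<And>k. k \<in> Q \<Longrightarrow> \<sigma> k = \<tau> k) \<Longrightarrow> \<sigma> = \<tau>"
  unfolding configs_def by (rule PiE_ext)

text \<open>Functoriality. By injectivity, \<open>m\<close> sends a qudit of \<open>F\<close>
  outside the image of \<open>E\<close> to one outside the image under the composition, so the two
  conditions of being diagonal merge into one.\<close>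

lemma transport_transport:
  assumes "inj_on m F" "n ` E \<subseteq> F" "m ` F \<subseteq> Q"
  shows "transport q Q m F (transport q F n E L) = transport q Q (m \<circ> n) E L"
proof (intro ext)
  fix \<sigma> \<tau> :: "'a config"
  have r: "restrict (restrict (\<rho> \<circ> m) F \<circ> n) E = restrict (\<rho> \<circ> (m \<circ> n)) E" for \<rho> :: "'a qudit \<Rightarrow> nat"
    using assms(2) by (auto simp: restrict_def image_subset_iff simp del: split_paired_All)
  have iff: "(\<forall>k\<in>Q - m ` F. \<sigma> k = \<tau> k) \<and> (\<forall>k\<in>F - n ` E. \<sigma> (m k) = \<tau> (m k)) \<longleftrightarrow>
      (\<forall>k\<in>Q - (m \<circ> n) ` E. \<sigma> k = \<tau> k)"
  proof
    assume l: "(\<forall>k\<in>Q - m ` F. \<sigma> k = \<tau> k) \<and> (\<forall>k\<in>F - n ` E. \<sigma> (m k) = \<tau> (m k))"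
    show "\<forall>k\<in>Q - (m \<circ> n) ` E. \<sigma> k = \<tau> k"
    proof
      fix k assume k: "k \<in> Q - (m \<circ> n) ` E"
      show "\<sigma> k = \<tau> k"
      proof (cases "k \<in> m ` F")
        case True
        then obtain k' where "k' \<in> F" "k = m k'" by auto
        then show ?thesis using l k by (auto simp: image_comp[symmetric])
      qed (use l k in auto)
    qed
  next
    assume l: "\<forall>k\<in>Q - (m \<circ> n) ` E. \<sigma> k = \<tau> k"
    have "\<sigma> (m k) = \<tau> (m k)" if "k \<in> F - n ` E" for k
    proof -
      have "m k \<notin> (m \<circ> n) ` E"
        using that assms(1,2) by (auto dest!: inj_onD[OF assms(1)])
      then show ?thesis using l that assms(3) by blast
    qed
    moreover have "(m \<circ> n) ` E \<subseteq> m ` F" using assms(2) by auto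
    ultimately show "(\<forall>k\<in>Q - m ` F. \<sigma> k = \<tau> k) \<and> (\<forall>k\<in>F - n ` E. \<sigma> (m k) = \<tau> (m k))"
      using l by blast
  qed
  show "transport q Q m F (transport q F n E L) \<sigma> \<tau> = transport q Q (m \<circ> n) E L \<sigma> \<tau>"
  proof (cases "\<sigma> \<in> configs q Q \<and> \<tau> \<in> configs q Q")
    case True
    have "(\<forall>k\<in>F - n ` E. restrict (\<sigma> \<circ> m) F k = restrict (\<tau> \<circ> m) F k) \<longleftrightarrow>
        (\<forall>k\<in>F - n ` E. \<sigma> (m k) = \<tau> (m k))" by auto
    moreover have "restrict (\<sigma> \<circ> m) F \<in> configs q F" "restrict (\<tau> \<circ> m) F \<in> configs q F"
      using True assms(3) pull_configs by blast+
    ultimately have t: "transport q F n E L (restrict (\<sigma> \<circ> m) F) (restrict (\<tau> \<circ> m) F) =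
        (if \<forall>k\<in>F - n ` E. \<sigma> (m k) = \<tau> (m k) then L (restrict (\<sigma> \<circ> (m \<circ> n)) E) (restrict (\<tau> \<circ> (m \<circ> n)) E) else 0)"
      unfolding transport_def r by presburger
    have if_merge: "(if a \<and> b \<and> c then if e then z else 0 else 0) = (if a \<and> b \<and> g then z else (0::complex))"
      if "a \<and> b" "c \<and> e \<longleftrightarrow> g" for a b c e g z using that by auto
    show ?thesis
      unfolding transport_def[of q Q] t using True iff by (rule if_merge)
  qed (auto simp: transport_def)
qed

text \<open>The reindexing behind \<open>transport_mult\<close>: the intermediate configurations in
  a product of two transported operators agree with \<sigma> off the image of \<open>F\<close>, and
  hence correspond to configurations of \<open>F\<close>. It also yields that a row of a transported
  operator has finitely many nonzero entries if \<open>F\<close> is finite.\<close>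

lemma bij_betw_pull:
  assumes "inj_on m F" "m ` F \<subseteq> Q" "\<sigma> \<in> configs q Q"
  shows "bij_betw (\<lambda>\<rho>. restrict (\<rho> \<circ> m) F) {\<rho> \<in> configs q Q. \<forall>k\<in>Q - m ` F. \<sigma> k = \<rho> k} (configs q F)"
proof (rule bij_betwI')
  fix \<rho> \<rho>'
  assume \<rho>: "\<rho> \<in> {\<rho> \<in> configs q Q. \<forall>k\<in>Q - m ` F. \<sigma> k = \<rho> k}"
    and \<rho>': "\<rho>' \<in> {\<rho> \<in> configs q Q. \<forall>k\<in>Q - m ` F. \<sigma> k = \<rho> k}"
  show "restrict (\<rho> \<circ> m) F = restrict (\<rho>' \<circ> m) F \<longleftrightarrow> \<rho> = \<rho>'"
  proof
    assume e: "restrict (\<rho> \<circ> m) F = restrict (\<rho>' \<circ> m) F"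
    show "\<rho> = \<rho>'"
    proof (rule configs_eqI[of _ q Q])
      fix k assume k: "k \<in> Q"
      show "\<rho> k = \<rho>' k"
      proof (cases "k \<in> m ` F")
        case True
        then obtain k' where "k' \<in> F" "k = m k'" by auto
        then show ?thesis using fun_cong[OF e, of k'] by simp
      next
        case False
        then show ?thesis using \<rho> \<rho>' k by (metis (mono_tags, lifting) DiffI mem_Collect_eq)
      qed
    qed (use \<rho> \<rho>' in auto)
  qed simp
next
  fix \<rho> assume "\<rho> \<in> {\<rho> \<in> configs q Q. \<forall>k\<in>Q - m ` F. \<sigma> k = \<rho> k}"
  then show "restrict (\<rho> \<circ> m) F \<in> configs q F" using pull_configs assms(2) by auto
next
  fix \<kappa> assume \<kappa>: "\<kappa> \<in> configs q F"
  define \<rho> where "\<rho> k = (if k \<in> m ` F then \<kappa> (the_inv_into F m k) else \<sigma> k)" for k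
  have "\<rho> k \<in> {..<q}" if "k \<in> Q" for k
    using that \<kappa> assms(3) the_inv_into_into[OF assms(1) _ subset_refl, of k]
    by (auto simp: configs_def \<rho>_def simp del: lessThan_iff intro: PiE_mem)
  moreover have "\<rho> k = undefined" if "k \<notin> Q" for k
  proof -
    have "k \<notin> m ` F" using that assms(2) by blast
    then show ?thesis using that assms(3) PiE_arb[of \<sigma> Q "\<lambda>_. {..<q}" k] by (simp add: \<rho>_def configs_def)
  qed
  ultimately have "\<rho> \<in> configs q Q" unfolding configs_def by (intro PiE_I)
  moreover have "restrict (\<rho> \<circ> m) F = \<kappa>"
    by (rule configs_eqI[of _ q F]) (use \<kappa> calculation assms in \<open>auto simp: \<rho>_def the_inv_into_f_f intro!: pull_configs\<close>)
  moreover have "\<forall>k\<in>Q - m ` F. \<sigma> k = \<rho> k" by (simp add: \<rho>_def)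
  ultimately show "\<exists>\<rho>\<in>{\<rho> \<in> configs q Q. \<forall>k\<in>Q - m ` F. \<sigma> k = \<rho> k}. \<kappa> = restrict (\<rho> \<circ> m) F" by auto
qed

lemma transport_mult:
  assumes "inj_on m F" "m ` F \<subseteq> Q"
  shows "op_mult q Q (transport q Q m F K) (transport q Q m F L) = transport q Q m F (op_mult q F K L)"
proof (intro ext)
  fix \<sigma> \<tau>
  let ?p = "\<lambda>\<rho>. restrict (\<rho> \<circ> m) F"
  let ?B = "{\<rho> \<in> configs q Q. \<forall>k\<in>Q - m ` F. \<sigma> k = \<rho> k}"
  show "op_mult q Q (transport q Q m F K) (transport q Q m F L) \<sigma> \<tau> = transport q Q m F (op_mult q F K L) \<sigma> \<tau>"
  proof (cases "\<sigma> \<in> configs q Q \<and> \<tau> \<in> configs q Q \<and> (\<forall>k\<in>Q - m ` F. \<sigma> k = \<tau> k)")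
    case True
    have S: "{\<rho> \<in> configs q Q. transport q Q m F K \<sigma> \<rho> \<noteq> 0} = {\<rho> \<in> ?B. K (?p \<sigma>) (?p \<rho>) \<noteq> 0}"
      using True by (auto simp: transport_def)
    have bij: "bij_betw ?p {\<rho> \<in> ?B. K (?p \<sigma>) (?p \<rho>) \<noteq> 0} {\<kappa> \<in> configs q F. K (?p \<sigma>) \<kappa> \<noteq> 0}"
      (is "bij_betw _ ?B' ?C'")
    proof (rule bij_betw_subset)
      show bp: "bij_betw ?p ?B (configs q F)" using bij_betw_pull[OF assms, of \<sigma> q] True by blast
      show "?p ` ?B' = ?C'"
      proof (intro equalityI subsetI)
        fix \<kappa> assume "\<kappa> \<in> ?C'"
        moreover then obtain \<rho> where "\<rho> \<in> ?B" "\<kappa> = ?p \<rho>" using bij_betw_imp_surj_on[OF bp] by blast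
        ultimately show "\<kappa> \<in> ?p ` ?B'" by blast
      next
        fix \<kappa> assume "\<kappa> \<in> ?p ` ?B'"
        then show "\<kappa> \<in> ?C'" using pull_configs assms(2) by blast
      qed
    qed blast
    have "op_mult q Q (transport q Q m F K) (transport q Q m F L) \<sigma> \<tau> =
        (\<Sum>\<rho>\<in>{\<rho> \<in> ?B. K (?p \<sigma>) (?p \<rho>) \<noteq> 0}. K (?p \<sigma>) (?p \<rho>) * L (?p \<rho>) (?p \<tau>))"
    proof -
      have "transport q Q m F K \<sigma> \<rho> = K (?p \<sigma>) (?p \<rho>)" "transport q Q m F L \<rho> \<tau> = L (?p \<rho>) (?p \<tau>)"
        if "\<rho> \<in> ?B" for \<rho>
        using True that by (simp_all add: transport_def)
      then show ?thesis unfolding op_mult_def S by (intro sum.cong refl) simp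
    qed
    also have "\<dots> = (\<Sum>\<kappa>\<in>{\<kappa> \<in> configs q F. K (?p \<sigma>) \<kappa> \<noteq> 0}. K (?p \<sigma>) \<kappa> * L \<kappa> (?p \<tau>))"
      by (rule sum.reindex_bij_betw[OF bij])
    finally show ?thesis using True by (simp add: transport_def op_mult_def)
  next
    case False
    have "transport q Q m F K \<sigma> \<rho> * transport q Q m F L \<rho> \<tau> = 0" for \<rho>
    proof (rule ccontr)
      assume "transport q Q m F K \<sigma> \<rho> * transport q Q m F L \<rho> \<tau> \<noteq> 0"
      then have "transport q Q m F K \<sigma> \<rho> \<noteq> 0" "transport q Q m F L \<rho> \<tau> \<noteq> 0" by simp_all
      then have "\<sigma> \<in> configs q Q" "\<tau> \<in> configs q Q" "\<forall>k\<in>Q - m ` F. \<sigma> k = \<rho> k" "\<forall>k\<in>Q - m ` F. \<rho> k = \<tau> k"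
        using transport_nonzeroD[of q Q m F K \<sigma> \<rho>] transport_nonzeroD[of q Q m F L \<rho> \<tau>] by blast+
      then show False using False by simp
    qed
    then have "op_mult q Q (transport q Q m F K) (transport q Q m F L) \<sigma> \<tau> = 0"
      unfolding op_mult_def by (intro sum.neutral) blast
    moreover have "transport q Q m F (op_mult q F K L) \<sigma> \<tau> = 0"
      using False unfolding transport_def by (rule if_not_P)
    ultimately show ?thesis by simp
  qed
qed

lemma transport_inside:
  assumes "\<sigma> \<in> configs q Q" "\<tau> \<in> configs q Q" "\<And>k. k \<in> Q - m ` F \<Longrightarrow> \<sigma> k = \<tau> k"
  shows "transport q Q m F L \<sigma> \<tau> = L (restrict (\<sigma> \<circ> m) F) (restrict (\<tau> \<circ> m) F)"
  unfolding transport_def by (rule if_P) (use assms in blast)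

lemma op_adj_transport: "op_adj (transport q Q m F K) = transport q Q m F (op_adj K)"
proof (intro ext)
  fix \<sigma> \<tau> :: "'a config"
  show "op_adj (transport q Q m F K) \<sigma> \<tau> = transport q Q m F (op_adj K) \<sigma> \<tau>"
  proof (cases "\<sigma> \<in> configs q Q \<and> \<tau> \<in> configs q Q \<and> (\<forall>k\<in>Q - m ` F. \<sigma> k = \<tau> k)")
    case True
    have s: "\<sigma> \<in> configs q Q" "\<tau> \<in> configs q Q" "\<And>k. k \<in> Q - m ` F \<Longrightarrow> \<sigma> k = \<tau> k"
      "\<And>k. k \<in> Q - m ` F \<Longrightarrow> \<tau> k = \<sigma> k" using True by (blast, blast, blast, metis)
    have "transport q Q m F K \<tau> \<sigma> = K (restrict (\<tau> \<circ> m) F) (restrict (\<sigma> \<circ> m) F)"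
      by (rule transport_inside) (use s in blast)+
    moreover have "transport q Q m F (op_adj K) \<sigma> \<tau> = op_adj K (restrict (\<sigma> \<circ> m) F) (restrict (\<tau> \<circ> m) F)"
      by (rule transport_inside) (use s in blast)+
    ultimately show ?thesis by (simp only: op_adj_def)
  next
    case False
    have "transport q Q m F K \<tau> \<sigma> = 0" "transport q Q m F (op_adj K) \<sigma> \<tau> = 0"
      using False transport_nonzeroD by (metis, metis)
    then show ?thesis by (simp add: op_adj_def)
  qed
qed

lemma transport_id_op:
  assumes "m ` F \<subseteq> Q"
  shows "transport q Q m F (op_id q F) = op_id q Q"
proof (intro ext)
  fix \<sigma> \<tau>
  have "\<sigma> = \<tau>" if "\<sigma> \<in> configs q Q" "\<tau> \<in> configs q Q" "\<forall>k\<in>Q - m ` F. \<sigma> k = \<tau> k"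
    "restrict (\<sigma> \<circ> m) F = restrict (\<tau> \<circ> m) F"
  proof (rule configs_eqI[OF that(1,2)])
    fix k assume "k \<in> Q"
    show "\<sigma> k = \<tau> k"
    proof (cases "k \<in> m ` F")
      case True
      then obtain k' where "k' \<in> F" "k = m k'" by auto
      then show ?thesis using fun_cong[OF that(4), of k'] by simp
    qed (use that(3) \<open>k \<in> Q\<close> in auto)
  qed
  note eq = this
  show "transport q Q m F (op_id q F) \<sigma> \<tau> = op_id q Q \<sigma> \<tau>"
  proof (cases "\<sigma> \<in> configs q Q \<and> \<tau> \<in> configs q Q \<and> (\<forall>k\<in>Q - m ` F. \<sigma> k = \<tau> k)")
    case True
    then have "transport q Q m F (op_id q F) \<sigma> \<tau> = op_id q F (restrict (\<sigma> \<circ> m) F) (restrict (\<tau> \<circ> m) F)"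
      unfolding transport_def by (rule if_P)
    moreover have "restrict (\<sigma> \<circ> m) F \<in> configs q F" using True assms pull_configs by blast
    moreover have "restrict (\<sigma> \<circ> m) F = restrict (\<tau> \<circ> m) F \<longleftrightarrow> \<sigma> = \<tau>" using eq True by blast
    ultimately show ?thesis using True by (simp add: op_id_def)
  next
    case False
    then have "transport q Q m F (op_id q F) \<sigma> \<tau> = 0" unfolding transport_def by (rule if_not_P)
    moreover have "\<not> (\<sigma> \<in> configs q Q \<and> \<sigma> = \<tau>)" using False by blast
    ultimately show ?thesis by (simp add: op_id_def)
  qed
qed

lemma is_op_transport: "is_op q Q (transport q Q m F K)"
  unfolding is_op_def using transport_nonzeroD(1,2) by blast

lemma unitary_transport:
  assumes "inj_on m F" "m ` F \<subseteq> Q" "unitary_op q F K"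
  shows "unitary_op q Q (transport q Q m F K)"
  using assms by (simp add: unitary_op_def is_op_transport op_adj_transport transport_mult transport_id_op)

lemma transport_self: "is_op q F K \<Longrightarrow> transport q F id F K = K"
proof (intro ext)
  fix \<sigma> \<tau> assume K: "is_op q F K"
  have "restrict \<sigma> F = \<sigma>" if "\<sigma> \<in> configs q F" for \<sigma>
    using that by (auto simp: configs_def PiE_def extensional_restrict)
  then show "transport q F id F K \<sigma> \<tau> = K \<sigma> \<tau>"
    using K by (auto simp: transport_def is_op_def)
qed

section \<open>Operators of finite support and their algebra\<close>

definition supported :: "nat \<Rightarrow> 's qudit set \<Rightarrow> 's qudit set \<Rightarrow> 's operator \<Rightarrow> bool" where
  "supported q Q F K \<longleftrightarrow> finite F \<and> F \<subseteq> Q \<and> (\<exists>L. is_op q F L \<and> K = transport q Q id F L)"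

lemma local_op_iff: "local_op q Q K \<longleftrightarrow> (\<exists>F. supported q Q F K)"
  by (auto simp: local_op_def supported_def op_ext_eq_transport)

lemma supported_local: "supported q Q F K \<Longrightarrow> local_op q Q K"
  by (auto simp: local_op_iff)

lemma supported_transport:
  assumes "finite F" "m ` F \<subseteq> Q" "inj_on m F"
  shows "supported q Q (m ` F) (transport q Q m F L)"
proof -
  have "transport q Q m F L = transport q Q id (m ` F) (transport q (m ` F) m F L)"
    using assms by (subst transport_transport) auto
  then show ?thesis using assms is_op_transport by (force simp: supported_def)
qed

lemma supported_mono:
  assumes "supported q Q F K" "F \<subseteq> G" "finite G" "G \<subseteq> Q"
  shows "supported q Q G K"
proof -
  obtain L where L: "K = transport q Q id F L" using assms by (auto simp: supported_def)
  have "K = transport q Q id G (transport q G id F L)"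
    unfolding L using assms by (subst transport_transport) auto
  then show ?thesis using assms(3,4) is_op_transport unfolding supported_def by blast
qed

lemma supported_mult:
  assumes "supported q Q F K" "supported q Q F L"
  shows "supported q Q F (op_mult q Q K L)"
proof -
  obtain K' L' where "K = transport q Q id F K'" "L = transport q Q id F L'"
    using assms by (auto simp: supported_def)
  then have "op_mult q Q K L = transport q Q id F (op_mult q F K' L')"
    using assms by (simp add: transport_mult supported_def)
  moreover have "transport q Q id F X = transport q Q id F (transport q F id F X)" for X
    using assms by (subst transport_transport) (auto simp: supported_def)
  ultimately show ?thesis using assms(1) is_op_transport unfolding supported_def by metis
qed

lemma is_op_adj: "is_op q F L \<Longrightarrow> is_op q F (op_adj L)"
  by (auto simp: is_op_def op_adj_def)

lemma supported_adj: "supported q Q F K \<Longrightarrow> supported q Q F (op_adj K)"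
  by (auto simp: supported_def op_adj_transport intro: is_op_adj)

lemma is_op_id: "is_op q Q (op_id q Q)"
  by (auto simp: is_op_def op_id_def)

lemma supported_id: "finite F \<Longrightarrow> F \<subseteq> Q \<Longrightarrow> supported q Q F (op_id q Q)"
  using transport_id_op[of id F Q q] is_op_id by (auto simp: supported_def intro!: exI[of _ "op_id q F"])

lemma op_mult_finite:
  assumes "finite F"
  shows "op_mult q F K L \<sigma> \<tau> = (\<Sum>\<rho>\<in>configs q F. K \<sigma> \<rho> * L \<rho> \<tau>)"
  unfolding op_mult_def using assms
  by (intro sum.mono_neutral_left) (auto simp: configs_def intro!: finite_PiE)

lemma op_mult_assoc_finite:
  assumes "finite F"
  shows "op_mult q F (op_mult q F K L) M = op_mult q F K (op_mult q F L M)"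
  unfolding fun_eq_iff op_mult_finite[OF assms] sum_distrib_left sum_distrib_right
  by (auto simp: mult.assoc intro: sum.swap)

lemma op_mult_id_finite:
  assumes "finite F" "is_op q F K"
  shows "op_mult q F (op_id q F) K = K" "op_mult q F K (op_id q F) = K"
proof -
  have fin: "finite (configs q F)" using assms by (auto simp: configs_def intro!: finite_PiE)
  have "(\<Sum>\<rho>\<in>configs q F. op_id q F \<sigma> \<rho> * K \<rho> \<tau>) = K \<sigma> \<tau>" for \<sigma> \<tau>
  proof -
    have "(\<Sum>\<rho>\<in>configs q F. op_id q F \<sigma> \<rho> * K \<rho> \<tau>) = (\<Sum>\<rho>\<in>configs q F. if \<rho> = \<sigma> then K \<sigma> \<tau> else 0)"
      by (intro sum.cong) (auto simp: op_id_def)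
    then show ?thesis using fin assms by (auto simp: is_op_def)
  qed
  then show "op_mult q F (op_id q F) K = K" using assms by (simp add: fun_eq_iff op_mult_finite)
  have "(\<Sum>\<rho>\<in>configs q F. K \<sigma> \<rho> * op_id q F \<rho> \<tau>) = K \<sigma> \<tau>" for \<sigma> \<tau>
  proof -
    have "(\<Sum>\<rho>\<in>configs q F. K \<sigma> \<rho> * op_id q F \<rho> \<tau>) = (\<Sum>\<rho>\<in>configs q F. if \<rho> = \<tau> then K \<sigma> \<tau> else 0)"
      by (intro sum.cong) (auto simp: op_id_def)
    then show ?thesis using fin assms by (auto simp: is_op_def)
  qed
  then show "op_mult q F K (op_id q F) = K" using assms by (simp add: fun_eq_iff op_mult_finite)
qed

lemma op_adj_mult_finite:
  assumes "finite F"
  shows "op_adj (op_mult q F K L) = op_mult q F (op_adj L) (op_adj K)"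
  using assms by (simp add: fun_eq_iff op_mult_finite op_adj_def mult.commute)

lemma supported_Un:
  assumes "supported q Q F K" "supported q Q G L"
  shows "supported q Q (F \<union> G) K" "supported q Q (F \<union> G) L"
proof -
  have "finite (F \<union> G)" "F \<union> G \<subseteq> Q" using assms by (auto simp: supported_def)
  then show "supported q Q (F \<union> G) K" "supported q Q (F \<union> G) L"
    using supported_mono[OF assms(1)] supported_mono[OF assms(2)] by auto
qed

lemma local_mult: "local_op q Q K \<Longrightarrow> local_op q Q L \<Longrightarrow> local_op q Q (op_mult q Q K L)"
  unfolding local_op_iff using supported_Un supported_mult by metis

lemma local_adj: "local_op q Q K \<Longrightarrow> local_op q Q (op_adj K)"
  unfolding local_op_iff using supported_adj by metis

lemma local_id: "local_op q Q (op_id q Q)"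
  unfolding local_op_iff using supported_id by blast

text \<open>The three supports lie in one finite set, where this is associativity of finite
  matrices. The unit laws and the adjoint of a product follow by the same reduction.\<close>

lemma local_assoc:
  assumes "local_op q Q K" "local_op q Q L" "local_op q Q M"
  shows "op_mult q Q (op_mult q Q K L) M = op_mult q Q K (op_mult q Q L M)"
proof -
  obtain F G H where "supported q Q F K" "supported q Q G L" "supported q Q H M"
    using assms by (auto simp: local_op_iff)
  then have s: "supported q Q (F \<union> G \<union> H) K" "supported q Q (F \<union> G \<union> H) L" "supported q Q (F \<union> G \<union> H) M"
    using supported_Un by metis+
  then obtain K' L' M' where "K = transport q Q id (F \<union> G \<union> H) K'" "L = transport q Q id (F \<union> G \<union> H) L'"
    "M = transport q Q id (F \<union> G \<union> H) M'" unfolding supported_def by blast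
  moreover have "finite (F \<union> G \<union> H)" "F \<union> G \<union> H \<subseteq> Q" using s(1) by (simp_all only: supported_def)
  ultimately show ?thesis by (simp add: transport_mult op_mult_assoc_finite)
qed

lemma local_mult_id:
  assumes "local_op q Q K"
  shows "op_mult q Q (op_id q Q) K = K" "op_mult q Q K (op_id q Q) = K"
proof -
  obtain F L where F: "finite F" "F \<subseteq> Q" "is_op q F L" "K = transport q Q id F L"
    using assms by (auto simp: local_op_iff supported_def)
  have "op_id q Q = transport q Q id F (op_id q F)" using F by (simp add: transport_id_op)
  then show "op_mult q Q (op_id q Q) K = K" "op_mult q Q K (op_id q Q) = K"
    using F by (simp_all add: transport_mult op_mult_id_finite)
qed

lemma op_adj_mult:
  assumes "local_op q Q K" "local_op q Q L"
  shows "op_adj (op_mult q Q K L) = op_mult q Q (op_adj L) (op_adj K)"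
proof -
  obtain F G where "supported q Q F K" "supported q Q G L" using assms by (auto simp: local_op_iff)
  then have s: "supported q Q (F \<union> G) K" "supported q Q (F \<union> G) L" using supported_Un by metis+
  then obtain K' L' where "K = transport q Q id (F \<union> G) K'" "L = transport q Q id (F \<union> G) L'"
    unfolding supported_def by blast
  moreover have "finite (F \<union> G)" "F \<union> G \<subseteq> Q" using s(1) by (simp_all only: supported_def)
  ultimately show ?thesis by (simp add: transport_mult op_adj_mult_finite op_adj_transport)
qed

text \<open>Exactly one intermediate configuration can contribute: it has the values of \<tau> on
  \<open>F\<close> and those of \<sigma> elsewhere. The resulting formula treats the two factors
  symmetrically, whence \<open>disjoint_commute\<close>.\<close>

lemma op_mult_disjoint:
  assumes "finite F" "F \<subseteq> Q" "G \<subseteq> Q" "F \<inter> G = {}"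
  shows "op_mult q Q (transport q Q id F K) (transport q Q id G L) = (\<lambda>\<sigma> \<tau>.
     if \<sigma> \<in> configs q Q \<and> \<tau> \<in> configs q Q \<and> (\<forall>k\<in>Q - (F \<union> G). \<sigma> k = \<tau> k)
     then K (restrict \<sigma> F) (restrict \<tau> F) * L (restrict \<sigma> G) (restrict \<tau> G) else 0)"
proof (intro ext)
  fix \<sigma> \<tau>
  let ?K = "transport q Q id F K" and ?L = "transport q Q id G L"
  let ?S = "{\<rho> \<in> configs q Q. ?K \<sigma> \<rho> \<noteq> 0}"
  let ?c = "\<sigma> \<in> configs q Q \<and> \<tau> \<in> configs q Q \<and> (\<forall>k\<in>Q - (F \<union> G). \<sigma> k = \<tau> k)"
  define \<rho>0 where "\<rho>0 k = (if k \<in> F then \<tau> k else \<sigma> k)" for k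
  have zero: "?K \<sigma> \<rho> * ?L \<rho> \<tau> = 0" if "\<not> ?c \<or> \<rho> \<noteq> \<rho>0" for \<rho>
  proof (rule ccontr)
    assume "?K \<sigma> \<rho> * ?L \<rho> \<tau> \<noteq> 0"
    then have "?K \<sigma> \<rho> \<noteq> 0" "?L \<rho> \<tau> \<noteq> 0" by simp_all
    then have *: "\<sigma> \<in> configs q Q" "\<rho> \<in> configs q Q" "\<tau> \<in> configs q Q" "\<forall>k\<in>Q - F. \<sigma> k = \<rho> k" "\<forall>k\<in>Q - G. \<rho> k = \<tau> k"
      using transport_nonzeroD(3)[of q Q id F K \<sigma> \<rho>] transport_nonzeroD(3)[of q Q id G L \<rho> \<tau>]
        transport_nonzeroD(1,2)[of q Q id F K \<sigma> \<rho>] transport_nonzeroD(1,2)[of q Q id G L \<rho> \<tau>]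
      by simp_all
    have "\<rho> k = \<rho>0 k" for k
    proof (cases "k \<in> Q")
      case True
      have "\<rho> k = \<tau> k" if "k \<in> F" using that * True assms(4) by blast
      moreover have "\<rho> k = \<sigma> k" if "k \<notin> F" using that * True by simp
      ultimately show ?thesis by (simp add: \<rho>0_def)
    next
      case False
      then have "\<rho> k = undefined" "\<sigma> k = undefined" 
        using * False PiE_arb[of \<rho> Q "\<lambda>_. {..<q}" k] PiE_arb[of \<sigma> Q "\<lambda>_. {..<q}" k]
        by (simp_all add: configs_def)
      then show ?thesis using False assms by (auto simp: \<rho>0_def)
    qed
    moreover have ?c using * by simp
    ultimately show False using that by blast
  qed
  show "op_mult q Q ?K ?L \<sigma> \<tau> =
     (if ?c then K (restrict \<sigma> F) (restrict \<tau> F) * L (restrict \<sigma> G) (restrict \<tau> G) else 0)"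
  proof (cases ?c)
    case True
    \<comment> \<open>Needed even though only one summand is nonzero: over an infinite index set the
      sum would be 0.\<close>
    have fin: "finite ?S"
    proof (rule finite_subset)
      show "?S \<subseteq> {\<rho> \<in> configs q Q. \<forall>k\<in>Q - id ` F. \<sigma> k = \<rho> k}"
        using transport_nonzeroD(3)[of q Q id F K \<sigma>] by blast
      have "finite (configs q F)" using assms by (auto simp: configs_def intro!: finite_PiE)
      then show "finite {\<rho> \<in> configs q Q. \<forall>k\<in>Q - id ` F. \<sigma> k = \<rho> k}"
        using bij_betw_finite[OF bij_betw_pull[of id F Q \<sigma> q]] assms True by auto
    qed
    have c0: "\<rho>0 \<in> configs q Q" using True assms by (auto simp: configs_def \<rho>0_def PiE_def Pi_def extensional_def)
    have r: "restrict \<rho>0 F = restrict \<tau> F" "restrict \<rho>0 G = restrict \<sigma> G"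
      using assms(4) by (auto intro!: restrict_ext simp: \<rho>0_def)
    have "\<forall>k\<in>Q - F. \<sigma> k = \<rho>0 k" "\<forall>k\<in>Q - G. \<rho>0 k = \<tau> k" using True by (auto simp: \<rho>0_def)
    then have K0: "?K \<sigma> \<rho>0 = K (restrict \<sigma> F) (restrict \<tau> F)" and L0: "?L \<rho>0 \<tau> = L (restrict \<sigma> G) (restrict \<tau> G)"
      using True c0 r by (simp_all add: transport_def)
    have "op_mult q Q ?K ?L \<sigma> \<tau> = (\<Sum>\<rho>\<in>?S. if \<rho> = \<rho>0 then ?K \<sigma> \<rho>0 * ?L \<rho>0 \<tau> else 0)"
      unfolding op_mult_def using zero by (intro sum.cong) auto
    also have "\<dots> = ?K \<sigma> \<rho>0 * ?L \<rho>0 \<tau>" using fin c0 by auto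
    finally show ?thesis using True K0 L0 by simp
  next
    case False
    then have "op_mult q Q ?K ?L \<sigma> \<tau> = 0" unfolding op_mult_def by (intro sum.neutral ballI zero) blast
    then show ?thesis using False by (simp only: if_False)
  qed
qed

lemma disjoint_commute:
  assumes "supported q Q F K" "supported q Q G L" "F \<inter> G = {}"
  shows "op_mult q Q K L = op_mult q Q L K"
proof -
  obtain K' L' where *: "K = transport q Q id F K'" "L = transport q Q id G L'"
    using assms by (auto simp: supported_def)
  show ?thesis unfolding * using assms
    by (subst (1 2) op_mult_disjoint) (auto simp: supported_def Un_commute mult.commute fun_eq_iff)
qed

text \<open>A criterion on matrix entries: diagonal off \<open>F\<close>, and determined by the
  values in \<open>F\<close>. The local matrix is read off after filling up configurations of
  \<open>F\<close> with the value 0, which is admissible because \<open>1 \<le> q\<close>.\<close>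

lemma supportedI:
  assumes "1 \<le> q" "finite F" "F \<subseteq> Q" "is_op q Q K"
    and "\<And>\<sigma> \<tau> k. K \<sigma> \<tau> \<noteq> 0 \<Longrightarrow> k \<in> Q - F \<Longrightarrow> \<sigma> k = \<tau> k"
    and "\<And>\<sigma> \<tau> \<sigma>' \<tau>'. {\<sigma>, \<tau>, \<sigma>', \<tau>'} \<subseteq> configs q Q \<Longrightarrow>
      (\<And>k. k \<in> Q - F \<Longrightarrow> \<sigma> k = \<tau> k \<and> \<sigma>' k = \<tau>' k) \<Longrightarrow> (\<And>k. k \<in> F \<Longrightarrow> \<sigma> k = \<sigma>' k \<and> \<tau> k = \<tau>' k) \<Longrightarrow> K \<sigma> \<tau> = K \<sigma>' \<tau>'"
  shows "supported q Q F K"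
proof -
  define e :: "'a config \<Rightarrow> 'a config" where "e \<sigma> k = (if k \<in> F then \<sigma> k else if k \<in> Q then 0 else undefined)" for \<sigma> k
  have e: "e \<sigma> \<in> configs q Q" if "\<sigma> \<in> configs q F" for \<sigma>
    using that assms(1,3) by (auto simp: configs_def e_def PiE_def Pi_def extensional_def)
  have e1: "e (restrict \<sigma> F) k = \<sigma> k" if "k \<in> F" for \<sigma> k using that by (simp add: e_def)
  have e2: "e \<sigma> k = e \<tau> k" if "k \<in> Q - F" for \<sigma> \<tau> k using that by (simp add: e_def)
  have r: "restrict \<sigma> F \<in> configs q F" if "\<sigma> \<in> configs q Q" for \<sigma>
    using pull_configs[of \<sigma> q Q id F] that assms(3) by simp
  define L where "L \<sigma> \<tau> = (if \<sigma> \<in> configs q F \<and> \<tau> \<in> configs q F then K (e \<sigma>) (e \<tau>) else 0)" for \<sigma> \<tau>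
  have "K \<sigma> \<tau> = transport q Q id F L \<sigma> \<tau>" for \<sigma> \<tau>
  proof (cases "\<sigma> \<in> configs q Q \<and> \<tau> \<in> configs q Q \<and> (\<forall>k\<in>Q - F. \<sigma> k = \<tau> k)")
    case True
    have "K \<sigma> \<tau> = K (e (restrict \<sigma> F)) (e (restrict \<tau> F))"
      by (rule assms(6)) (use True e r e1 e2 in auto)
    then show ?thesis using True r by (simp add: transport_def L_def)
  next
    case False
    then have "K \<sigma> \<tau> = 0" using assms(4,5) unfolding is_op_def by blast
    then show ?thesis using False by (auto simp: transport_def)
  qed
  moreover have "is_op q F L" by (auto simp: is_op_def L_def)
  ultimately show ?thesis using assms(2,3) unfolding supported_def by blast
qed

section \<open>Ordered products and substitution of qudits\<close>

abbreviation commutes :: "nat \<Rightarrow> 's qudit set \<Rightarrow> 's operator \<Rightarrow> 's operator \<Rightarrow> bool" where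
  "commutes q Q K L \<equiv> op_mult q Q K L = op_mult q Q L K"

text \<open>The head of the list is the leftmost factor and acts last, so lists of gates are kept in
  order of decreasing time.\<close>

definition opprod :: "nat \<Rightarrow> 's qudit set \<Rightarrow> ('g \<Rightarrow> 's operator) \<Rightarrow> 'g list \<Rightarrow> 's operator" where
  "opprod q Q E gs = foldr (\<lambda>g. op_mult q Q (E g)) gs (op_id q Q)"

lemma opprod_simps [simp]:
  "opprod q Q E [] = op_id q Q"
  "opprod q Q E (g # gs) = op_mult q Q (E g) (opprod q Q E gs)"
  by (simp_all add: opprod_def)

lemma opprod_cong: "(\<And>g. g \<in> set gs \<Longrightarrow> E g = E' g) \<Longrightarrow> opprod q Q E gs = opprod q Q E' gs"
  by (induction gs) auto

lemma opprod_local: "(\<And>g. g \<in> set gs \<Longrightarrow> local_op q Q (E g)) \<Longrightarrow> local_op q Q (opprod q Q E gs)"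
  by (induction gs) (auto intro: local_id local_mult)

lemma opprod_supported:
  "finite F \<Longrightarrow> F \<subseteq> Q \<Longrightarrow> (\<And>g. g \<in> set gs \<Longrightarrow> supported q Q F (E g)) \<Longrightarrow> supported q Q F (opprod q Q E gs)"
  by (induction gs) (auto intro: supported_id supported_mult)

lemma opprod_append:
  assumes "\<And>g. g \<in> set (gs @ hs) \<Longrightarrow> local_op q Q (E g)"
  shows "opprod q Q E (gs @ hs) = op_mult q Q (opprod q Q E gs) (opprod q Q E hs)"
  using assms
proof (induction gs)
  case (Cons g gs)
  then have "local_op q Q (opprod q Q E gs)" "local_op q Q (opprod q Q E hs)" by (auto intro: opprod_local)
  then show ?case using Cons by (simp add: local_assoc)
qed (simp add: local_mult_id opprod_local)

lemma commutes_id: "local_op q Q K \<Longrightarrow> commutes q Q K (op_id q Q)"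
  by (simp add: local_mult_id)

lemma commutes_mult:
  assumes "local_op q Q K" "local_op q Q L" "local_op q Q M" "commutes q Q M K" "commutes q Q M L"
  shows "commutes q Q M (op_mult q Q K L)"
proof -
  have "op_mult q Q M (op_mult q Q K L) = op_mult q Q (op_mult q Q K M) L"
    using assms by (simp add: local_assoc[symmetric])
  also have "\<dots> = op_mult q Q (op_mult q Q K L) M" using assms by (simp add: local_assoc)
  finally show ?thesis .
qed

lemma commutes_opprod:
  assumes "local_op q Q M" "\<And>g. g \<in> set gs \<Longrightarrow> local_op q Q (E g) \<and> commutes q Q M (E g)"
  shows "commutes q Q M (opprod q Q E gs)"
  using assms(2)
proof (induction gs)
  case (Cons g gs)
  then show ?case using assms(1) by (auto intro!: commutes_mult opprod_local)
qed (use assms in \<open>simp add: commutes_id\<close>)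

lemma opprod_move_front:
  assumes "\<And>g. g \<in> set (gs @ x # hs) \<Longrightarrow> local_op q Q (E g)"
    and "\<And>g. g \<in> set gs \<Longrightarrow> commutes q Q (E x) (E g)"
  shows "opprod q Q E (gs @ x # hs) = op_mult q Q (E x) (opprod q Q E (gs @ hs))"
proof -
  have l: "local_op q Q (opprod q Q E gs)" "local_op q Q (opprod q Q E hs)" "local_op q Q (E x)"
    using assms(1) by (auto intro: opprod_local)
  have c: "commutes q Q (E x) (opprod q Q E gs)" using assms by (intro commutes_opprod) auto
  have "opprod q Q E (gs @ x # hs) = op_mult q Q (op_mult q Q (opprod q Q E gs) (E x)) (opprod q Q E hs)"
    using opprod_append[of gs "x # hs" q Q E] assms(1) l by (simp add: local_assoc)
  also have "\<dots> = op_mult q Q (E x) (opprod q Q E (gs @ hs))"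
    unfolding c[symmetric] using opprod_append[of gs hs q Q E] assms(1) l by (simp add: local_assoc)
  finally show ?thesis .
qed

text \<open>Let \<open>x\<close> be the head of the first list, and let \<open>y\<close> stand
  before \<open>x\<close> in the second. The first list puts \<open>s y\<close> at most at
  \<open>s x\<close>, the second puts \<open>t x\<close> at most at \<open>t y\<close>. This
  excludes both strict alternatives, so \<open>x\<close> commutes with \<open>y\<close> and can be
  moved to the front.\<close>

lemma opprod_reorder:
  fixes s t :: "'g \<Rightarrow> 'a::linorder"
  assumes "distinct gs" "distinct hs" "set gs = set hs"
    and "sorted_wrt (\<lambda>x y. s y \<le> s x) gs" "sorted_wrt (\<lambda>x y. t y \<le> t x) hs"
    and "\<And>g. g \<in> set gs \<Longrightarrow> local_op q Q (E g)"
    and "\<And>x y. x \<in> set gs \<Longrightarrow> y \<in> set gs \<Longrightarrow> x \<noteq> y \<Longrightarrow>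
      commutes q Q (E x) (E y) \<or> s x < s y \<and> t x < t y \<or> s y < s x \<and> t y < t x"
  shows "opprod q Q E gs = opprod q Q E hs"
  using assms
proof (induction gs arbitrary: hs)
  case (Cons x gs)
  obtain h1 h2 where hs: "hs = h1 @ x # h2" using Cons.prems(3) by (metis list.set_intros(1) split_list)
  have "opprod q Q E hs = op_mult q Q (E x) (opprod q Q E (h1 @ h2))"
    unfolding hs
  proof (rule opprod_move_front)
    show "local_op q Q (E g)" if "g \<in> set (h1 @ x # h2)" for g using that Cons.prems(3,6) hs by blast
    fix y assume y: "y \<in> set h1"
    then have "y \<in> set gs" "y \<noteq> x" using Cons.prems(2,3) hs by auto
    moreover have "t x \<le> t y" using Cons.prems(5) y unfolding hs by (simp add: sorted_wrt_append)
    moreover have "s y \<le> s x" using Cons.prems(4) calculation(1) by simp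
    ultimately show "commutes q Q (E x) (E y)" using Cons.prems(7)[of x y] by auto
  qed
  also have "opprod q Q E (h1 @ h2) = opprod q Q E gs"
  proof (rule Cons.IH[symmetric])
    show "sorted_wrt (\<lambda>x y. t y \<le> t x) (h1 @ h2)"
      using Cons.prems(5) unfolding hs by (simp add: sorted_wrt_append)
    show "set gs = set (h1 @ h2)" using Cons.prems(1,2,3) hs by auto
    show "local_op q Q (E g)" if "g \<in> set gs" for g using that Cons.prems(6) by simp
    show "commutes q Q (E y) (E z) \<or> s y < s z \<and> t y < t z \<or> s z < s y \<and> t z < t y"
      if "y \<in> set gs" "z \<in> set gs" "y \<noteq> z" for y z using that by (intro Cons.prems(7)) auto
  qed (use Cons.prems(1,2,4) hs in \<open>simp_all\<close>)
  finally show ?case by simp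
qed simp

section \<open>Unitarity, cancellation and commutants\<close>

lemma unitary_op_mult:
  assumes "local_op q Q K" "local_op q Q L" "unitary_op q Q K" "unitary_op q Q L"
  shows "unitary_op q Q (op_mult q Q K L)"
proof -
  have l: "local_op q Q (op_adj K)" "local_op q Q (op_adj L)" using assms local_adj by auto
  have "op_mult q Q (op_mult q Q K L) (op_mult q Q (op_adj L) (op_adj K)) =
      op_mult q Q K (op_mult q Q (op_mult q Q L (op_adj L)) (op_adj K))"
    using assms l by (simp add: local_assoc local_mult)
  moreover have "op_mult q Q (op_mult q Q (op_adj L) (op_adj K)) (op_mult q Q K L) =
      op_mult q Q (op_adj L) (op_mult q Q (op_mult q Q (op_adj K) K) L)"
    using assms l by (simp add: local_assoc local_mult)
  moreover have "is_op q Q (op_mult q Q K L)"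
    using local_mult[OF assms(1,2)] is_op_transport by (auto simp: local_op_iff supported_def)
  ultimately show ?thesis using assms l
    by (simp add: unitary_op_def op_adj_mult local_mult_id)
qed

lemma unitary_op_id: "unitary_op q Q (op_id q Q)"
proof -
  have "op_adj (op_id q Q) = op_id q Q"
    unfolding op_adj_def op_id_def by (intro ext) (metis complex_cnj_one complex_cnj_zero)
  then show ?thesis by (simp add: unitary_op_def is_op_id local_mult_id local_id)
qed

lemma opprod_unitary:
  "(\<And>g. g \<in> set gs \<Longrightarrow> local_op q Q (E g) \<and> unitary_op q Q (E g)) \<Longrightarrow> unitary_op q Q (opprod q Q E gs)"
  by (induction gs) (auto intro!: unitary_op_id unitary_op_mult opprod_local)

lemma unitary_cancel_left:
  assumes "unitary_op q Q U" "local_op q Q U" "local_op q Q K" "local_op q Q L"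
    and "op_mult q Q U K = op_mult q Q U L"
  shows "K = L"
proof -
  have "op_mult q Q (op_adj U) (op_mult q Q U M) = M" if "local_op q Q M" for M
    using assms(1,2) that by (simp add: local_assoc[symmetric] local_adj unitary_op_def local_mult_id)
  then show ?thesis using assms(3-5) by metis
qed

lemma unitary_cancel_right:
  assumes "unitary_op q Q U" "local_op q Q U" "local_op q Q K" "local_op q Q L"
    and "op_mult q Q K U = op_mult q Q L U"
  shows "K = L"
proof -
  have "op_mult q Q (op_mult q Q M U) (op_adj U) = M" if "local_op q Q M" for M
    using assms(1,2) that by (simp add: local_assoc local_adj unitary_op_def local_mult_id)
  then show ?thesis using assms(3-5) by metis
qed

text \<open>The commutant of the full matrix algebra of one tensor factor is the algebra of the
  remaining factors. It suffices to compare entries of the commutators with the matrix units at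
  \<open>k\<close>.\<close>

lemma supported_off_commutant:
  assumes q: "1 \<le> q" and K: "supported q Q F K" and k: "k \<in> Q"
    and comm: "\<And>M. supported q Q {k} M \<Longrightarrow> commutes q Q K M"
  shows "supported q Q (F - {k}) K"
proof -
  obtain K' where F: "finite F" "F \<subseteq> Q" and K': "K = transport q Q id F K'"
    using K by (auto simp: supported_def)
  \<comment> \<open>The matrix unit that maps the basis state \<open>b\<close> of the qudit
    \<open>k\<close> to \<open>a\<close>.\<close>
  define e :: "nat \<Rightarrow> nat \<Rightarrow> 'a operator" where
    "e a b = transport q Q id {k} (\<lambda>\<sigma> \<tau>. if \<sigma> k = a \<and> \<tau> k = b then 1 else 0)" for a b
  have e: "e a b \<sigma> \<tau> = (if \<sigma> = \<tau>(k := a) \<and> \<tau> k = b then 1 else 0)"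
    if "\<sigma> \<in> configs q Q" "\<tau> \<in> configs q Q" for a b \<sigma> \<tau>
  proof (cases "\<forall>l\<in>Q - {k}. \<sigma> l = \<tau> l")
    case True
    have "\<sigma> l = (\<tau>(k := a)) l" if "\<sigma> k = a" for l
    proof (cases "l \<in> Q")
      case False
      then show ?thesis using k that \<open>\<sigma> \<in> _\<close> \<open>\<tau> \<in> _\<close> PiE_arb[of \<sigma> Q "\<lambda>_. {..<q}" l] PiE_arb[of \<tau> Q "\<lambda>_. {..<q}" l]
        by (auto simp: configs_def)
    qed (use True that in auto)
    then have "\<sigma> = \<tau>(k := a) \<longleftrightarrow> \<sigma> k = a" by (metis fun_upd_same ext)
    moreover have "e a b \<sigma> \<tau> = (if \<sigma> k = a \<and> \<tau> k = b then 1 else 0)"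
      unfolding e_def using True that by (subst transport_inside) auto
    ultimately show ?thesis by simp
  next
    case False
    then have "e a b \<sigma> \<tau> = 0" unfolding e_def using transport_nonzeroD(3)[of q Q id "{k}" _ \<sigma> \<tau>] by auto
    moreover have "\<sigma> \<noteq> \<tau>(k := a)" using False by auto
    ultimately show ?thesis by simp
  qed
  have upd: "\<tau>(k := a) \<in> configs q Q" if "\<tau> \<in> configs q Q" "a < q" for \<tau> a
    using that PiE_fun_upd[of a "\<lambda>_. {..<q}" k \<tau> Q] by (simp add: configs_def insert_absorb[OF k])
  have isop: "is_op q Q K" unfolding K' by (rule is_op_transport)
  have fin: "finite {\<rho> \<in> configs q Q. K \<sigma> \<rho> \<noteq> 0}" for \<sigma>
  proof (cases "\<sigma> \<in> configs q Q")
    case True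
    have "{\<rho> \<in> configs q Q. K \<sigma> \<rho> \<noteq> 0} \<subseteq> {\<rho> \<in> configs q Q. \<forall>k\<in>Q - id ` F. \<sigma> k = \<rho> k}"
      using transport_nonzeroD(3)[of q Q id F K' \<sigma>] unfolding K' by blast
    moreover have "finite (configs q F)" using F by (simp add: configs_def finite_PiE)
    ultimately show ?thesis using bij_betw_finite[OF bij_betw_pull[of id F Q \<sigma> q]] F True
      by (simp add: finite_subset)
  next
    case False
    then have "{\<rho> \<in> configs q Q. K \<sigma> \<rho> \<noteq> 0} = {}" using isop unfolding is_op_def by blast
    then show ?thesis by (simp only: finite.emptyI)
  qed
  have Ke: "op_mult q Q K (e a b) \<sigma> \<tau> = (if \<tau> k = b then K \<sigma> (\<tau>(k := a)) else 0)"
    if "\<sigma> \<in> configs q Q" "\<tau> \<in> configs q Q" "a < q" for a b \<sigma> \<tau>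
  proof -
    have "op_mult q Q K (e a b) \<sigma> \<tau> =
       (\<Sum>\<rho>\<in>{\<rho> \<in> configs q Q. K \<sigma> \<rho> \<noteq> 0}. if \<rho> = \<tau>(k := a) then (if \<tau> k = b then K \<sigma> \<rho> else 0) else 0)"
      unfolding op_mult_def using that by (intro sum.cong refl) (simp add: e)
    also have "\<dots> = (if \<tau> k = b then K \<sigma> (\<tau>(k := a)) else 0)"
      using fin upd[OF that(2,3)] by (subst sum.delta) auto
    finally show ?thesis .
  qed
  have eK: "op_mult q Q (e a b) K \<sigma> \<tau> = (if \<sigma> k = a then K (\<sigma>(k := b)) \<tau> else 0)"
    if "\<sigma> \<in> configs q Q" "\<tau> \<in> configs q Q" "a < q" "b < q" for a b \<sigma> \<tau>
  proof -
    have *: "e a b \<sigma> \<rho> = (if \<rho> = \<sigma>(k := b) \<and> \<sigma> k = a then 1 else 0)" if "\<rho> \<in> configs q Q" for \<rho>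
    proof -
      have "\<sigma> = \<rho>(k := a) \<and> \<rho> k = b \<longleftrightarrow> \<rho> = \<sigma>(k := b) \<and> \<sigma> k = a" by (metis fun_upd_same fun_upd_triv fun_upd_upd)
      then show ?thesis using e[OF \<open>\<sigma> \<in> _\<close> that] by simp
    qed
    have "{\<rho> \<in> configs q Q. e a b \<sigma> \<rho> \<noteq> 0} = (if \<sigma> k = a then {\<sigma>(k := b)} else {})"
      using * upd[OF that(1,4)] by (auto split: if_splits)
    then show ?thesis unfolding op_mult_def using *[OF upd[OF that(1,4)]] by simp
  qed
  have "supported q Q {k} (e a b)" for a b
    unfolding e_def using supported_transport[of "{k}" id Q] k by simp
  then have main: "(if \<tau> k = b then K \<sigma> (\<tau>(k := a)) else 0) = (if \<sigma> k = a then K (\<sigma>(k := b)) \<tau> else 0)"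
    if "\<sigma> \<in> configs q Q" "\<tau> \<in> configs q Q" "a < q" "b < q" for a b \<sigma> \<tau>
    using comm[of "e a b"] Ke[OF that(1,2,3)] eK[OF that] by metis
  have lt: "\<sigma> k < q" if "\<sigma> \<in> configs q Q" for \<sigma> using that k by (auto simp: configs_def)
  \<comment> \<open>Taking \<open>a = b = \<tau> k\<close> shows that \<open>K\<close> is diagonal
    at \<open>k\<close>; the choice in \<open>shift\<close> shows that its entries do not depend on
    the common value there.\<close>
  have diag: "\<sigma> k = \<tau> k" if "K \<sigma> \<tau> \<noteq> 0" for \<sigma> \<tau>
  proof -
    have c: "\<sigma> \<in> configs q Q" "\<tau> \<in> configs q Q" using that isop unfolding is_op_def by blast+
    show ?thesis using main[OF c lt[OF c(2)] lt[OF c(2)]] that by (auto split: if_splits)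
  qed
  have shift: "K \<sigma> \<tau> = K (\<sigma>(k := b)) (\<tau>(k := b))"
    if c: "\<sigma> \<in> configs q Q" "\<tau> \<in> configs q Q" and "\<sigma> k = \<tau> k" "b < q" for \<sigma> \<tau> b
    using main[OF upd[OF c(1) \<open>b < q\<close>] c(2) \<open>b < q\<close> lt[OF c(2)]] that(3) by simp (metis fun_upd_triv)
  show ?thesis
  proof (cases "k \<in> F")
    case True
    show ?thesis
    proof (rule supportedI[OF q _ _ isop])
      fix \<sigma> \<tau> l assume "K \<sigma> \<tau> \<noteq> 0" "l \<in> Q - (F - {k})"
      then show "\<sigma> l = \<tau> l" using diag[of \<sigma> \<tau>] transport_nonzeroD(3)[of q Q id F K' \<sigma> \<tau> l]
        unfolding K' by (cases "l = k") auto
    next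
      fix \<sigma> \<tau> \<sigma>' \<tau>' assume c: "{\<sigma>, \<tau>, \<sigma>', \<tau>'} \<subseteq> configs q Q"
        and off: "\<And>l. l \<in> Q - (F - {k}) \<Longrightarrow> \<sigma> l = \<tau> l \<and> \<sigma>' l = \<tau>' l"
        and on: "\<And>l. l \<in> F - {k} \<Longrightarrow> \<sigma> l = \<sigma>' l \<and> \<tau> l = \<tau>' l"
      let ?\<sigma> = "\<sigma>(k := \<sigma>' k)" and ?\<tau> = "\<tau>(k := \<sigma>' k)"
      have k': "\<sigma> k = \<tau> k" "\<sigma>' k = \<tau>' k" using off[of k] k by auto
      have c': "?\<sigma> \<in> configs q Q" "?\<tau> \<in> configs q Q" using c upd lt by auto
      have "K \<sigma> \<tau> = K ?\<sigma> ?\<tau>" using shift k'(1) c lt by auto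
      also have "\<dots> = K' (restrict (?\<sigma> \<circ> id) F) (restrict (?\<tau> \<circ> id) F)"
        unfolding K' by (rule transport_inside[OF c']) (use off in auto)
      also have "restrict (?\<sigma> \<circ> id) F = restrict (\<sigma>' \<circ> id) F" using on by (intro restrict_ext) auto
      also have "restrict (?\<tau> \<circ> id) F = restrict (\<tau>' \<circ> id) F" using on k' by (intro restrict_ext) auto
      also have "K' (restrict (\<sigma>' \<circ> id) F) (restrict (\<tau>' \<circ> id) F) = K \<sigma>' \<tau>'"
        unfolding K' by (rule transport_inside[symmetric]) (use c off in auto)
      finally show "K \<sigma> \<tau> = K \<sigma>' \<tau>'" .
    qed (use F in auto)
  qed (use K in simp)
qed

lemma transport_off:
  assumes "supported q Q F K" "inj_on m Q" "m ` Q \<subseteq> Q" "\<And>k. k \<in> F \<Longrightarrow> m k = k"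
  shows "transport q Q m Q K = K"
proof -
  obtain L where "F \<subseteq> Q" "K = transport q Q id F L" using assms by (auto simp: supported_def)
  then have "transport q Q m Q K = transport q Q (m \<circ> id) F L" using assms by (simp add: transport_transport)
  also have "\<dots> = transport q Q id F L" using assms(4) by (intro transport_cong) simp
  finally show ?thesis using \<open>K = _\<close> by simp
qed

lemma transport_opprod:
  assumes "inj_on m F" "m ` F \<subseteq> Q"
  shows "transport q Q m F (opprod q F E gs) = opprod q Q (\<lambda>g. transport q Q m F (E g)) gs"
  by (induction gs) (use assms in \<open>simp_all add: transport_id_op transport_mult[symmetric]\<close>)

lemma sorted_filter_split:
  fixes t :: "'g \<Rightarrow> 'a::linorder"
  assumes "sorted_wrt (\<lambda>x y. t y \<le> t x) gs"
  shows "gs = filter (\<lambda>x. c < t x) gs @ filter (\<lambda>x. t x \<le> c) gs"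
  using assms
proof (induction gs)
  case (Cons g gs)
  show ?case
  proof (cases "c < t g")
    case False
    then have "\<forall>x\<in>set gs. \<not> c < t x" using Cons.prems by auto
    then have "filter (\<lambda>x. c < t x) gs = []" by (simp add: filter_empty_conv)
    then show ?thesis using Cons False by auto
  qed (use Cons in auto)
qed simp


section \<open>Replacing ancillas in an ordered product\<close>

definition subst_on :: "'k set \<Rightarrow> ('k \<Rightarrow> 'k) \<Rightarrow> 'k \<Rightarrow> 'k" where
  "subst_on B f k = (if k \<in> B then f k else k)"

text \<open>The induction runs over the set \<open>B\<close> of ancillas already replaced, with the
  invariant that the product is still \<open>U\<close>; this is why \<open>comm\<close> is only
  assumed for the original gates. Some ancillas in \<open>B\<close> may already use the lender
  \<open>f k\<close>, so \<open>sep\<close> must separate \<open>k\<close> from these as well as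
  from the lender itself.\<close>

theorem opprod_substitution:
  fixes t :: "'g \<Rightarrow> 'a::linorder" and Q :: "'s qudit set"
  assumes q: "1 \<le> q" and A: "finite A" "A \<subseteq> Q" "f ` A \<subseteq> Q - A"
    and sorted: "sorted_wrt (\<lambda>x y. t y \<le> t x) gs"
    and gates: "\<And>x. x \<in> set gs \<Longrightarrow> finite (F x) \<and> F x \<subseteq> Q \<and> unitary_op q (F x) (L x)"
    and inj: "\<And>x B. x \<in> set gs \<Longrightarrow> B \<subseteq> A \<Longrightarrow> inj_on (subst_on B f) (F x)"
    and sep: "\<And>k l. k \<in> A \<Longrightarrow> l \<noteq> k \<Longrightarrow> l = f k \<or> l \<in> A \<and> f l = f k \<Longrightarrow>
      (\<forall>x\<in>set gs. \<forall>y\<in>set gs. k \<in> F x \<and> l \<in> F y \<longrightarrow> t x < t y) \<or>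
      (\<forall>x\<in>set gs. \<forall>y\<in>set gs. k \<in> F x \<and> l \<in> F y \<longrightarrow> t y < t x)"
    and comm: "\<And>k M. k \<in> A \<Longrightarrow> supported q Q {k} M \<Longrightarrow>
      commutes q Q (opprod q Q (\<lambda>x. transport q Q id (F x) (L x)) gs) M"
  shows "opprod q Q (\<lambda>x. transport q Q (subst_on A f) (F x) (L x)) gs =
    opprod q Q (\<lambda>x. transport q Q id (F x) (L x)) gs"
proof -
  define E where "E B x = transport q Q (subst_on B f) (F x) (L x)" for B x
  define U where "U = opprod q Q (\<lambda>x. transport q Q id (F x) (L x)) gs"
  have img: "subst_on B f ` F x \<subseteq> Q" if "x \<in> set gs" "B \<subseteq> A" for B x
    using gates[OF that(1)] that(2) A(3) by (auto simp: subst_on_def)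
  have supp: "supported q Q (subst_on B f ` F x) (E B x)" if "x \<in> set gs" "B \<subseteq> A" for B x
    unfolding E_def using that gates img inj by (intro supported_transport) auto
  have loc: "local_op q Q (E B x)" if "x \<in> set gs" "B \<subseteq> A" for B x
    using supp[OF that] by (rule supported_local)
  have unit: "unitary_op q Q (E B x)" if "x \<in> set gs" "B \<subseteq> A" for B x
    unfolding E_def using that gates img inj by (intro unitary_transport) auto
  have "opprod q Q (E B) gs = U" if "finite B" "B \<subseteq> A" for B
    using that
  proof (induction B rule: finite_induct)
    case empty
    have "E {} x = transport q Q id (F x) (L x)" for x
      unfolding E_def by (rule transport_cong) (simp add: subst_on_def)
    then show ?case by (simp add: U_def)
  next
    case (insert k B)
    have B: "B \<subseteq> A" "k \<in> A" "k \<notin> B" "opprod q Q (E B) gs = U" using insert by auto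
    let ?B = "insert k B"
    have same: "E ?B x = E B x" if "k \<notin> F x" for x
      unfolding E_def by (rule transport_cong) (use that in \<open>auto simp: subst_on_def\<close>)
    \<comment> \<open>The times at which \<open>k\<close> is used. If there are none, nothing
      changes; otherwise the product is cut into the gates later than all of them
      (\<open>h1\<close>), the gates in between (\<open>h2\<close>) and the earlier ones
      (\<open>h3\<close>).\<close>
    define T where "T = t ` {x \<in> set gs. k \<in> F x}"
    show ?case
    proof (cases "T = {}")
      case True
      then have "opprod q Q (E ?B) gs = opprod q Q (E B) gs"
        by (intro opprod_cong same) (auto simp: T_def)
      then show ?thesis using B by simp
    next
      case False
      have finT: "finite T" by (simp add: T_def)
      define h1 where "h1 = filter (\<lambda>x. Max T < t x) gs"
      define h where "h = filter (\<lambda>x. t x \<le> Max T) gs"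
      define h2 where "h2 = filter (\<lambda>x. \<not> t x < Min T) h"
      define h3 where "h3 = filter (\<lambda>x. t x < Min T) h"
      have gs: "gs = h1 @ h" unfolding h1_def h_def by (rule sorted_filter_split[OF sorted])
      have "sorted_wrt (\<lambda>x y. t y \<le> t x) h" using sorted unfolding gs by (simp add: sorted_wrt_append)
      have "h = h2 @ h3"
        using \<open>sorted_wrt _ h\<close> unfolding h2_def h3_def
      proof (induction h)
        case (Cons x h)
        show ?case
        proof (cases "t x < Min T")
          case True
          then have "\<forall>y\<in>set h. t y < Min T" using Cons.prems by auto
          then have "filter (\<lambda>y. \<not> t y < Min T) h = []" "filter (\<lambda>y. t y < Min T) h = h"
            by (simp_all add: filter_empty_conv filter_id_conv)
          then show ?thesis using True by simp
        qed (use Cons in simp)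
      qed simp
      then have split: "gs = h1 @ h2 @ h3" using gs by simp
      then have sub: "set h1 \<subseteq> set gs" "set h2 \<subseteq> set gs" "set h3 \<subseteq> set gs" by auto
      have split3: "opprod q Q D gs = op_mult q Q (opprod q Q D h1) (op_mult q Q (opprod q Q D h2) (opprod q Q D h3))"
        if "\<And>x. x \<in> set gs \<Longrightarrow> local_op q Q (D x)" for D
      proof -
        have "opprod q Q D (h2 @ h3) = op_mult q Q (opprod q Q D h2) (opprod q Q D h3)"
          using that sub by (intro opprod_append) auto
        moreover have "opprod q Q D (h1 @ h2 @ h3) = op_mult q Q (opprod q Q D h1) (opprod q Q D (h2 @ h3))"
          using that sub by (intro opprod_append) auto
        ultimately show ?thesis using split by simp
      qed
      have memT: "t x \<in> T" if "x \<in> set gs" "k \<in> F x" for x using that by (auto simp: T_def)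
      have out: "k \<notin> F x" if "x \<in> set h1 \<union> set h3" for x
      proof
        assume "k \<in> F x"
        moreover have "x \<in> set gs" using that sub by auto
        ultimately have "Min T \<le> t x" "t x \<le> Max T" using memT finT by auto
        then show False using that by (auto simp: h1_def h3_def)
      qed
      have h2t: "Min T \<le> t x" "t x \<le> Max T" if "x \<in> set h2" for x using that by (auto simp: h2_def h_def)
      obtain lo hi where lo: "lo \<in> set gs" "k \<in> F lo" "t lo = Min T" and hi: "hi \<in> set gs" "k \<in> F hi" "t hi = Max T"
        using Min_in[OF finT False] Max_in[OF finT False] unfolding T_def by (auto simp del: Min_in Max_in)
      \<comment> \<open>By \<open>sep\<close>, a qudit that is sent to \<open>f k\<close> is used
        only before or only after all uses of \<open>k\<close>, whereas \<open>h2\<close> lies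
        between the uses \<open>lo\<close> and \<open>hi\<close> of \<open>k\<close>.\<close>
      have free: "f k \<notin> subst_on B f ` F x" if x: "x \<in> set h2" for x
      proof
        assume "f k \<in> subst_on B f ` F x"
        then obtain l where l: "l \<in> F x" "f k = subst_on B f l" by auto
        have "l = f k \<or> l \<in> A \<and> f l = f k" using l(2) B by (auto simp: subst_on_def split: if_splits)
        moreover have "l \<noteq> k" using l(2) A(3) B by (auto simp: subst_on_def split: if_splits)
        ultimately have "t hi < t x \<or> t x < t lo" using sep[of k l] B(2) l(1) lo hi x sub by blast
        then show False using h2t[OF x] lo hi by auto
      qed
      have notk: "k \<notin> subst_on B f ` F x" if "k \<notin> F x" for x
        using that B A(3) by (auto simp: subst_on_def split: if_splits)
      have l: "local_op q Q (opprod q Q (E B) h1)" "local_op q Q (opprod q Q (E B) h2)" "local_op q Q (opprod q Q (E B) h3)"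
        using loc[OF _ B(1)] sub by (auto intro!: opprod_local)
      have u: "unitary_op q Q (opprod q Q (E B) h1)" "unitary_op q Q (opprod q Q (E B) h3)"
        using loc[OF _ B(1)] unit[OF _ B(1)] sub by (auto intro!: opprod_unitary)
      have U: "U = op_mult q Q (opprod q Q (E B) h1) (op_mult q Q (opprod q Q (E B) h2) (opprod q Q (E B) h3))"
        using split3[OF loc[OF _ B(1)]] B(4) by simp
      have fk: "f k \<in> Q" "f k \<notin> A" "k \<in> Q" using A B by auto
      \<comment> \<open>\<open>M\<close> commutes with the whole product and with both outer
        factors; these are unitary and cancel from the two sides.\<close>
      have comm2: "commutes q Q (opprod q Q (E B) h2) M" if M: "supported q Q {k} M" for M
      proof -
        let ?U1 = "opprod q Q (E B) h1" and ?U2 = "opprod q Q (E B) h2" and ?U3 = "opprod q Q (E B) h3"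
        have lM: "local_op q Q M" using M by (rule supported_local)
        have c: "commutes q Q M ?U1" "commutes q Q M ?U3"
        proof -
          have "commutes q Q M (E B x)" if "x \<in> set h1 \<union> set h3" for x
            using that sub notk[OF out[OF that]] by (intro disjoint_commute[OF M supp[OF _ B(1)]]) auto
          then show "commutes q Q M ?U1" "commutes q Q M ?U3"
            using loc[OF _ B(1)] sub lM by (auto intro!: commutes_opprod)
        qed
        have "op_mult q Q ?U1 (op_mult q Q (op_mult q Q ?U2 M) ?U3) = op_mult q Q U M"
          unfolding U using l lM c(2) by (simp add: local_assoc local_mult)
        also have "\<dots> = op_mult q Q M U" using comm[OF B(2) M] by (simp add: U_def)
        also have "\<dots> = op_mult q Q (op_mult q Q M ?U1) (op_mult q Q ?U2 ?U3)"
          unfolding U using l lM by (simp add: local_assoc local_mult)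
        also have "\<dots> = op_mult q Q ?U1 (op_mult q Q (op_mult q Q M ?U2) ?U3)"
          unfolding c(1) using l lM by (simp add: local_assoc local_mult)
        finally have "op_mult q Q (op_mult q Q ?U2 M) ?U3 = op_mult q Q (op_mult q Q M ?U2) ?U3"
          by (rule unitary_cancel_left[OF u(1) l(1), rotated 2]) (intro local_mult l lM)+
        then show ?thesis
          by (rule unitary_cancel_right[OF u(2) l(3), rotated 2]) (intro local_mult l lM)+
      qed
      define G where "G = (\<Union>x\<in>set h2. subst_on B f ` F x)"
      have G: "finite G" "G \<subseteq> Q" "f k \<notin> G"
        unfolding G_def using gates img[OF _ B(1)] free sub by blast+
      have "supported q Q G (opprod q Q (E B) h2)"
      proof (rule opprod_supported[OF G(1,2)])
        fix x assume "x \<in> set h2"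
        then show "supported q Q G (E B x)"
          using sub G by (intro supported_mono[OF supp[OF _ B(1)]]) (auto simp: G_def)
      qed
      then have s2: "supported q Q (G - {k}) (opprod q Q (E B) h2)"
        using supported_off_commutant[OF q _ fk(3)] comm2 by blast
      \<comment> \<open>A swap, since sending \<open>k\<close> to \<open>f k\<close> and fixing the
        rest would not be injective on \<open>Q\<close>. No factor in \<open>h2\<close> acts on
        \<open>f k\<close>, so on each factor the swap merely replaces \<open>k\<close>, while on
        their product it does nothing.\<close>
      define p where "p l = (if l = k then f k else if l = f k then k else l)" for l
      have p: "inj_on p Q" "p ` Q \<subseteq> Q" using fk by (auto simp: p_def inj_on_def)
      have "opprod q Q (E ?B) h2 = opprod q Q (\<lambda>x. transport q Q p Q (E B x)) h2"
      proof (rule opprod_cong)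
        fix x assume x: "x \<in> set h2"
        then have xg: "x \<in> set gs" using sub by blast
        have "transport q Q p Q (E B x) = transport q Q (p \<circ> subst_on B f) (F x) (L x)"
          unfolding E_def by (rule transport_transport[OF p(1) img[OF xg B(1)] p(2)])
        also have "\<dots> = E ?B x" unfolding E_def
        proof (rule transport_cong)
          fix l assume l: "l \<in> F x"
          have "subst_on B f l \<noteq> f k" using free[OF x] l by (metis imageI)
          moreover have "subst_on B f l \<noteq> k" if "l \<noteq> k" using that B A(3) by (auto simp: subst_on_def)
          ultimately show "(p \<circ> subst_on B f) l = subst_on ?B f l"
            using B(3) by (cases "l = k") (simp_all add: p_def subst_on_def)
        qed
        finally show "E ?B x = transport q Q p Q (E B x)" ..
      qed
      also have "\<dots> = transport q Q p Q (opprod q Q (E B) h2)" by (rule transport_opprod[OF p, symmetric])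
      also have "\<dots> = opprod q Q (E B) h2"
        using G(3) by (intro transport_off[OF s2 p]) (auto simp: p_def)
      finally have e2: "opprod q Q (E ?B) h2 = opprod q Q (E B) h2" .
      have e13: "opprod q Q (E ?B) h1 = opprod q Q (E B) h1" "opprod q Q (E ?B) h3 = opprod q Q (E B) h3"
        using out by (auto intro!: opprod_cong same)
      have "opprod q Q (E ?B) gs =
          op_mult q Q (opprod q Q (E ?B) h1) (op_mult q Q (opprod q Q (E ?B) h2) (opprod q Q (E ?B) h3))"
        by (rule split3[OF loc[OF _ insert.prems]])
      then show ?thesis unfolding e2 e13 U .
    qed
  qed
  from this[OF A(1) subset_refl] show ?thesis unfolding E_def U_def .
qed

section \<open>Layers of a circuit\<close>

definition conj_op :: "nat \<Rightarrow> 's qudit set \<Rightarrow> 's operator \<Rightarrow> 's operator \<Rightarrow> 's operator" where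
  "conj_op q Q U K = op_mult q Q (op_mult q Q U K) (op_adj U)"

lemma conj_op_mult:
  assumes "local_op q Q U" "local_op q Q V" "local_op q Q K"
  shows "conj_op q Q (op_mult q Q U V) K = conj_op q Q U (conj_op q Q V K)"
  using assms by (simp add: conj_op_def op_adj_mult local_assoc local_mult local_adj)

lemma conj_op_commutes:
  assumes "local_op q Q U" "local_op q Q K" "unitary_op q Q U" "commutes q Q K U"
  shows "conj_op q Q U K = K"
  unfolding conj_op_def assms(4)[symmetric]
  using assms(1-3) by (simp add: local_assoc local_adj unitary_op_def local_mult_id)

lemma conj_op_eq_commutes:
  assumes "local_op q Q U" "local_op q Q K" "unitary_op q Q U" "conj_op q Q U K = K"
  shows "commutes q Q U K"
proof -
  have "op_mult q Q K U = op_mult q Q (conj_op q Q U K) U" using assms by simp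
  also have "\<dots> = op_mult q Q U K" using assms(1-3)
    by (simp add: conj_op_def local_assoc local_adj local_mult unitary_op_def local_mult_id)
  finally show ?thesis ..
qed

lemma conj_op_transport:
  assumes "inj_on m F" "m ` F \<subseteq> Q"
  shows "transport q Q m F (conj_op q F U K) = conj_op q Q (transport q Q m F U) (transport q Q m F K)"
  using assms by (simp add: conj_op_def op_adj_transport transport_mult)

lemma conj_op_supported:
  "supported q Q F U \<Longrightarrow> supported q Q F K \<Longrightarrow> supported q Q F (conj_op q Q U K)"
  by (simp add: conj_op_def supported_mult supported_adj)

lemma conj_op_local: "local_op q Q U \<Longrightarrow> local_op q Q K \<Longrightarrow> local_op q Q (conj_op q Q U K)"
  by (simp add: conj_op_def local_mult local_adj)

lemma supported_ext:
  assumes "supported q R F K" "R \<subseteq> Q"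
  shows "supported q Q F (transport q Q id R K)"
proof -
  obtain L where L: "finite F" "F \<subseteq> R" "is_op q F L" "K = transport q R id F L"
    using assms by (auto simp: supported_def)
  have "transport q Q id R K = transport q Q (id \<circ> id) F L"
    unfolding L(4) using L assms(2) by (intro transport_transport) auto
  then show ?thesis using L assms(2) by (auto simp: supported_def)
qed

lemma local_ext: "local_op q R K \<Longrightarrow> R \<subseteq> Q \<Longrightarrow> local_op q Q (transport q Q id R K)"
  unfolding local_op_iff using supported_ext by blast

text \<open>Brings equations between operators extended to all qudits back to the physical ones.
  Configurations are filled up with the value 0, hence \<open>1 \<le> q\<close>.\<close>

lemma ext_inject:
  assumes "1 \<le> q" "R \<subseteq> Q" "is_op q R K" "is_op q R L"
    and "transport q Q id R K = transport q Q id R L"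
  shows "K = L"
proof (intro ext)
  fix \<sigma> \<tau>
  define e :: "'a config \<Rightarrow> 'a config" where "e \<sigma> k = (if k \<in> R then \<sigma> k else if k \<in> Q then 0 else undefined)" for \<sigma> k
  show "K \<sigma> \<tau> = L \<sigma> \<tau>"
  proof (cases "\<sigma> \<in> configs q R \<and> \<tau> \<in> configs q R")
    case True
    have e: "e \<sigma> \<in> configs q Q" "restrict (e \<sigma> \<circ> id) R = \<sigma>" if "\<sigma> \<in> configs q R" for \<sigma>
    proof -
      show c: "e \<sigma> \<in> configs q Q"
        using that assms(1,2) by (auto simp: configs_def e_def PiE_def Pi_def extensional_def)
      show "restrict (e \<sigma> \<circ> id) R = \<sigma>"
        using c that assms(2) by (intro configs_eqI[OF pull_configs that]) (auto simp: e_def)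
    qed
    have *: "transport q Q id R M (e \<sigma>) (e \<tau>) = M \<sigma> \<tau>" for M
    proof -
      have "transport q Q id R M (e \<sigma>) (e \<tau>) = M (restrict (e \<sigma> \<circ> id) R) (restrict (e \<tau> \<circ> id) R)"
        using True e(1) by (intro transport_inside) (auto simp: e_def)
      then show ?thesis using True e(2) by simp
    qed
    then show ?thesis using assms(5) by metis
  next
    case False
    then have "K \<sigma> \<tau> = 0" "L \<sigma> \<tau> = 0" using assms(3,4) unfolding is_op_def by blast+
    then show ?thesis by simp
  qed
qed

lemma local_is_op: "local_op q Q K \<Longrightarrow> is_op q Q K"
  by (auto simp: local_op_iff supported_def is_op_transport)

text \<open>Rounds \<open>n\<close> down to 1, latest first, in the recursion pattern of
  \<open>circuit_op\<close> and \<open>circuit_act\<close>. Within a round the order of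
  \<open>xs\<close> is kept.\<close>

primrec ord_list :: "('g \<Rightarrow> nat) \<Rightarrow> 'g list \<Rightarrow> nat \<Rightarrow> 'g list" where
  "ord_list t xs 0 = []"
| "ord_list t xs (Suc n) = filter (\<lambda>x. t x = Suc n) xs @ ord_list t xs n"

lemma set_ord_list: "set (ord_list t xs n) = {x \<in> set xs. 1 \<le> t x \<and> t x \<le> n}"
proof (induction n)
  case (Suc n)
  have "(1 \<le> t x \<and> t x \<le> Suc n) = (t x = Suc n \<or> 1 \<le> t x \<and> t x \<le> n)" for x by linarith
  then show ?case using Suc by auto
qed simp

lemma distinct_ord_list: "distinct xs \<Longrightarrow> distinct (ord_list t xs n)"
  by (induction n) (auto simp: set_ord_list)

lemma sorted_ord_list: "sorted_wrt (\<lambda>x y. t y \<le> t x) (ord_list t xs n)"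
proof (induction n)
  case (Suc n)
  have "sorted_wrt (\<lambda>x y. t y \<le> t x) (filter (\<lambda>x. t x = Suc n) xs)"
    by (induction xs) auto
  then show ?case using Suc by (auto simp: sorted_wrt_append set_ord_list)
qed simp

lemma qudits_mono: "S \<subseteq> T \<Longrightarrow> qudits P A S \<subseteq> qudits P A T"
  by (auto simp: qudits_def phys_qudits_def anc_qudits_def)

lemma qudits_Un: "qudits P A (S \<union> T) = qudits P A S \<union> qudits P A T"
  by (auto simp: qudits_def phys_qudits_def anc_qudits_def)

lemma qudits_disjoint: "S \<inter> T = {} \<Longrightarrow> qudits P A S \<inter> qudits P A T = {}"
  by (auto simp: qudits_def phys_qudits_def anc_qudits_def)

lemma finite_qudits: "finite S \<Longrightarrow> finite (qudits P A S)"
  by (auto simp: qudits_def phys_qudits_def anc_qudits_def)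

lemma layer_op_eq_transport:
  assumes "\<Union>G \<subseteq> P \<union> A"
  shows "layer_op q P A C a G = transport q (qudits P A (P \<union> A)) id (qudits P A (\<Union>G))
    (\<lambda>\<sigma> \<tau>. \<Prod>S\<in>G. gate C S a (restrict \<sigma> (qudits P A S)) (restrict \<tau> (qudits P A S)))"
proof -
  have "restrict (restrict \<sigma> (qudits P A (\<Union>G))) (qudits P A S) = restrict \<sigma> (qudits P A S)"
    if "S \<in> G" for S and \<sigma> :: "'a config"
    using qudits_mono[of S "\<Union>G" P A] that by (auto simp: Int_absorb1 Sup_upper)
  then show ?thesis by (simp add: layer_op_def transport_def cong: if_cong)
qed

lemma layer_op_eq_opprod:
  assumes "distinct Ss" "pairwise disjnt (set Ss)" "\<And>S. S \<in> set Ss \<Longrightarrow> finite S \<and> S \<subseteq> P \<union> A"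
  shows "layer_op q P A C a (set Ss) =
    opprod q (qudits P A (P \<union> A)) (\<lambda>S. transport q (qudits P A (P \<union> A)) id (qudits P A S) (gate C S a)) Ss"
  using assms
proof (induction Ss)
  case Nil
  show ?case
  proof (intro ext)
    fix \<sigma> \<tau>
    have "\<sigma> = \<tau>" if "\<sigma> \<in> configs q (qudits P A (P \<union> A))" "\<tau> \<in> configs q (qudits P A (P \<union> A))"
      "\<forall>k\<in>qudits P A (P \<union> A) - qudits P A {}. \<sigma> k = \<tau> k"
      by (rule configs_eqI[OF that(1,2)]) (use that(3) in \<open>simp add: qudits_def phys_qudits_def anc_qudits_def\<close>)
    then show "layer_op q P A C a (set []) \<sigma> \<tau> = opprod q (qudits P A (P \<union> A)) (\<lambda>S. transport q (qudits P A (P \<union> A)) id (qudits P A S) (gate C S a)) [] \<sigma> \<tau>"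
      by (simp add: layer_op_def op_id_def) blast
  qed
next
  case (Cons S Ss)
  let ?Q = "qudits P A (P \<union> A)"
  let ?L = "\<lambda>\<sigma> \<tau>. \<Prod>S\<in>set Ss. gate C S a (restrict \<sigma> (qudits P A S)) (restrict \<tau> (qudits P A S))"
  have U: "\<Union>(set Ss) \<subseteq> P \<union> A" "S \<subseteq> P \<union> A" "finite S" "\<Union>(set (S # Ss)) \<subseteq> P \<union> A"
    using Cons.prems(3) by auto
  have dis: "S \<inter> \<Union>(set Ss) = {}"
    using Cons.prems(1,2) by (auto simp: pairwise_insert disjnt_iff)
  have IH: "opprod q ?Q (\<lambda>S. transport q ?Q id (qudits P A S) (gate C S a)) Ss = transport q ?Q id (qudits P A (\<Union>(set Ss))) ?L"
  proof -
    have "layer_op q P A C a (set Ss) = opprod q ?Q (\<lambda>S. transport q ?Q id (qudits P A S) (gate C S a)) Ss"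
      using Cons.prems by (intro Cons.IH) (auto simp: pairwise_insert)
    then show ?thesis using layer_op_eq_transport[OF U(1), of q C a] by metis
  qed
  have r: "restrict (restrict \<sigma> (qudits P A (\<Union>(set Ss)))) (qudits P A T) = restrict \<sigma> (qudits P A T)"
    if "T \<in> set Ss" for T and \<sigma> :: "'a config"
    using qudits_mono[of T "\<Union>(set Ss)" P A] that by (auto simp: Int_absorb1 Sup_upper)
  have "opprod q ?Q (\<lambda>S. transport q ?Q id (qudits P A S) (gate C S a)) (S # Ss) =
    (\<lambda>\<sigma> \<tau>. if \<sigma> \<in> configs q ?Q \<and> \<tau> \<in> configs q ?Q \<and> (\<forall>k\<in>?Q - (qudits P A S \<union> qudits P A (\<Union>(set Ss))). \<sigma> k = \<tau> k)
     then gate C S a (restrict \<sigma> (qudits P A S)) (restrict \<tau> (qudits P A S)) *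
       ?L (restrict \<sigma> (qudits P A (\<Union>(set Ss)))) (restrict \<tau> (qudits P A (\<Union>(set Ss)))) else 0)"
    unfolding opprod_simps(2) IH
    by (rule op_mult_disjoint[OF finite_qudits[OF U(3)] qudits_mono[OF U(2)] qudits_mono[OF U(1)] qudits_disjoint[OF dis]])
  also have "\<dots> = layer_op q P A C a (set (S # Ss))"
    unfolding layer_op_def using Cons.prems(1) r
    by (simp add: qudits_Un[symmetric] cong: if_cong)
  finally show ?case ..
qed

lemma ext_layer_op:
  assumes "distinct Ss" "pairwise disjnt (set Ss)" "\<And>S. S \<in> set Ss \<Longrightarrow> finite S \<and> S \<subseteq> P \<union> A"
    and "qudits P A (P \<union> A) \<subseteq> Q"
  shows "transport q Q id (qudits P A (P \<union> A)) (layer_op q P A C a (set Ss)) =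
    opprod q Q (\<lambda>S. transport q Q id (qudits P A S) (gate C S a)) Ss"
proof -
  let ?R = "qudits P A (P \<union> A)"
  have "transport q Q id ?R (layer_op q P A C a (set Ss)) =
    opprod q Q (\<lambda>S. transport q Q id ?R (transport q ?R id (qudits P A S) (gate C S a))) Ss"
    using assms by (simp add: layer_op_eq_opprod transport_opprod)
  also have "\<dots> = opprod q Q (\<lambda>S. transport q Q id (qudits P A S) (gate C S a)) Ss"
  proof (rule opprod_cong)
    fix S assume "S \<in> set Ss"
    then have "qudits P A S \<subseteq> ?R" using assms(3) by (intro qudits_mono) auto
    then show "transport q Q id ?R (transport q ?R id (qudits P A S) (gate C S a)) = transport q Q id (qudits P A S) (gate C S a)"
      using assms(4) by (subst transport_transport) auto
  qed
  finally show ?thesis .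
qed

section \<open>Light cones\<close>

lemma opprod_map: "opprod q Q E (map \<phi> gs) = opprod q Q (\<lambda>g. E (\<phi> g)) gs"
  by (induction gs) auto

text \<open>Choosing a point of \<open>F\<close> in each of these sets is injective because the sets
  are disjoint.\<close>

lemma finite_touching:
  assumes "finite F" "\<And>x y. x \<in> \<Gamma> \<Longrightarrow> y \<in> \<Gamma> \<Longrightarrow> x \<noteq> y \<Longrightarrow> G x \<inter> G y = {}"
  shows "finite {x \<in> \<Gamma>. G x \<inter> F \<noteq> {}}"
proof -
  define h where "h x = (SOME k. k \<in> G x \<inter> F)" for x
  have h: "h x \<in> G x \<inter> F" if "G x \<inter> F \<noteq> {}" for x
  proof -
    have "\<exists>k. k \<in> G x \<inter> F" using that by blast
    then show ?thesis unfolding h_def by (rule someI_ex)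
  qed
  have "inj_on h {x \<in> \<Gamma>. G x \<inter> F \<noteq> {}}"
  proof (rule inj_onI, rule ccontr)
    fix x y assume "x \<in> {x \<in> \<Gamma>. G x \<inter> F \<noteq> {}}" "y \<in> {x \<in> \<Gamma>. G x \<inter> F \<noteq> {}}" "h x = h y" "x \<noteq> y"
    then have "h x \<in> G x \<inter> G y" "G x \<inter> G y = {}" using h[of x] h[of y] assms(2)[of x y] by auto
    then show False by simp
  qed
  moreover have "h ` {x \<in> \<Gamma>. G x \<inter> F \<noteq> {}} \<subseteq> F" using h by auto
  ultimately show ?thesis using assms(1) by (blast intro: finite_imageD[of h] finite_subset)
qed

lemma layer_op_local_unitary:
  assumes "finite G" "pairwise disjnt G"
    and "\<And>S. S \<in> G \<Longrightarrow> finite S \<and> S \<subseteq> P \<union> A \<and> unitary_op q (qudits P A S) (gate C S a)"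
  shows "local_op q (qudits P A (P \<union> A)) (layer_op q P A C a G) \<and>
    unitary_op q (qudits P A (P \<union> A)) (layer_op q P A C a G)"
    (is "?l \<and> ?u")
proof -
  let ?Q = "qudits P A (P \<union> A)"
  obtain Ss where Ss: "set Ss = G" "distinct Ss" using finite_distinct_list[OF assms(1)] by auto
  have g: "local_op q ?Q (transport q ?Q id (qudits P A S) (gate C S a)) \<and>
      unitary_op q ?Q (transport q ?Q id (qudits P A S) (gate C S a))" if "S \<in> set Ss" for S
  proof -
    have S: "finite (qudits P A S)" "qudits P A S \<subseteq> ?Q"
      using assms(3)[of S] that Ss finite_qudits qudits_mono by (blast, metis)
    show ?thesis
      using supported_local[OF supported_transport[OF S(1), of id ?Q q]] unitary_transport[of id "qudits P A S" ?Q q] assms(3)[of S] that Ss S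
      by simp
  qed
  have e: "layer_op q P A C a G = opprod q ?Q (\<lambda>S. transport q ?Q id (qudits P A S) (gate C S a)) Ss"
    using layer_op_eq_opprod[of Ss P A q C a] Ss assms(2,3) by blast
  show ?thesis unfolding e using g by (simp add: opprod_local opprod_unitary)
qed

text \<open>A gate outside \<open>G\<close> meets no qudit of \<open>F\<close>, so it commutes with
  \<open>K\<close> and cancels against its adjoint. The conjugation is therefore the same for every
  finite set of gates of the layer above \<open>G\<close>, and this is the value selected by
  \<open>THE\<close>.\<close>

lemma layer_act_eq:
  assumes dis: "pairwise disjnt (layer C a)"
    and gates: "\<And>S. S \<in> layer C a \<Longrightarrow> finite S \<and> S \<subseteq> P \<union> A \<and> unitary_op q (qudits P A S) (gate C S a)"
    and K: "supported q (qudits P A (P \<union> A)) F K"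
    and G: "finite G" "G \<subseteq> layer C a" "\<And>S. S \<in> layer C a \<Longrightarrow> qudits P A S \<inter> F \<noteq> {} \<Longrightarrow> S \<in> G"
  shows "layer_act q P A C a K = conj_op q (qudits P A (P \<union> A)) (layer_op q P A C a G) K"
proof -
  let ?Q = "qudits P A (P \<union> A)"
  define E where "E S = transport q ?Q id (qudits P A S) (gate C S a)" for S
  have lK: "local_op q ?Q K" using K by (rule supported_local)
  have stable: "conj_op q ?Q (layer_op q P A C a H) K = conj_op q ?Q (layer_op q P A C a G) K"
    if H: "finite H" "G \<subseteq> H" "H \<subseteq> layer C a" for H
  proof -
    obtain Gs where Gs: "set Gs = G" "distinct Gs" using finite_distinct_list[OF G(1)] by auto
    obtain Hs where Hs: "set Hs = H - G" "distinct Hs" using finite_distinct_list[of "H - G"] H by auto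
    have supp: "supported q ?Q (qudits P A S) (E S)" if "S \<in> layer C a" for S
      using supported_transport[OF finite_qudits, of S id P A ?Q q] gates[OF that] qudits_mono[of S "P \<union> A" P A] by (simp add: E_def)
    have lu: "local_op q ?Q (layer_op q P A C a H') \<and> unitary_op q ?Q (layer_op q P A C a H')"
      if "finite H'" "H' \<subseteq> layer C a" for H'
      using that gates dis by (intro layer_op_local_unitary) (auto intro: pairwise_subset)
    have e: "layer_op q P A C a (set Ss) = opprod q ?Q E Ss" if "distinct Ss" "set Ss \<subseteq> layer C a" for Ss
      unfolding E_def using that gates dis by (intro layer_op_eq_opprod) (auto intro: pairwise_subset)
    have eG: "layer_op q P A C a G = opprod q ?Q E Gs" using e[of Gs] Gs G(2) by simp
    have sH: "set Hs \<subseteq> layer C a" using Hs(1) H(3) by blast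
    have eH: "layer_op q P A C a (H - G) = opprod q ?Q E Hs" using e[OF Hs(2) sH] unfolding Hs(1) .
    have "set (Gs @ Hs) = H" using Gs Hs H by auto
    then have "layer_op q P A C a H = opprod q ?Q E (Gs @ Hs)"
      using e[of "Gs @ Hs"] Gs Hs H by auto
    also have "\<dots> = op_mult q ?Q (opprod q ?Q E Gs) (opprod q ?Q E Hs)"
      using supp[THEN supported_local] Gs Hs H by (intro opprod_append) auto
    also have "\<dots> = op_mult q ?Q (layer_op q P A C a G) (layer_op q P A C a (H - G))"
      unfolding eG eH ..
    finally have split: "layer_op q P A C a H = op_mult q ?Q (layer_op q P A C a G) (layer_op q P A C a (H - G))" .
    have "commutes q ?Q K (opprod q ?Q E Hs)"
    proof (rule commutes_opprod[OF lK])
      fix S assume S: "S \<in> set Hs"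
      then have S': "S \<in> layer C a" "S \<notin> G" using Hs H by auto
      then show "local_op q ?Q (E S) \<and> commutes q ?Q K (E S)"
        using G(3)[of S] disjoint_commute[OF K supp[OF S'(1)]] supported_local[OF supp[OF S'(1)]] by blast
    qed
    then have "commutes q ?Q K (layer_op q P A C a (H - G))" unfolding eH .
    then have "conj_op q ?Q (layer_op q P A C a (H - G)) K = K"
      using lu[of "H - G"] H lK by (intro conj_op_commutes) auto
    moreover have "H - G \<subseteq> layer C a" using H by blast
    ultimately show ?thesis unfolding split
      using lu[of G] lu[of "H - G"] G(1,2) H(1) lK by (simp add: conj_op_mult)
  qed
  have ev: "\<forall>\<^sub>F H in finite_subsets_at_top (layer C a).
      conj_op q ?Q (layer_op q P A C a H) K = conj_op q ?Q (layer_op q P A C a G) K"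
    unfolding eventually_finite_subsets_at_top using G(1,2) by (intro exI[of _ G] conjI allI impI stable) auto
  have "(THE L. \<forall>\<^sub>F H in finite_subsets_at_top (layer C a). conj_op q ?Q (layer_op q P A C a H) K = L) =
      conj_op q ?Q (layer_op q P A C a G) K"
  proof (rule the_equality)
    show "\<forall>\<^sub>F H in finite_subsets_at_top (layer C a).
      conj_op q ?Q (layer_op q P A C a H) K = conj_op q ?Q (layer_op q P A C a G) K" by (rule ev)
  next
    fix L assume "\<forall>\<^sub>F H in finite_subsets_at_top (layer C a). conj_op q ?Q (layer_op q P A C a H) K = L"
    with ev have "\<forall>\<^sub>F H in finite_subsets_at_top (layer C a). L = conj_op q ?Q (layer_op q P A C a G) K"
      by eventually_elim simp
    then show "L = conj_op q ?Q (layer_op q P A C a G) K" by simp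
  qed
  then show ?thesis by (simp add: layer_act_def conj_op_def)
qed

text \<open>Gates are indexed by abstract labels \<open>g\<close>, with site set
  \<open>\<phi> g\<close> and round \<open>t g\<close>, so that the gates of the original circuit
  can label those of the borrowed circuit too, with other sites and rounds. Likewise
  \<open>Q\<close> may exceed the qudits of the circuit.\<close>

lemma circuit_op_eq_opprod:
  assumes gates: "\<And>a S. a \<in> {1..depth C} \<Longrightarrow> S \<in> layer C a \<Longrightarrow>
      finite S \<and> S \<subseteq> P \<union> A \<and> unitary_op q (qudits P A S) (gate C S a)"
    and dis: "\<And>a. a \<in> {1..depth C} \<Longrightarrow> pairwise disjnt (layer C a)"
    and xs: "distinct xs" "\<And>a. a \<in> {1..depth C} \<Longrightarrow> bij_betw \<phi> {g \<in> set xs. t g = a} (layer C a)"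
    and Q: "qudits P A (P \<union> A) \<subseteq> Q" and n: "n \<le> depth C"
  shows "transport q Q id (qudits P A (P \<union> A)) (circuit_op q P A C n) =
    opprod q Q (\<lambda>g. transport q Q id (qudits P A (\<phi> g)) (gate C (\<phi> g) (t g))) (ord_list t xs n)"
  using n
proof (induction n)
  case 0
  then show ?case using Q by (simp add: transport_id_op)
next
  case (Suc n)
  define E where "E g = transport q Q id (qudits P A (\<phi> g)) (gate C (\<phi> g) (t g))" for g
  let ?R = "qudits P A (P \<union> A)"
  define gs where "gs = filter (\<lambda>x. t x = Suc n) xs"
  have a: "Suc n \<in> {1..depth C}" using Suc.prems by simp
  have gs: "set gs = {g \<in> set xs. t g = Suc n}" "distinct gs" using xs by (auto simp: gs_def)
  have map: "set (map \<phi> gs) = layer C (Suc n)" "distinct (map \<phi> gs)"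
    using xs(2)[OF a] gs by (auto simp: bij_betw_def distinct_map)
  have "transport q Q id ?R (layer_op q P A C (Suc n) (layer C (Suc n))) =
      opprod q Q (\<lambda>S. transport q Q id (qudits P A S) (gate C S (Suc n))) (map \<phi> gs)"
    unfolding map(1)[symmetric]
    using map gates[OF a] dis[OF a] Q by (intro ext_layer_op) auto
  also have "\<dots> = opprod q Q E gs"
    unfolding opprod_map using gs by (intro opprod_cong) (auto simp: E_def)
  finally have layer: "transport q Q id ?R (layer_op q P A C (Suc n) (layer C (Suc n))) = opprod q Q E gs" .
  have loc: "local_op q Q (E g)" if "g \<in> set xs" "1 \<le> t g" "t g \<le> Suc n" for g
  proof -
    have "t g \<in> {1..depth C}" using that Suc.prems by auto
    then have "\<phi> g \<in> layer C (t g)" using xs(2)[of "t g"] that by (auto simp: bij_betw_def)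
    then have "finite (\<phi> g)" "\<phi> g \<subseteq> P \<union> A" using gates \<open>t g \<in> _\<close> by blast+
    then show ?thesis using finite_qudits[of "\<phi> g" P A] qudits_mono[of "\<phi> g" "P \<union> A" P A] Q
      unfolding E_def by (intro supported_local[OF supported_transport]) auto
  qed
  have "opprod q Q E (ord_list t xs (Suc n)) = op_mult q Q (opprod q Q E gs) (opprod q Q E (ord_list t xs n))"
    unfolding ord_list.simps gs_def[symmetric]
    by (rule opprod_append) (use loc gs in \<open>auto simp: set_ord_list\<close>)
  moreover have "transport q Q id ?R (circuit_op q P A C n) = opprod q Q E (ord_list t xs n)"
    unfolding E_def by (rule Suc.IH) (use Suc.prems in simp)
  moreover have "transport q Q id ?R (op_mult q ?R X Y) = op_mult q Q (transport q Q id ?R X) (transport q Q id ?R Y)" for X Y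
    by (rule transport_mult[symmetric]) (use Q in auto)
  ultimately show ?case unfolding E_def[symmetric] circuit_op.simps by (simp only: layer)
qed

text \<open>
  The family \<open>E\<close> agrees with the gates of the circuit only on the cone \<open>N\<close>, because only finitely many
  ancillas will be replaced and a gate outside the cone may also act on others.
\<close>

lemma circuit_act_cone:
  fixes \<Gamma> :: "'g set"
  assumes gates: "\<And>a S. a \<in> {1..depth C} \<Longrightarrow> S \<in> layer C a \<Longrightarrow>
      finite S \<and> S \<subseteq> P \<union> A \<and> unitary_op q (qudits P A S) (gate C S a)"
    and dis: "\<And>a. a \<in> {1..depth C} \<Longrightarrow> pairwise disjnt (layer C a)"
    and \<Gamma>: "\<And>a. a \<in> {1..depth C} \<Longrightarrow> bij_betw \<phi> {g \<in> \<Gamma>. t g = a} (layer C a)"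
    and Q: "qudits P A (P \<union> A) \<subseteq> Q" and n: "n \<le> depth C"
    and F0: "finite F0" "F0 \<subseteq> qudits P A (P \<union> A)"
  shows "\<exists>F N. finite N \<and> N \<subseteq> \<Gamma> \<and> (\<forall>K. supported q (qudits P A (P \<union> A)) F0 K \<longrightarrow>
     supported q (qudits P A (P \<union> A)) F (circuit_act q P A C n K) \<and>
     (\<forall>xs E s.
       distinct xs \<and> N \<subseteq> set xs \<and> set xs \<subseteq> \<Gamma> \<and>
       (\<forall>g\<in>set xs. supported q Q (s g) (E g) \<and> unitary_op q Q (E g) \<and>
          s g \<inter> qudits P A (P \<union> A) \<subseteq> qudits P A (\<phi> g)) \<and>
       (\<forall>g\<in>set xs. \<forall>h\<in>set xs. g \<noteq> h \<and> t g = t h \<longrightarrow> s g \<inter> s h = {}) \<and>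
       (\<forall>g\<in>N. E g = transport q Q id (qudits P A (\<phi> g)) (gate C (\<phi> g) (t g))) \<longrightarrow>
       conj_op q Q (opprod q Q E (ord_list t xs n)) (transport q Q id (qudits P A (P \<union> A)) K) =
         transport q Q id (qudits P A (P \<union> A)) (circuit_act q P A C n K)))"
  using n
proof (induction n)
  case 0
  have "conj_op q Q (op_id q Q) (transport q Q id (qudits P A (P \<union> A)) K) = transport q Q id (qudits P A (P \<union> A)) K"
    if "supported q (qudits P A (P \<union> A)) F0 K" for K
    using local_ext[OF supported_local[OF that] Q] by (intro conj_op_commutes) (auto simp: local_id unitary_op_id local_mult_id)
  then show ?case unfolding circuit_act.simps ord_list.simps opprod_simps
    by (intro exI[of _ F0] exI[of _ "{}"]) blast
next
  case (Suc n)
  let ?R = "qudits P A (P \<union> A)"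
  obtain F N where N: "finite N" "N \<subseteq> \<Gamma>" and
    IH: "\<forall>K. supported q ?R F0 K \<longrightarrow> supported q ?R F (circuit_act q P A C n K) \<and>
     (\<forall>xs E s. distinct xs \<and> N \<subseteq> set xs \<and> set xs \<subseteq> \<Gamma> \<and>
       (\<forall>g\<in>set xs. supported q Q (s g) (E g) \<and> unitary_op q Q (E g) \<and> s g \<inter> ?R \<subseteq> qudits P A (\<phi> g)) \<and>
       (\<forall>g\<in>set xs. \<forall>h\<in>set xs. g \<noteq> h \<and> t g = t h \<longrightarrow> s g \<inter> s h = {}) \<and>
       (\<forall>g\<in>N. E g = transport q Q id (qudits P A (\<phi> g)) (gate C (\<phi> g) (t g))) \<longrightarrow>
       conj_op q Q (opprod q Q E (ord_list t xs n)) (transport q Q id ?R K) =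
         transport q Q id ?R (circuit_act q P A C n K))"
    using Suc.IH[OF Suc_leD[OF Suc.prems]] by (elim conjE exE)
  \<comment> \<open>Finiteness of \<open>F\<close> is part of \<open>supported\<close>; the identity
    serves as an operator on \<open>F0\<close> from which to read it off.\<close>
  have "supported q ?R F (circuit_act q P A C n (op_id q ?R))" using IH supported_id[OF F0] by blast
  then have finF: "finite F" "F \<subseteq> ?R" by (auto simp: supported_def)
  have a: "Suc n \<in> {1..depth C}" using Suc.prems by simp
  note bij = \<Gamma>[OF a]
  \<comment> \<open>Only these gates of the new round can change an operator on
    \<open>F\<close>.\<close>
  define M where "M = {g \<in> {g \<in> \<Gamma>. t g = Suc n}. qudits P A (\<phi> g) \<inter> F \<noteq> {}}"
  have "finite M"
    unfolding M_def
  proof (rule finite_touching[OF finF(1)])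
    fix g h assume gh: "g \<in> {g \<in> \<Gamma>. t g = Suc n}" "h \<in> {g \<in> \<Gamma>. t g = Suc n}" "g \<noteq> h"
    then have "\<phi> g \<noteq> \<phi> h" "\<phi> g \<in> layer C (Suc n)" "\<phi> h \<in> layer C (Suc n)"
      using bij by (auto simp: bij_betw_def inj_on_def)
    then have "disjnt (\<phi> g) (\<phi> h)" using dis[OF a] by (auto simp: pairwise_def)
    then show "qudits P A (\<phi> g) \<inter> qudits P A (\<phi> h) = {}" by (intro qudits_disjoint) (simp add: disjnt_def)
  qed
  have M: "M \<subseteq> \<Gamma>" "\<And>g. g \<in> M \<Longrightarrow> t g = Suc n" by (auto simp: M_def)
  have G: "finite (\<phi> ` M)" "\<phi> ` M \<subseteq> layer C (Suc n)" "inj_on \<phi> M"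
    using \<open>finite M\<close> bij by (auto simp: bij_betw_def M_def inj_on_def)
  define F' where "F' = F \<union> qudits P A (\<Union>(\<phi> ` M))"
  have act: "circuit_act q P A C (Suc n) K =
      conj_op q ?R (layer_op q P A C (Suc n) (\<phi> ` M)) (circuit_act q P A C n K)"
    if K: "supported q ?R F0 K" for K
    unfolding circuit_act.simps
  proof (rule layer_act_eq[OF dis[OF a] gates[OF a] _ G(1,2)])
    show "supported q ?R F (circuit_act q P A C n K)" using IH K by blast
    fix S assume S: "S \<in> layer C (Suc n)" "qudits P A S \<inter> F \<noteq> {}"
    then obtain g where "g \<in> \<Gamma>" "t g = Suc n" "S = \<phi> g" using bij by (auto simp: bij_betw_def)
    then show "S \<in> \<phi> ` M" using S by (auto simp: M_def)
  qed
  have UM: "finite (\<Union>(\<phi> ` M))" "\<Union>(\<phi> ` M) \<subseteq> P \<union> A" using gates[OF a] G by blast+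
  have lo: "supported q ?R (qudits P A (\<Union>(\<phi> ` M))) (layer_op q P A C (Suc n) (\<phi> ` M))"
    unfolding layer_op_eq_transport[OF UM(2)]
    using supported_transport[OF finite_qudits[OF UM(1)], of id P A ?R q] qudits_mono[OF UM(2), of P A] by simp
  show ?case
  proof (rule exI[of _ F'], rule exI[of _ "N \<union> M"], intro conjI allI impI)
    show "finite (N \<union> M)" "N \<union> M \<subseteq> \<Gamma>" using N \<open>finite M\<close> M by auto
  next
    fix K assume K: "supported q ?R F0 K"
    then have "supported q ?R F (circuit_act q P A C n K)" using IH by blast
    from supported_Un[OF this lo] show "supported q ?R F' (circuit_act q P A C (Suc n) K)"
      unfolding act[OF K] F'_def by (intro conj_op_supported)
  next
    fix K and xs :: "'g list" and E s
    assume K: "supported q ?R F0 K"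
    let ?K = "circuit_act q P A C n K"
    have F: "supported q ?R F ?K" using IH K by blast
    have lK: "local_op q ?R K" "local_op q ?R ?K" using supported_local K F by blast+
    assume *: "distinct xs \<and> N \<union> M \<subseteq> set xs \<and> set xs \<subseteq> \<Gamma> \<and>
       (\<forall>g\<in>set xs. supported q Q (s g) (E g) \<and> unitary_op q Q (E g) \<and> s g \<inter> ?R \<subseteq> qudits P A (\<phi> g)) \<and>
       (\<forall>g\<in>set xs. \<forall>h\<in>set xs. g \<noteq> h \<and> t g = t h \<longrightarrow> s g \<inter> s h = {}) \<and>
       (\<forall>g\<in>N \<union> M. E g = transport q Q id (qudits P A (\<phi> g)) (gate C (\<phi> g) (t g)))"
    define gs where "gs = filter (\<lambda>x. t x = Suc n) xs"
    \<comment> \<open>Factors of one round commute. With those in \<open>M\<close> on the left, the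
      others act first, and trivially.\<close>
    define g1 where "g1 = filter (\<lambda>g. g \<in> M) gs"
    define g2 where "g2 = filter (\<lambda>g. g \<notin> M) gs"
    have sets: "set g1 = M" "set gs = set (g1 @ g2)" "distinct gs" "distinct (g1 @ g2)" "set gs \<subseteq> set xs"
      using * M by (auto simp: gs_def g1_def g2_def)
    have supp: "supported q Q (s g) (E g)" "local_op q Q (E g)" "unitary_op q Q (E g)" if "g \<in> set xs" for g
      using * that supported_local by blast+
    have "opprod q Q E gs = opprod q Q E (g1 @ g2)"
    proof (rule opprod_reorder[where s = "\<lambda>_. 0::nat" and t = "\<lambda>_. 0::nat"])
      fix x y assume xy: "x \<in> set gs" "y \<in> set gs" "x \<noteq> y"
      then have "t x = t y" "x \<in> set xs" "y \<in> set xs" by (auto simp: gs_def)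
      then have "commutes q Q (E x) (E y)" using xy * by (intro disjoint_commute[OF supp(1) supp(1)]) auto
      then show "commutes q Q (E x) (E y) \<or> (0::nat) < 0 \<and> (0::nat) < 0 \<or> (0::nat) < 0 \<and> (0::nat) < 0" ..
    qed (use sets supp in \<open>auto simp: sorted_wrt_iff_nth_less\<close>)
    also have "\<dots> = op_mult q Q (opprod q Q E g1) (opprod q Q E g2)"
      using supp sets by (intro opprod_append) auto
    finally have split: "opprod q Q E gs = op_mult q Q (opprod q Q E g1) (opprod q Q E g2)" .
    have l: "local_op q Q (opprod q Q E g1)" "local_op q Q (opprod q Q E g2)" "local_op q Q (opprod q Q E (ord_list t xs n))"
      "unitary_op q Q (opprod q Q E g2)"
      using supp sets by (auto intro!: opprod_local opprod_unitary simp: set_ord_list)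
    have g1: "opprod q Q E g1 = transport q Q id ?R (layer_op q P A C (Suc n) (\<phi> ` M))"
    proof -
      have "opprod q Q E g1 = opprod q Q (\<lambda>S. transport q Q id (qudits P A S) (gate C S (Suc n))) (map \<phi> g1)"
        unfolding opprod_map using * M sets by (intro opprod_cong) auto
      also have "\<dots> = transport q Q id ?R (layer_op q P A C (Suc n) (set (map \<phi> g1)))"
        using sets G gates[OF a] dis[OF a] Q
        by (intro ext_layer_op[symmetric]) (auto simp: distinct_map intro: pairwise_subset)
      finally show ?thesis using sets by simp
    qed
    have c2: "conj_op q Q (opprod q Q E g2) (transport q Q id ?R ?K) = transport q Q id ?R ?K"
    proof (rule conj_op_commutes[OF l(2) local_ext[OF lK(2) Q] l(4)])
      show "commutes q Q (transport q Q id ?R ?K) (opprod q Q E g2)"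
      proof (rule commutes_opprod[OF local_ext[OF lK(2) Q]], rule conjI)
        fix g assume g: "g \<in> set g2"
        then have gx: "g \<in> set xs" "t g = Suc n" "g \<notin> M" using sets by (auto simp: g2_def gs_def)
        show "local_op q Q (E g)" by (rule supp[OF gx(1)])
        have "qudits P A (\<phi> g) \<inter> F = {}" using gx * by (auto simp: M_def)
        \<comment> \<open>\<open>s g\<close> may reach beyond \<open>\<phi> g\<close>, but only at
          qudits outside \<open>?R\<close>, where \<open>F\<close> has none.\<close>
        then have "F \<inter> s g = {}" using * gx finF by blast
        then show "commutes q Q (transport q Q id ?R ?K) (E g)"
          by (intro disjoint_commute[OF supported_ext[OF F Q] supp(1)[OF gx(1)]])
      qed
    qed
    have "opprod q Q E (ord_list t xs (Suc n)) = op_mult q Q (opprod q Q E gs) (opprod q Q E (ord_list t xs n))"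
      unfolding ord_list.simps gs_def[symmetric]
      by (rule opprod_append) (use supp sets in \<open>auto simp: set_ord_list\<close>)
    then have "conj_op q Q (opprod q Q E (ord_list t xs (Suc n))) (transport q Q id ?R K) =
        conj_op q Q (opprod q Q E g1) (conj_op q Q (opprod q Q E g2)
          (conj_op q Q (opprod q Q E (ord_list t xs n)) (transport q Q id ?R K)))"
      using l local_ext[OF lK(1) Q] by (simp add: split conj_op_mult local_mult conj_op_local)
    also have "conj_op q Q (opprod q Q E (ord_list t xs n)) (transport q Q id ?R K) = transport q Q id ?R ?K"
      using * by (intro IH[rule_format, OF K, THEN conjunct2, rule_format, of xs s E]) auto
    also have "conj_op q Q (opprod q Q E g2) (transport q Q id ?R ?K) = transport q Q id ?R ?K" by (rule c2)
    also have "conj_op q Q (opprod q Q E g1) (transport q Q id ?R ?K) = transport q Q id ?R (circuit_act q P A C (Suc n) K)"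
      unfolding g1 act[OF K] using Q by (intro conj_op_transport[symmetric]) auto
    finally show "conj_op q Q (opprod q Q E (ord_list t xs (Suc n))) (transport q Q id ?R K) =
        transport q Q id ?R (circuit_act q P A C (Suc n) K)" .
  qed
qed

section \<open>Removing the ancillas\<close>

lemma mem_qudits: "(j, l) \<in> qudits P A S \<longleftrightarrow> j \<in> S \<and> (if l = Phys then j \<in> P else j \<in> A)"
  by (cases l) (auto simp: qudits_def phys_qudits_def anc_qudits_def)

text \<open>In one case \<open>sep\<close> asks for more than \<open>borrowing_function\<close>: if
  \<open>i = f j = j\<close>, the times of \<open>j\<close> precede themselves, so no gate acts on
  \<open>j\<close>. Otherwise a gate could act on both qudits of \<open>j\<close>, and the
  replacement would identify them.\<close>

locale borrowing =
  fixes q :: nat and P A :: "'s set" and \<delta> :: "'x \<Rightarrow> 'x \<Rightarrow> real" and loc r and C :: "'s circuit"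
    and \<tau> :: "'s set \<Rightarrow> nat \<Rightarrow> int" and f :: "'s \<Rightarrow> 's" and D' :: nat
  assumes q: "1 \<le> q"
    and circ: "is_circuit q P A \<delta> loc r C"
    and causal: "causal_time C \<tau>"
    and range: "\<And>a S. a \<in> {1..depth C} \<Longrightarrow> S \<in> layer C a \<Longrightarrow> 1 \<le> \<tau> S a \<and> \<tau> S a \<le> int D'"
    and f: "f ` A \<subseteq> P"
    and sep: "\<And>j i. j \<in> A \<Longrightarrow> i = f j \<or> i \<in> A \<and> i \<noteq> j \<and> f i = f j \<Longrightarrow>
      all_before (site_times C \<tau> j) (site_times C \<tau> i) \<or> all_before (site_times C \<tau> i) (site_times C \<tau> j)"
begin

text \<open>The round belongs to the label, since one set of sites may carry gates in several
  rounds.\<close>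

definition gates :: "('s set \<times> nat) set" where
  "gates = {(S, a). a \<in> {1..depth C} \<and> S \<in> layer C a}"

definition \<theta> :: "'s set \<times> nat \<Rightarrow> nat" where
  "\<theta> g = nat (\<tau> (fst g) (snd g))"

abbreviation "bs \<equiv> borrow_sites P A f"
abbreviation "bq \<equiv> borrow_qudit f"
abbreviation "Q \<equiv> qudits P A (P \<union> A)"
abbreviation "R \<equiv> phys_qudits P"
abbreviation "qs g \<equiv> qudits P A (fst g)"

definition op_at :: "'s qudit set \<Rightarrow> 's set \<times> nat \<Rightarrow> 's operator" where
  "op_at B g = transport q Q (subst_on B bq) (qs g) (gate C (fst g) (snd g))"

lemma gate_facts:
  assumes "g \<in> gates"
  shows "fst g \<noteq> {}" "finite (fst g)" "fst g \<subseteq> P \<union> A" "unitary_op q (qs g) (gate C (fst g) (snd g))"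
    "\<And>i j. i \<in> fst g \<Longrightarrow> j \<in> fst g \<Longrightarrow> \<delta> (loc i) (loc j) \<le> r"
    "finite (qs g)" "qs g \<subseteq> Q" "1 \<le> snd g" "snd g \<le> depth C" "1 \<le> \<theta> g" "\<theta> g \<le> D'" "int (\<theta> g) = \<tau> (fst g) (snd g)"
proof -
  obtain S a where g: "g = (S, a)" "a \<in> {1..depth C}" "S \<in> layer C a" using assms by (auto simp: gates_def)
  then show "fst g \<noteq> {}" "finite (fst g)" "fst g \<subseteq> P \<union> A" "unitary_op q (qs g) (gate C (fst g) (snd g))"
    "\<And>i j. i \<in> fst g \<Longrightarrow> j \<in> fst g \<Longrightarrow> \<delta> (loc i) (loc j) \<le> r" "1 \<le> snd g" "snd g \<le> depth C"
    using circ by (auto simp: is_circuit_def)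
  then show "finite (qs g)" "qs g \<subseteq> Q" by (simp_all add: finite_qudits qudits_mono)
  show "1 \<le> \<theta> g" "\<theta> g \<le> D'" "int (\<theta> g) = \<tau> (fst g) (snd g)"
    using range[OF g(2,3)] by (auto simp: \<theta>_def g(1))
qed

text \<open>Gates of the same round are disjoint, so two that share a site belong to different
  rounds, and causality carries their order over to \<theta>. This is the input for exchanging the
  two orders in \<open>reorder\<close>.\<close>

lemma gates_overlap:
  assumes "g \<in> gates" "h \<in> gates" "fst g \<inter> fst h \<noteq> {}" "g \<noteq> h"
  shows "snd g < snd h \<and> \<theta> g < \<theta> h \<or> snd h < snd g \<and> \<theta> h < \<theta> g"
proof -
  have lt: "\<theta> x < \<theta> y" if xy: "x \<in> gates" "y \<in> gates" "fst x \<inter> fst y \<noteq> {}" "snd x < snd y" for x y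
  proof -
    have "\<tau> (fst x) (snd x) < \<tau> (fst y) (snd y)"
    proof -
      obtain S a T b where e: "x = (S, a)" "y = (T, b)" "a \<in> {1..depth C}" "S \<in> layer C a" "b \<in> {1..depth C}" "T \<in> layer C b"
        using xy(1,2) by (auto simp: gates_def)
      then have "a < b \<and> S \<inter> T \<noteq> {} \<longrightarrow> \<tau> S a < \<tau> T b" using causal unfolding causal_time_def by blast
      then show ?thesis using xy(3,4) e by simp
    qed
    then show ?thesis using gate_facts(12)[OF xy(1)] gate_facts(12)[OF xy(2)] by linarith
  qed
  have "snd g \<noteq> snd h"
  proof
    assume e: "snd g = snd h"
    then have "fst g \<noteq> fst h" using assms(4) by (simp add: prod_eq_iff)
    moreover have "pairwise disjnt (layer C (snd g))" "fst g \<in> layer C (snd g)" "fst h \<in> layer C (snd g)"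
      using circ assms(1,2) e by (auto simp: gates_def is_circuit_def)
    ultimately show False using assms(3) by (auto simp: pairwise_def disjnt_def)
  qed
  then consider "snd g < snd h" | "snd h < snd g" by linarith
  then show ?thesis
  proof cases
    case 1
    then show ?thesis using lt[OF assms(1,2,3)] by blast
  next
    case 2
    have "fst h \<inter> fst g \<noteq> {}" using assms(3) by blast
    then show ?thesis using 2 lt[OF assms(2,1)] by blast
  qed
qed

lemma sep_times:
  assumes "j \<in> A" "i = f j \<or> i \<in> A \<and> i \<noteq> j \<and> f i = f j"
  shows "(\<forall>g\<in>gates. \<forall>h\<in>gates. j \<in> fst g \<and> i \<in> fst h \<longrightarrow> \<theta> g < \<theta> h) \<or>
    (\<forall>g\<in>gates. \<forall>h\<in>gates. j \<in> fst g \<and> i \<in> fst h \<longrightarrow> \<theta> h < \<theta> g)"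
proof -
  have mem: "int (\<theta> g) \<in> site_times C \<tau> k" if "g \<in> gates" "k \<in> fst g" for g k
    using that gate_facts(12)[OF that(1)] by (auto simp: site_times_def gates_def intro!: exI[of _ "fst g"] exI[of _ "snd g"])
  have "\<forall>g\<in>gates. \<forall>h\<in>gates. j \<in> fst g \<and> i \<in> fst h \<longrightarrow> \<theta> g < \<theta> h"
    if ab: "all_before (site_times C \<tau> j) (site_times C \<tau> i)"
  proof (intro ballI impI)
    fix g h assume "g \<in> gates" "h \<in> gates" "j \<in> fst g \<and> i \<in> fst h"
    then have "int (\<theta> g) < int (\<theta> h)" using ab mem unfolding all_before_def by blast
    then show "\<theta> g < \<theta> h" by simp
  qed
  moreover have "\<forall>g\<in>gates. \<forall>h\<in>gates. j \<in> fst g \<and> i \<in> fst h \<longrightarrow> \<theta> h < \<theta> g"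
    if ab: "all_before (site_times C \<tau> i) (site_times C \<tau> j)"
  proof (intro ballI impI)
    fix g h assume "g \<in> gates" "h \<in> gates" "j \<in> fst g \<and> i \<in> fst h"
    then have "int (\<theta> h) < int (\<theta> g)" using ab mem unfolding all_before_def by blast
    then show "\<theta> h < \<theta> g" by simp
  qed
  ultimately show ?thesis using sep[OF assms] by blast
qed

lemma mem_anc: "k \<in> anc_qudits A \<longleftrightarrow> (\<exists>j\<in>A. k = (j, Anc))"
  by (auto simp: anc_qudits_def)

lemma bq_anc: "k \<in> anc_qudits A \<Longrightarrow> bq k \<in> Q \<and> bq k \<notin> anc_qudits A"
  using f by (auto simp: mem_anc mem_qudits)

lemma subst_all: "k \<in> Q \<Longrightarrow> subst_on (anc_qudits A) bq k = bq k"
  by (cases k; cases "snd k") (auto simp: subst_on_def mem_anc mem_qudits)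

lemma subst_all_gate: "g \<in> gates \<Longrightarrow> k \<in> qs g \<Longrightarrow> subst_on (anc_qudits A) bq k = bq k"
  using gate_facts(7) subst_all by blast

lemma sep_qudits:
  assumes "k \<in> anc_qudits A" "l \<noteq> k" "l = bq k \<or> l \<in> anc_qudits A \<and> bq l = bq k"
  shows "(\<forall>g\<in>gates. \<forall>h\<in>gates. k \<in> qs g \<and> l \<in> qs h \<longrightarrow> \<theta> g < \<theta> h) \<or>
    (\<forall>g\<in>gates. \<forall>h\<in>gates. k \<in> qs g \<and> l \<in> qs h \<longrightarrow> \<theta> h < \<theta> g)"
proof -
  obtain j where j: "k = (j, Anc)" "j \<in> A" using assms(1) by (auto simp: mem_anc)
  obtain i l' where i: "l = (i, l')" by (cases l)
  have "i = f j \<or> i \<in> A \<and> i \<noteq> j \<and> f i = f j" using assms(2,3) j i by (auto simp: mem_anc)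
  then show ?thesis using sep_times[OF j(2)] unfolding i j(1) mem_qudits by blast
qed

text \<open>If the two qudits coincide, the gates share a site at equal times and are the same. If
  they differ, one of them was replaced, and \<open>sep_qudits\<close> would make the times of the
  gates differ strictly. The case \<open>g = h\<close> gives injectivity on each gate, the other
  case disjointness of simultaneous gates, for every partial replacement.\<close>

lemma subst_collision:
  assumes "g \<in> gates" "h \<in> gates" "\<theta> g = \<theta> h" "k \<in> qs g" "l \<in> qs h" "B \<subseteq> anc_qudits A"
    and "subst_on B bq k = subst_on B bq l"
  shows "g = h \<and> k = l"
proof (cases "k = l")
  case True
  then have "fst g \<inter> fst h \<noteq> {}" using assms(4,5) by (cases k) (auto simp: mem_qudits)
  then show ?thesis using gates_overlap[OF assms(1,2)] assms(3) True by fastforce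
next
  case False
  have "k \<in> B \<or> l \<in> B" using False assms(7) by (simp add: subst_on_def split: if_splits)
  then have False
  proof
    assume k: "k \<in> B"
    have "l = bq k \<or> l \<in> anc_qudits A \<and> bq l = bq k"
      using assms(6,7) k by (auto simp: subst_on_def split: if_splits)
    moreover have "k \<in> anc_qudits A" using k assms(6) by blast
    ultimately show False using sep_qudits[of k l] False assms(1-5) by (metis less_irrefl)
  next
    assume l: "l \<in> B"
    have "k = bq l \<or> k \<in> anc_qudits A \<and> bq k = bq l"
      using assms(6,7) l by (auto simp: subst_on_def split: if_splits)
    moreover have "l \<in> anc_qudits A" using l assms(6) by blast
    ultimately show False using sep_qudits[of l k] False assms(1-5) by (metis less_irrefl)
  qed
  then show ?thesis ..
qed

lemma inj_subst: "g \<in> gates \<Longrightarrow> B \<subseteq> anc_qudits A \<Longrightarrow> inj_on (subst_on B bq) (qs g)"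
  by (rule inj_onI) (use subst_collision[of g g] in blast)

lemma inj_bq: "g \<in> gates \<Longrightarrow> inj_on bq (qs g)"
  using inj_subst[of g "anc_qudits A"] subst_all_gate[of g] by (simp cong: inj_on_cong)

lemma subst_image: "g \<in> gates \<Longrightarrow> B \<subseteq> anc_qudits A \<Longrightarrow> subst_on B bq ` qs g \<subseteq> Q"
  using gate_facts(7)[of g] bq_anc by (auto simp: subst_on_def simp del: split_paired_All)

lemma op_at_facts:
  assumes "g \<in> gates" "B \<subseteq> anc_qudits A"
  shows "supported q Q (subst_on B bq ` qs g) (op_at B g)" "local_op q Q (op_at B g)" "unitary_op q Q (op_at B g)"
proof -
  show s: "supported q Q (subst_on B bq ` qs g) (op_at B g)"
    unfolding op_at_def using gate_facts(6)[OF assms(1)] subst_image[OF assms] inj_subst[OF assms]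
    by (rule supported_transport)
  show "local_op q Q (op_at B g)" using s by (rule supported_local)
  show "unitary_op q Q (op_at B g)"
    unfolding op_at_def using inj_subst[OF assms] subst_image[OF assms] gate_facts(4)[OF assms(1)]
    by (rule unitary_transport)
qed

lemma op_at_empty: "op_at {} g = transport q Q id (qs g) (gate C (fst g) (snd g))"
  unfolding op_at_def by (rule transport_cong) (simp add: subst_on_def)

section \<open>The circuit on the physical qudits\<close>

lemma qudits_bs:
  assumes "g \<in> gates" shows "qudits P {} (bs (fst g)) = bq ` qs g"
proof (intro equalityI subsetI)
  fix k assume "k \<in> qudits P {} (bs (fst g))"
  then obtain i where k: "k = (i, Phys)" "i \<in> P" "i \<in> bs (fst g)"
    by (auto simp: qudits_def phys_qudits_def anc_qudits_def)
  then consider "i \<in> fst g" | j where "j \<in> fst g" "j \<in> A" "i = f j" by (auto simp: borrow_sites_def)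
  then show "k \<in> bq ` qs g"
  proof cases
    case 1
    then have "(i, Phys) \<in> qs g" using k by (simp add: mem_qudits)
    then show ?thesis using k by force
  next
    case 2
    then have "(j, Anc) \<in> qs g" by (simp add: mem_qudits)
    then show ?thesis using k 2 by force
  qed
next
  fix k assume "k \<in> bq ` qs g"
  then obtain j l where "k = bq (j, l)" "(j, l) \<in> qs g" by auto
  then show "k \<in> qudits P {} (bs (fst g))"
    using f by (cases l) (auto simp: mem_qudits borrow_sites_def)
qed

lemma bs_overlap:
  assumes "g \<in> gates" "h \<in> gates" "\<theta> g = \<theta> h" "x \<in> bs (fst g)" "x \<in> bs (fst h)"
  shows "g = h"
proof -
  have "x \<in> P" using assms(4) f by (auto simp: borrow_sites_def)
  then have "(x, Phys) \<in> bq ` qs g" "(x, Phys) \<in> bq ` qs h"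
    using assms by (simp_all add: qudits_bs[symmetric] mem_qudits)
  then obtain k l where "k \<in> qs g" "l \<in> qs h" "bq k = bq l" by (metis imageE)
  then show ?thesis
    using subst_collision[OF assms(1-3), of k l "anc_qudits A"] subst_all_gate assms(1,2) by auto
qed

lemma bs_facts:
  assumes "g \<in> gates"
  shows "bs (fst g) \<noteq> {}" "finite (bs (fst g))" "bs (fst g) \<subseteq> P"
  using gate_facts[OF assms] f by (auto simp: borrow_sites_def)

lemma bs_inject: "g \<in> gates \<Longrightarrow> h \<in> gates \<Longrightarrow> \<theta> g = \<theta> h \<Longrightarrow> bs (fst g) = bs (fst h) \<Longrightarrow> g = h"
  using bs_overlap[of g h] bs_facts(1)[of g] by auto

text \<open>A gate is addressed by its sites and its round; \<open>bs_inject\<close> shows that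
  these determine the original gate, so \<open>SOME\<close> has only one candidate.\<close>

definition C' :: "'s circuit" where
  "C' = \<lparr>depth = D', layer = \<lambda>t. {bs S |S a. a \<in> {1..depth C} \<and> S \<in> layer C a \<and> \<tau> S a = int t},
     gate = \<lambda>S' t. let g = (SOME g. g \<in> gates \<and> bs (fst g) = S' \<and> \<theta> g = t) in
       borrow_op q (qs g) f (gate C (fst g) (snd g))\<rparr>"

lemma depth_C': "depth C' = D'" by (simp add: C'_def)

lemma layer_C': "layer C' t = (\<lambda>g. bs (fst g)) ` {g \<in> gates. \<theta> g = t}"
proof -
  have "\<tau> S a = int t \<longleftrightarrow> \<theta> (S, a) = t" if "(S, a) \<in> gates" for S a
    using gate_facts(12)[OF that] by auto
  then have "{(S, a). (S, a) \<in> gates \<and> \<tau> S a = int t} = {g \<in> gates. \<theta> g = t}" by auto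
  moreover have "layer C' t = (\<lambda>g. bs (fst g)) ` {(S, a). (S, a) \<in> gates \<and> \<tau> S a = int t}"
  proof (intro equalityI subsetI)
    fix x assume "x \<in> layer C' t"
    then obtain S a where S: "x = bs S" "(S, a) \<in> gates" "\<tau> S a = int t" by (auto simp: C'_def gates_def)
    show "x \<in> (\<lambda>g. bs (fst g)) ` {(S, a). (S, a) \<in> gates \<and> \<tau> S a = int t}"
      by (rule image_eqI[of _ _ "(S, a)"]) (use S in auto)
  qed (auto simp: C'_def gates_def)
  ultimately show ?thesis by simp
qed

lemma gate_C': 
  assumes "g \<in> gates"
  shows "gate C' (bs (fst g)) (\<theta> g) = borrow_op q (qs g) f (gate C (fst g) (snd g))"
proof -
  have "(SOME h. h \<in> gates \<and> bs (fst h) = bs (fst g) \<and> \<theta> h = \<theta> g) = g"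
    using assms bs_inject by (intro some_equality) auto
  then show ?thesis by (simp add: C'_def Let_def)
qed

lemma borrowed: "borrowed_circuit q P A C \<tau> f C'"
proof -
  have "1 \<le> \<tau> S a \<and> \<tau> S a \<le> int (depth C') \<and> inj_on bq (qudits P A S) \<and>
     gate C' (bs S) (nat (\<tau> S a)) = borrow_op q (qudits P A S) f (gate C S a)"
    if "a \<in> {1..depth C}" "S \<in> layer C a" for a S
  proof -
    have "(S, a) \<in> gates" using that by (simp add: gates_def)
    then show ?thesis using range[OF that] inj_bq[of "(S, a)"] gate_C'[of "(S, a)"] by (simp add: depth_C' \<theta>_def)
  qed
  then show ?thesis unfolding borrowed_circuit_def by (simp add: C'_def)
qed

lemma is_circuit_C':
  assumes "\<And>g i j. g \<in> gates \<Longrightarrow> i \<in> bs (fst g) \<Longrightarrow> j \<in> bs (fst g) \<Longrightarrow> \<delta> (loc i) (loc j) \<le> r'"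
  shows "is_circuit q P {} \<delta> loc r' C'"
  unfolding is_circuit_def
proof (intro ballI conjI)
  fix t
  show "pairwise disjnt (layer C' t)"
    unfolding layer_C' pairwise_def disjnt_def using bs_overlap by blast
  fix S' assume "S' \<in> layer C' t"
  then obtain g where g: "g \<in> gates" "\<theta> g = t" "S' = bs (fst g)" by (auto simp: layer_C')
  show "S' \<noteq> {}" "finite S'" "S' \<subseteq> P \<union> {}" using bs_facts[OF g(1)] g(3) by auto
  have "unitary_op q (bq ` qs g) (transport q (bq ` qs g) bq (qs g) (gate C (fst g) (snd g)))"
    using inj_bq[OF g(1)] gate_facts(4)[OF g(1)] by (intro unitary_transport) auto
  then show "unitary_op q (qudits P {} S') (gate C' S' t)"
    using gate_C'[OF g(1)] g qudits_bs[OF g(1)] by (simp add: borrow_op_eq_transport)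
  fix i j assume "i \<in> S'" "j \<in> S'"
  then show "\<delta> (loc i) (loc j) \<le> r'" using assms g by blast
qed

lemma R_eq: "qudits P {} (P \<union> {}) = R"
  by (simp add: qudits_def anc_qudits_def phys_qudits_def)

lemma R_sub: "R \<subseteq> Q"
  by (auto simp: qudits_def anc_qudits_def phys_qudits_def)

text \<open>It suffices that \<open>B\<close> contains the ancillas of this one gate, which lets a
  finite \<open>B\<close> serve for finitely many gates.\<close>

lemma ext_gate_C':
  assumes "g \<in> gates" "qs g \<inter> anc_qudits A \<subseteq> B"
  shows "transport q Q id (qudits P {} (bs (fst g))) (gate C' (bs (fst g)) (\<theta> g)) = op_at B g"
proof -
  have "bq ` qs g \<subseteq> Q" using subst_image[OF assms(1) subset_refl] subst_all_gate[OF assms(1)] by (auto simp: image_iff)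
  then have "transport q Q id (bq ` qs g) (transport q (bq ` qs g) bq (qs g) (gate C (fst g) (snd g))) =
      transport q Q (id \<circ> bq) (qs g) (gate C (fst g) (snd g))"
    by (intro transport_transport) auto
  also have "\<dots> = op_at B g"
    unfolding op_at_def
  proof (rule transport_cong)
    fix k assume k: "k \<in> qs g"
    then show "(id \<circ> bq) k = subst_on B bq k"
      using subst_all_gate[OF assms(1) k] assms(2) by (auto simp: subst_on_def split: if_splits)
  qed
  finally show ?thesis using assms(1) by (simp add: qudits_bs gate_C' borrow_op_eq_transport)
qed

lemma bij_C: "a \<in> {1..depth C} \<Longrightarrow> bij_betw fst {g \<in> gates. snd g = a} (layer C a)"
  by (auto simp: bij_betw_def inj_on_def gates_def image_iff)

lemma bij_C': "t \<in> {1..depth C'} \<Longrightarrow> bij_betw (\<lambda>g. bs (fst g)) {g \<in> gates. \<theta> g = t} (layer C' t)"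
  unfolding layer_C' bij_betw_def inj_on_def using bs_inject by blast

lemma circuit_hyps:
  "\<And>a S. a \<in> {1..depth C} \<Longrightarrow> S \<in> layer C a \<Longrightarrow> finite S \<and> S \<subseteq> P \<union> A \<and> unitary_op q (qudits P A S) (gate C S a)"
  "\<And>a. a \<in> {1..depth C} \<Longrightarrow> pairwise disjnt (layer C a)"
  using circ by (auto simp: is_circuit_def)

lemma circuit_hyps':
  "\<And>a S. a \<in> {1..depth C'} \<Longrightarrow> S \<in> layer C' a \<Longrightarrow> finite S \<and> S \<subseteq> P \<union> {} \<and> unitary_op q (qudits P {} S) (gate C' S a)"
  "\<And>a. a \<in> {1..depth C'} \<Longrightarrow> pairwise disjnt (layer C' a)"
proof -
  have "is_circuit q P {} (\<lambda>_ _. 0) loc 0 C'"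
  proof -
    \<comment> \<open>The properties wanted here do not mention distances. With the zero distance
      function the range condition of \<open>is_circuit_C'\<close> is trivial.\<close>
    interpret b0: borrowing q P A "\<lambda>_ _. 0" loc 0 C \<tau> f D'
      using q causal range f sep circ by unfold_locales (auto simp: is_circuit_def)
    show ?thesis using b0.is_circuit_C' by simp
  qed
  then show "\<And>a S. a \<in> {1..depth C'} \<Longrightarrow> S \<in> layer C' a \<Longrightarrow> finite S \<and> S \<subseteq> P \<union> {} \<and> unitary_op q (qudits P {} S) (gate C' S a)"
    "\<And>a. a \<in> {1..depth C'} \<Longrightarrow> pairwise disjnt (layer C' a)"
    unfolding is_circuit_def by blast+
qed

text \<open>Gates sharing a site are ordered alike by round and by \<theta>, and all other pairs
  commute.\<close>

lemma reorder:
  assumes "distinct xs" "set xs \<subseteq> gates"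
  shows "opprod q Q (op_at {}) (ord_list snd xs (depth C)) = opprod q Q (op_at {}) (ord_list \<theta> xs D')"
proof (rule opprod_reorder[where s = snd and t = \<theta>])
  have "{x \<in> set xs. 1 \<le> snd x \<and> snd x \<le> depth C} = set xs" "{x \<in> set xs. 1 \<le> \<theta> x \<and> \<theta> x \<le> D'} = set xs"
    using assms(2) gate_facts(8-11) by blast+
  then show "set (ord_list snd xs (depth C)) = set (ord_list \<theta> xs D')" by (simp add: set_ord_list)
next
  fix x y assume "x \<in> set (ord_list snd xs (depth C))" "y \<in> set (ord_list snd xs (depth C))" "x \<noteq> y"
  then have xy: "x \<in> gates" "y \<in> gates" "x \<noteq> y" using assms(2) by (auto simp: set_ord_list)
  show "commutes q Q (op_at {} x) (op_at {} y) \<or> snd x < snd y \<and> \<theta> x < \<theta> y \<or> snd y < snd x \<and> \<theta> y < \<theta> x"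
  proof (cases "fst x \<inter> fst y = {}")
    case True
    have s: "supported q Q (qs g) (op_at {} g)" if "g \<in> gates" for g
      using op_at_facts(1)[OF that, of "{}"] by (simp add: subst_on_def)
    show ?thesis using disjoint_commute[OF s[OF xy(1)] s[OF xy(2)] qudits_disjoint[OF True]] by blast
  next
    case False
    then show ?thesis using gates_overlap[OF xy(1,2) False xy(3)] by blast
  qed
next
  fix g assume "g \<in> set (ord_list snd xs (depth C))"
  then show "local_op q Q (op_at {} g)" using assms(2) op_at_facts(2)[of g "{}"] by (auto simp: set_ord_list)
qed (use assms(1) in \<open>simp_all add: distinct_ord_list sorted_ord_list\<close>)

lemma substitute:
  assumes "set xs \<subseteq> gates" "finite B" "B \<subseteq> anc_qudits A"
    and comm: "\<And>k M. k \<in> B \<Longrightarrow> supported q Q {k} M \<Longrightarrow>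
      commutes q Q (opprod q Q (op_at {}) (ord_list \<theta> xs D')) M"
  shows "opprod q Q (op_at B) (ord_list \<theta> xs D') = opprod q Q (op_at {}) (ord_list \<theta> xs D')"
proof -
  have sub: "set (ord_list \<theta> xs D') \<subseteq> gates" using assms(1) by (auto simp: set_ord_list)
  have "opprod q Q (\<lambda>x. transport q Q (subst_on B bq) (qs x) (gate C (fst x) (snd x))) (ord_list \<theta> xs D') =
    opprod q Q (\<lambda>x. transport q Q id (qs x) (gate C (fst x) (snd x))) (ord_list \<theta> xs D')"
  proof (rule opprod_substitution[OF q assms(2), where t = \<theta>])
    show "B \<subseteq> Q" using assms(3) by (auto simp: qudits_def anc_qudits_def)
    show "bq ` B \<subseteq> Q - B" using bq_anc assms(3) by blast
    show "sorted_wrt (\<lambda>x y. \<theta> y \<le> \<theta> x) (ord_list \<theta> xs D')" by (rule sorted_ord_list)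
  next
    fix x assume "x \<in> set (ord_list \<theta> xs D')"
    then have x: "x \<in> gates" using sub by blast
    show "finite (qs x) \<and> qs x \<subseteq> Q \<and> unitary_op q (qs x) (gate C (fst x) (snd x))"
      using gate_facts(4,6,7)[OF x] by blast
    fix B' assume "B' \<subseteq> B"
    then show "inj_on (subst_on B' bq) (qs x)" using inj_subst[OF x] assms(3) by blast
  next
    fix k l assume k: "k \<in> B" "l \<noteq> k" "l = bq k \<or> l \<in> B \<and> bq l = bq k"
    have "k \<in> anc_qudits A" "l = bq k \<or> l \<in> anc_qudits A \<and> bq l = bq k" using k assms(3) by blast+
    from sep_qudits[OF this(1) k(2) this(2)]
    show "(\<forall>x\<in>set (ord_list \<theta> xs D'). \<forall>y\<in>set (ord_list \<theta> xs D'). k \<in> qs x \<and> l \<in> qs y \<longrightarrow> \<theta> x < \<theta> y) \<or>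
      (\<forall>x\<in>set (ord_list \<theta> xs D'). \<forall>y\<in>set (ord_list \<theta> xs D'). k \<in> qs x \<and> l \<in> qs y \<longrightarrow> \<theta> y < \<theta> x)"
      using sub by blast
  next
    fix k M assume "k \<in> B" "supported q Q {k} M"
    then show "commutes q Q (opprod q Q (\<lambda>x. transport q Q id (qs x) (gate C (fst x) (snd x))) (ord_list \<theta> xs D')) M"
      using comm unfolding op_at_empty by blast
  qed
  then show ?thesis unfolding op_at_empty[abs_def] op_at_def[abs_def] by (simp only: op_at_empty[unfolded op_at_def])
qed

text \<open>One set \<open>N\<close> serves all operators on \<open>F\<close>, since a single
  product will have to commute with every operator on a given ancilla. It may be enlarged by
  arbitrary gates, so cones of several sets can be merged.\<close>

definition is_cone :: "'s qudit set \<Rightarrow> ('s set \<times> nat) set \<Rightarrow> bool" where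
  "is_cone F N \<longleftrightarrow> finite N \<and> N \<subseteq> gates \<and>
    (\<forall>K xs. supported q Q F K \<longrightarrow> distinct xs \<longrightarrow> N \<subseteq> set xs \<longrightarrow> set xs \<subseteq> gates \<longrightarrow>
      conj_op q Q (opprod q Q (op_at {}) (ord_list snd xs (depth C))) K = circuit_act q P A C (depth C) K)"

text \<open>Only the gates in \<open>N\<close> must have all their ancillas replaced. The other
  gates of \<open>xs\<close> may keep ancillas outside \<open>B\<close>, yet they do not disturb the
  evolution of \<open>K\<close>.\<close>

definition is_borrowed_cone :: "'s qudit set \<Rightarrow> ('s set \<times> nat) set \<Rightarrow> bool" where
  "is_borrowed_cone F N \<longleftrightarrow> finite N \<and> N \<subseteq> gates \<and>
    (\<forall>K. supported q R F K \<longrightarrow> local_op q R (circuit_act q P {} C' D' K) \<and>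
      (\<forall>xs B. distinct xs \<longrightarrow> N \<subseteq> set xs \<longrightarrow> set xs \<subseteq> gates \<longrightarrow>
        B \<subseteq> anc_qudits A \<longrightarrow> (\<forall>g\<in>N. qs g \<inter> anc_qudits A \<subseteq> B) \<longrightarrow>
        conj_op q Q (opprod q Q (op_at B) (ord_list \<theta> xs D')) (transport q Q id R K) =
          transport q Q id R (circuit_act q P {} C' D' K)))"

lemma cone:
  assumes "finite F" "F \<subseteq> Q"
  obtains N where "is_cone F N"
proof -
  obtain F' N where N: "finite N" "N \<subseteq> gates" and *: "\<forall>K. supported q Q F K \<longrightarrow>
     supported q Q F' (circuit_act q P A C (depth C) K) \<and>
     (\<forall>xs E s.
       distinct xs \<and> N \<subseteq> set xs \<and> set xs \<subseteq> gates \<and>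
       (\<forall>g\<in>set xs. supported q Q (s g) (E g) \<and> unitary_op q Q (E g) \<and> s g \<inter> Q \<subseteq> qs g) \<and>
       (\<forall>g\<in>set xs. \<forall>h\<in>set xs. g \<noteq> h \<and> snd g = snd h \<longrightarrow> s g \<inter> s h = {}) \<and>
       (\<forall>g\<in>N. E g = transport q Q id (qs g) (gate C (fst g) (snd g))) \<longrightarrow>
       conj_op q Q (opprod q Q E (ord_list snd xs (depth C))) (transport q Q id Q K) =
         transport q Q id Q (circuit_act q P A C (depth C) K))"
    using circuit_act_cone[of C P A q fst gates snd Q "depth C" F, OF circuit_hyps bij_C subset_refl order_refl assms]
    by blast
  have "is_cone F N"
    unfolding is_cone_def
  proof (intro conjI allI impI N)
    fix K and xs :: "('s set \<times> nat) list" assume K: "supported q Q F K" and xs: "distinct xs" "N \<subseteq> set xs" "set xs \<subseteq> gates"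
    have self: "transport q Q id Q M = M" if "supported q Q G M" for M G
      using that by (intro transport_self local_is_op supported_local)
    have "conj_op q Q (opprod q Q (op_at {}) (ord_list snd xs (depth C))) (transport q Q id Q K) =
        transport q Q id Q (circuit_act q P A C (depth C) K)"
    proof (rule *[rule_format, OF K, THEN conjunct2, rule_format, of xs qs], intro conjI ballI impI)
      fix g assume "g \<in> set xs"
      then have g: "g \<in> gates" using xs by blast
      show "supported q Q (qs g) (op_at {} g)" "unitary_op q Q (op_at {} g)"
        using op_at_facts[OF g, of "{}"] by (simp_all add: subst_on_def)
      fix h assume "h \<in> set xs" "g \<noteq> h \<and> snd g = snd h"
      then show "qs g \<inter> qs h = {}" using gates_overlap[OF g, of h] xs by (intro qudits_disjoint) auto
    qed (use xs op_at_empty in auto)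
    moreover have "supported q Q F' (circuit_act q P A C (depth C) K)" using * K by blast
    ultimately show "conj_op q Q (opprod q Q (op_at {}) (ord_list snd xs (depth C))) K = circuit_act q P A C (depth C) K"
      using self[OF K] self by metis
  qed
  then show ?thesis by (rule that)
qed

lemma cone':
  assumes "finite F" "F \<subseteq> R"
  obtains N where "is_borrowed_cone F N"
proof -
  obtain F' N where N: "finite N" "N \<subseteq> gates" and *: "\<forall>K. supported q R F K \<longrightarrow>
     supported q R F' (circuit_act q P {} C' D' K) \<and>
     (\<forall>xs E s.
       distinct xs \<and> N \<subseteq> set xs \<and> set xs \<subseteq> gates \<and>
       (\<forall>g\<in>set xs. supported q Q (s g) (E g) \<and> unitary_op q Q (E g) \<and> s g \<inter> R \<subseteq> qudits P {} (bs (fst g))) \<and>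
       (\<forall>g\<in>set xs. \<forall>h\<in>set xs. g \<noteq> h \<and> \<theta> g = \<theta> h \<longrightarrow> s g \<inter> s h = {}) \<and>
       (\<forall>g\<in>N. E g = transport q Q id (qudits P {} (bs (fst g))) (gate C' (bs (fst g)) (\<theta> g))) \<longrightarrow>
       conj_op q Q (opprod q Q E (ord_list \<theta> xs D')) (transport q Q id R K) =
         transport q Q id R (circuit_act q P {} C' D' K))"
    using circuit_act_cone[of C' P "{}" q "\<lambda>g. bs (fst g)" gates \<theta> Q D' F, unfolded R_eq, OF circuit_hyps' bij_C' R_sub _ assms]
    unfolding depth_C' by blast
  have "is_borrowed_cone F N"
    unfolding is_borrowed_cone_def
  proof (intro conjI allI impI N)
    fix K assume K: "supported q R F K"
    show "local_op q R (circuit_act q P {} C' D' K)" using * K supported_local by blast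
    fix xs :: "('s set \<times> nat) list" and B assume xs: "distinct xs" "N \<subseteq> set xs" "set xs \<subseteq> gates"
      and B: "B \<subseteq> anc_qudits A" "\<forall>g\<in>N. qs g \<inter> anc_qudits A \<subseteq> B"
    show "conj_op q Q (opprod q Q (op_at B) (ord_list \<theta> xs D')) (transport q Q id R K) =
        transport q Q id R (circuit_act q P {} C' D' K)"
    proof (rule *[rule_format, OF K, THEN conjunct2, rule_format, of xs "\<lambda>g. subst_on B bq ` qs g"], intro conjI ballI impI)
      fix g assume "g \<in> set xs"
      then have g: "g \<in> gates" using xs by blast
      show "supported q Q (subst_on B bq ` qs g) (op_at B g)" "unitary_op q Q (op_at B g)"
        using op_at_facts[OF g B(1)] by simp_all
      show "subst_on B bq ` qs g \<inter> R \<subseteq> qudits P {} (bs (fst g))"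
      proof
        fix l assume l: "l \<in> subst_on B bq ` qs g \<inter> R"
        then obtain k where k: "k \<in> qs g" "l = subst_on B bq k" by auto
        \<comment> \<open>A physical qudit in the support of the partly replaced gate is either an
          original physical qudit or a lender, so the complete replacement yields it as
          well.\<close>
        have "l = bq k"
        proof (cases "k \<in> B")
          case False
          then have "l = k" using k by (simp add: subst_on_def)
          moreover have "snd l = Phys" using l unfolding phys_qudits_def by (metis IntD2 mem_Times_iff singletonD)
          ultimately show ?thesis by (cases k) auto
        qed (use k in \<open>simp add: subst_on_def\<close>)
        then show "l \<in> qudits P {} (bs (fst g))" using k(1) qudits_bs[OF g] by blast
      qed
      fix h assume h: "h \<in> set xs" "g \<noteq> h \<and> \<theta> g = \<theta> h"
      then have "h \<in> gates" using xs by blast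
      then show "subst_on B bq ` qs g \<inter> subst_on B bq ` qs h = {}"
        using subst_collision[OF g _ _ _ _ B(1)] h(2) by blast
    next
      fix g assume "g \<in> N"
      then show "op_at B g = transport q Q id (qudits P {} (bs (fst g))) (gate C' (bs (fst g)) (\<theta> g))"
        using ext_gate_C'[of g B] B(2) N by auto
    qed (use xs in auto)
  qed
  then show ?thesis by (rule that)
qed

text \<open>All gates fit into one list and every ancilla is replaced. The product itself is
  unchanged, so \<open>V\<close> is recovered exactly and not only up to a phase.\<close>

lemma implements_unitary_C':
  assumes "finite (P \<union> A)" "implements_unitary q P A C V"
  shows "implements_unitary q P {} C' V"
proof -
  have V: "unitary_op q R V" "circuit_op q P A C (depth C) = transport q Q id R V"
    using assms(2) by (simp_all add: implements_unitary_def op_ext_eq_transport)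
  have "gates \<subseteq> Pow (P \<union> A) \<times> {1..depth C}"
    using gate_facts(3,8,9) by (fastforce simp: subset_iff)
  then have "finite gates" using assms(1) finite_subset by blast
  then obtain xs where xs: "distinct xs" "set xs = gates" using finite_distinct_list by metis
  have finA: "finite (anc_qudits A)" using assms(1) by (simp add: anc_qudits_def)
  let ?U = "opprod q Q (op_at {}) (ord_list \<theta> xs D')"
  have "transport q Q id Q (circuit_op q P A C (depth C)) =
      opprod q Q (\<lambda>g. transport q Q id (qs g) (gate C (fst g) (snd g))) (ord_list snd xs (depth C))"
    by (rule circuit_op_eq_opprod[OF circuit_hyps xs(1) _ subset_refl order_refl]) (use bij_C xs(2) in auto)
  also have "\<dots> = ?U" using reorder[OF xs(1)] xs(2) unfolding op_at_empty[symmetric] by simp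
  finally have U: "transport q Q id R V = ?U"
    by (simp only: V(2) transport_self[OF is_op_transport])
  have finR: "finite R" using assms(1) by (simp add: phys_qudits_def)
  have supV: "supported q Q R (transport q Q id R V)"
    using supported_transport[OF finR, of id Q q V] R_sub by simp
  have "commutes q Q ?U M" if "k \<in> anc_qudits A" "supported q Q {k} M" for k M
    unfolding U[symmetric] using that
    by (intro disjoint_commute[OF supV that(2)]) (auto simp: phys_qudits_def anc_qudits_def)
  then have sub: "opprod q Q (op_at (anc_qudits A)) (ord_list \<theta> xs D') = ?U"
    by (intro substitute finA) (simp_all add: xs)
  have "transport q Q id R (circuit_op q P {} C' D') =
      opprod q Q (\<lambda>g. transport q Q id (qudits P {} (bs (fst g))) (gate C' (bs (fst g)) (\<theta> g))) (ord_list \<theta> xs D')"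
    by (rule circuit_op_eq_opprod[of C' P "{}" q xs, unfolded R_eq, OF circuit_hyps' xs(1) _ R_sub]) (use bij_C' xs(2) depth_C' in auto)
  also have "\<dots> = opprod q Q (op_at (anc_qudits A)) (ord_list \<theta> xs D')"
    by (rule opprod_cong, rule ext_gate_C') (use xs(2) in \<open>auto simp: set_ord_list\<close>)
  finally have eq: "transport q Q id R (circuit_op q P {} C' D') = transport q Q id R V" using sub U by simp
  \<comment> \<open>For \<open>ext_inject\<close>: the entries vanish outside the configurations of
    physical qudits.\<close>
  have isop: "is_op q R (circuit_op q P {} C' n)" for n
  proof (induction n)
    case (Suc n)
    have "is_op q R (op_mult q R K L)" if "is_op q R K" "is_op q R L" for K L
      unfolding is_op_def
    proof (intro allI impI)
      fix \<sigma> \<tau> assume "op_mult q R K L \<sigma> \<tau> \<noteq> 0"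
      then obtain \<rho> where "K \<sigma> \<rho> * L \<rho> \<tau> \<noteq> 0" unfolding op_mult_def by (meson sum.neutral)
      then show "\<sigma> \<in> configs q R \<and> \<tau> \<in> configs q R" using that unfolding is_op_def by (metis mult_eq_0_iff)
    qed
    moreover have "is_op q R (layer_op q P {} C' (Suc n) (layer C' (Suc n)))"
      unfolding is_op_def layer_op_def R_eq by auto
    ultimately show ?case using Suc unfolding circuit_op.simps R_eq by blast
  next
    case 0
    show ?case unfolding circuit_op.simps R_eq by (rule is_op_id)
  qed
  have "circuit_op q P {} C' D' = V"
    using eq V(1) by (intro ext_inject[OF q R_sub isop]) (auto simp: unitary_op_def)
  moreover have "op_ext q R R V = V"
    unfolding op_ext_eq_transport using V(1) by (intro transport_self) (simp add: unitary_op_def)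
  ultimately show ?thesis using V(1) unfolding implements_unitary_def depth_C' R_eq by simp
qed

text \<open>A finite product of gates imitates the circuit on all operators relevant to one given
  \<open>K\<close>; to this product the substitution applies.\<close>

lemma implements_action_C':
  assumes "implements_action q P A C \<beta>"
  shows "implements_action q P {} C' \<beta>"
proof -
  let ?e = "transport q Q id R"
  have loc\<beta>: "local_op q R (\<beta> K)" if "local_op q R K" for K
    using assms that by (simp add: implements_action_def)
  have act: "circuit_act q P A C (depth C) (op_mult q Q (?e K) (transport q Q id (anc_qudits A) L)) =
      op_mult q Q (?e (\<beta> K)) (transport q Q id (anc_qudits A) L)"
    if "local_op q R K" "local_op q (anc_qudits A) L" for K L
    using assms that by (simp add: implements_action_def Let_def op_ext_eq_transport)
  have ancQ: "anc_qudits A \<subseteq> Q" by (auto simp: qudits_def anc_qudits_def)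
  \<comment> \<open>The circuit fixes the identity, which forces \<beta> to do so. Inserting the
    identity for \<open>K\<close> in \<open>act\<close> then isolates the ancilla factor and gives
    \<open>fix_anc\<close>.\<close>
  have id: "\<beta> (op_id q R) = op_id q R"
  proof (rule ext_inject[OF q R_sub])
    obtain N where "is_cone {} N" by (rule cone[of "{}"]) auto
    then have N: "finite N" "N \<subseteq> gates" and act_N: "\<And>K xs. supported q Q {} K \<Longrightarrow> distinct xs \<Longrightarrow> N \<subseteq> set xs \<Longrightarrow> set xs \<subseteq> gates \<Longrightarrow>
      conj_op q Q (opprod q Q (op_at {}) (ord_list snd xs (depth C))) K = circuit_act q P A C (depth C) K"
      unfolding is_cone_def by simp_all
    obtain xs where xs: "distinct xs" "set xs = N" using finite_distinct_list[OF N(1)] by metis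
    have lu: "local_op q Q (op_at {} g) \<and> unitary_op q Q (op_at {} g)" if "g \<in> set (ord_list snd xs (depth C))" for g
      using op_at_facts[of g "{}"] that xs N(2) by (auto simp: set_ord_list)
    have "circuit_act q P A C (depth C) (op_id q Q) = conj_op q Q (opprod q Q (op_at {}) (ord_list snd xs (depth C))) (op_id q Q)"
      by (rule act_N[symmetric]) (use xs N(2) in \<open>auto intro: supported_id\<close>)
    also have "\<dots> = op_id q Q"
      using lu by (intro conj_op_commutes opprod_local opprod_unitary local_id) (auto intro!: local_mult_id opprod_local simp: local_mult_id opprod_local)
    finally have "circuit_act q P A C (depth C) (op_id q Q) = op_id q Q" .
    moreover have "?e (op_id q R) = op_id q Q" "transport q Q id (anc_qudits A) (op_id q (anc_qudits A)) = op_id q Q"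
      using R_sub ancQ by (simp_all add: transport_id_op)
    ultimately show "?e (\<beta> (op_id q R)) = ?e (op_id q R)"
      using act[OF local_id local_id] local_ext[OF loc\<beta>[OF local_id] R_sub] local_id
      by (simp only: local_mult_id local_mult_id[OF local_id])
  qed (use local_is_op loc\<beta> local_id is_op_id in blast)+
  have fix_anc: "circuit_act q P A C (depth C) M = M" if kM: "k \<in> anc_qudits A" "supported q Q {k} M" for k M
  proof -
    obtain L where L: "M = transport q Q id {k} L" using kM(2) by (auto simp: supported_def)
    define L' where "L' = transport q (anc_qudits A) id {k} L"
    have "supported q (anc_qudits A) (id ` {k}) L'"
      unfolding L'_def by (rule supported_transport) (use kM(1) in auto)
    then have lL: "local_op q (anc_qudits A) L'" by (rule supported_local)
    have M: "transport q Q id (anc_qudits A) L' = M"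
      unfolding L L'_def using kM(1) ancQ by (subst transport_transport) auto
    have "?e (op_id q R) = op_id q Q" using R_sub by (simp add: transport_id_op)
    then show ?thesis using act[OF local_id lL] unfolding id M using supported_local[OF kM(2)] by (simp only: local_mult_id)
  qed
  \<comment> \<open>Without ancillas, an operator on them is a scalar, here the extension of
    \<open>L\<close> from the empty set. As \<beta> is not assumed linear, the scalar cannot simply
    be pulled out; in \<open>extM\<close> it is read as an operator on the ancillas of the original
    circuit.\<close>
  have main: "circuit_act q P {} C' D' (op_mult q R K (transport q R id {} L)) = op_mult q R (\<beta> K) (transport q R id {} L)"
    if K: "local_op q R K" for K L
  proof -
    define M where "M = transport q R id {} L"
    have lM: "local_op q R M"
      unfolding M_def using supported_local[OF supported_transport[of "{}" id R q L]] by simp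
    have loc: "local_op q R (op_mult q R K M)" "local_op q R (op_mult q R (\<beta> K) M)"
      using K lM loc\<beta> by (auto intro: local_mult)
    obtain F where F: "supported q R F (op_mult q R K M)" using loc(1) by (auto simp: local_op_iff)
    then have finF: "finite F" "F \<subseteq> R" "F \<subseteq> Q" using R_sub by (auto simp: supported_def)
    obtain N' where cone_N': "is_borrowed_cone F N'" by (rule cone'[OF finF(1,2)])
    then have N': "finite N'" "N' \<subseteq> gates" by (simp_all add: is_borrowed_cone_def)
    \<comment> \<open>The new cone determines the finitely many ancillas to be replaced; only then
      are their cones in the original circuit added, so that the product \<open>U\<close> fixes the
      operators on them. No further ancilla has to be replaced on account of these added
      gates.\<close>
    define B where "B = (\<Union>g\<in>N'. qs g) \<inter> anc_qudits A"
    have "finite (\<Union>g\<in>N'. qs g)" using N' gate_facts(6) by blast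
    then have B: "finite B" "B \<subseteq> anc_qudits A" by (simp_all add: B_def)
    obtain N where cone_N: "is_cone F N" by (rule cone[OF finF(1,3)])
    then have N: "finite N" "N \<subseteq> gates" by (simp_all add: is_cone_def)
    have "\<exists>N. is_cone {k} N" if "k \<in> B" for k
    proof -
      have "{k} \<subseteq> Q" using that B(2) ancQ by blast
      then show ?thesis using cone[of "{k}"] by blast
    qed
    then obtain Nk where cone_Nk: "\<And>k. k \<in> B \<Longrightarrow> is_cone {k} (Nk k)" by metis
    then have Nk: "\<And>k. k \<in> B \<Longrightarrow> finite (Nk k)" "\<And>k. k \<in> B \<Longrightarrow> Nk k \<subseteq> gates"
      by (simp_all add: is_cone_def)
    obtain xs where xs: "distinct xs" "set xs = N \<union> N' \<union> (\<Union>k\<in>B. Nk k)"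
      using finite_distinct_list[of "N \<union> N' \<union> (\<Union>k\<in>B. Nk k)"] N(1) N'(1) Nk(1) B(1) by (metis finite_UN finite_Un)
    have sub: "set xs \<subseteq> gates" "N \<subseteq> set xs" "N' \<subseteq> set xs" "\<And>k. k \<in> B \<Longrightarrow> Nk k \<subseteq> set xs"
    proof -
      have "(\<Union>k\<in>B. Nk k) \<subseteq> gates" using Nk(2) by (rule UN_least)
      then show "set xs \<subseteq> gates" using xs(2) N(2) N'(2) by simp
      show "N \<subseteq> set xs" "N' \<subseteq> set xs" "\<And>k. k \<in> B \<Longrightarrow> Nk k \<subseteq> set xs" unfolding xs(2) by blast+
    qed
    define U where "U = opprod q Q (op_at {}) (ord_list \<theta> xs D')"
    have U: "opprod q Q (op_at {}) (ord_list snd xs (depth C)) = U"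
      unfolding U_def by (rule reorder[OF xs(1) sub(1)])
    have lu: "local_op q Q (op_at {} g) \<and> unitary_op q Q (op_at {} g)" if "g \<in> set (ord_list \<theta> xs D')" for g
      using op_at_facts[of g "{}"] that sub(1) by (auto simp: set_ord_list)
    have locU: "local_op q Q U" and unitU: "unitary_op q Q U"
      unfolding U_def using lu by (auto intro: opprod_local opprod_unitary)
    \<comment> \<open>On operators at \<open>k\<close> the finite product acts like the full
      circuit, which fixes them; being fixed by a unitary conjugation means commuting with the
      unitary.\<close>
    have "commutes q Q U M" if "k \<in> B" "supported q Q {k} M" for k M
    proof (rule conj_op_eq_commutes[OF locU supported_local[OF that(2)] unitU])
      show "conj_op q Q U M = M"
        using cone_Nk[OF that(1)] that(2) xs(1) sub(4)[OF that(1)] sub(1) fix_anc[OF _ that(2)] that(1) B(2)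
        unfolding is_cone_def U[symmetric] by auto
    qed
    then have sb: "opprod q Q (op_at B) (ord_list \<theta> xs D') = U"
      unfolding U_def by (intro substitute[OF sub(1) B]) blast
    have extM: "?e M = transport q Q id (anc_qudits A) (transport q (anc_qudits A) id {} L)"
      unfolding M_def using R_sub ancQ by (subst (1 2) transport_transport) auto
    have "supported q (anc_qudits A) (id ` {}) (transport q (anc_qudits A) id {} L)"
      by (rule supported_transport) auto
    then have lL: "local_op q (anc_qudits A) (transport q (anc_qudits A) id {} L)" by (rule supported_local)
    have mult: "?e (op_mult q R X Y) = op_mult q Q (?e X) (?e Y)" for X Y
      by (rule transport_mult[symmetric]) (use R_sub in auto)
    have "?e (circuit_act q P {} C' D' (op_mult q R K M)) = conj_op q Q U (?e (op_mult q R K M))"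
    proof -
      have "\<forall>g\<in>N'. qs g \<inter> anc_qudits A \<subseteq> B" by (auto simp: B_def)
      then show ?thesis
        using cone_N' F xs(1) sub(3,1) B(2) unfolding is_borrowed_cone_def sb[symmetric] by simp
    qed
    also have "\<dots> = circuit_act q P A C (depth C) (?e (op_mult q R K M))"
      using cone_N supported_ext[OF F R_sub] xs(1) sub(2,1) unfolding is_cone_def U[symmetric] by simp
    also have "\<dots> = ?e (op_mult q R (\<beta> K) M)"
      unfolding mult extM by (rule act[OF K lL])
    finally have eq: "?e (circuit_act q P {} C' D' (op_mult q R K M)) = ?e (op_mult q R (\<beta> K) M)" .
    have "local_op q R (circuit_act q P {} C' D' (op_mult q R K M))"
      using cone_N' F unfolding is_borrowed_cone_def by blast
    then have "circuit_act q P {} C' D' (op_mult q R K M) = op_mult q R (\<beta> K) M"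
      using loc(2) by (intro ext_inject[OF q R_sub _ _ eq] local_is_op)
    then show ?thesis unfolding M_def .
  qed
  have "transport q R id R K = K" if "local_op q R K" for K
    using that by (intro transport_self local_is_op)
  then show ?thesis
    unfolding implements_action_def Let_def R_eq op_ext_eq_transport depth_C'
    using main loc\<beta> by (auto simp: anc_qudits_def)
qed

end

section \<open>Construction of a borrowing function\<close>

text \<open>Greedy colouring: removing a vertex does not add conflicts elsewhere, so the rest is
  coloured by induction, and the neighbours of the removed vertex use fewer colours than its palette
  has. Infinite palettes are listed apart because their \<open>card\<close> is 0.\<close>

lemma list_colouring:
  assumes "finite J" "\<And>j k. conf j k \<Longrightarrow> conf k j"
    and "\<And>j. j \<in> J \<Longrightarrow> infinite (Pal j) \<or> card {k \<in> J. k \<noteq> j \<and> conf j k} < card (Pal j)"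
  shows "\<exists>g. (\<forall>j\<in>J. g j \<in> Pal j) \<and> (\<forall>j\<in>J. \<forall>k\<in>J. j \<noteq> k \<and> conf j k \<longrightarrow> g j \<noteq> g k)"
  using assms(1,3)
proof (induction J rule: finite_induct)
  case (insert j J)
  have "\<exists>g. (\<forall>j\<in>J. g j \<in> Pal j) \<and> (\<forall>j\<in>J. \<forall>k\<in>J. j \<noteq> k \<and> conf j k \<longrightarrow> g j \<noteq> g k)"
  proof (rule insert.IH)
    fix i assume "i \<in> J"
    have "card {k \<in> J. k \<noteq> i \<and> conf i k} \<le> card {k \<in> insert j J. k \<noteq> i \<and> conf i k}"
      using insert.hyps(1) by (intro card_mono) auto
    then show "infinite (Pal i) \<or> card {k \<in> J. k \<noteq> i \<and> conf i k} < card (Pal i)"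
      using insert.prems[of i] \<open>i \<in> J\<close> by auto
  qed
  then obtain g where g: "\<forall>j\<in>J. g j \<in> Pal j" "\<forall>j\<in>J. \<forall>k\<in>J. j \<noteq> k \<and> conf j k \<longrightarrow> g j \<noteq> g k"
    by (elim exE conjE)
  let ?N = "{k \<in> J. conf j k}"
  have N: "finite ?N" "{k \<in> insert j J. k \<noteq> j \<and> conf j k} = ?N" using insert.hyps by auto
  have "\<not> Pal j \<subseteq> g ` ?N"
  proof
    assume *: "Pal j \<subseteq> g ` ?N"
    then have "finite (Pal j)" using N(1) finite_surj by blast
    moreover have "card (Pal j) \<le> card ?N" using * N(1) by (meson card_image_le card_mono finite_imageI order_trans)
    ultimately show False using insert.prems[of j] N(2) by auto
  qed
  then obtain x where x: "x \<in> Pal j" "x \<notin> g ` ?N" by blast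
  show ?case
  proof (intro exI[of _ "g(j := x)"] conjI ballI impI)
    fix i assume "i \<in> insert j J"
    then show "(g(j := x)) i \<in> Pal i" using g(1) x(1) by auto
  next
    fix i k assume ik: "i \<in> insert j J" "k \<in> insert j J" "i \<noteq> k \<and> conf i k"
    have "conf j i" if "k = j" using assms(2) ik(3) that by blast
    then show "(g(j := x)) i \<noteq> (g(j := x)) k" using g(2) x(2) ik by auto
  qed
qed simp

text \<open>By Zorn's lemma there is a maximal separated set. A point at distance at least
  \<open>s\<close> from all its members could be added to it, so maximality gives the covering
  property.\<close>

lemma (in Metric_space) maximal_separated:
  assumes "0 < s"
  shows "\<exists>N\<subseteq>M. (\<forall>x\<in>N. \<forall>y\<in>N. x \<noteq> y \<longrightarrow> s \<le> d x y) \<and> (\<forall>p\<in>M. \<exists>x\<in>N. d x p < s)"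
proof -
  define \<A> where "\<A> = {N. N \<subseteq> M \<and> (\<forall>x\<in>N. \<forall>y\<in>N. x \<noteq> y \<longrightarrow> s \<le> d x y)}"
  have "\<exists>N\<in>\<A>. \<forall>N'\<in>\<A>. N \<subseteq> N' \<longrightarrow> N' = N"
  proof (rule subset_Zorn')
    fix \<C> assume c: "subset.chain \<A> \<C>"
    then have sub: "\<C> \<subseteq> \<A>" and tot: "\<And>X Y. X \<in> \<C> \<Longrightarrow> Y \<in> \<C> \<Longrightarrow> X \<subseteq> Y \<or> Y \<subseteq> X"
      by (auto simp: subset.chain_def)
    have "s \<le> d x y" if xy: "x \<in> \<Union>\<C>" "y \<in> \<Union>\<C>" "x \<noteq> y" for x y
    proof -
      obtain X Y where XY: "X \<in> \<C>" "Y \<in> \<C>" "x \<in> X" "y \<in> Y" using xy by blast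
      then have "\<exists>Z\<in>\<C>. x \<in> Z \<and> y \<in> Z" using tot[of X Y] by blast
      then show ?thesis using sub xy(3) unfolding \<A>_def by blast
    qed
    moreover have "\<Union>\<C> \<subseteq> M" using sub by (auto simp: \<A>_def)
    ultimately show "\<Union>\<C> \<in> \<A>" unfolding \<A>_def by blast
  qed
  then obtain N where N: "N \<in> \<A>" "\<And>N'. N' \<in> \<A> \<Longrightarrow> N \<subseteq> N' \<Longrightarrow> N' = N" by blast
  have "\<exists>x\<in>N. d x p < s" if p: "p \<in> M" for p
  proof (rule ccontr)
    assume "\<not> (\<exists>x\<in>N. d x p < s)"
    then have far: "\<forall>x\<in>N. s \<le> d x p" by force
    then have "\<forall>x\<in>N. s \<le> d p x" by (simp add: commute)
    then have "insert p N \<in> \<A>" using N(1) p far by (auto simp: \<A>_def)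
    then have "p \<in> N" using N(2)[of "insert p N"] by blast
    then show False using far p assms by auto
  qed
  then show ?thesis using N(1) unfolding \<A>_def by (intro exI[of _ N]) simp
qed

text \<open>The intermediate value theorem for the distance from \<open>x\<close> on a connected set
  containing \<open>x\<close> and \<open>z\<close>.\<close>

lemma (in Metric_space) connected_component_distance:
  assumes "connected_component_of mtopology x z" "x \<in> M" "0 \<le> t" "t \<le> d x z"
  shows "\<exists>y\<in>M. d x y = t"
proof -
  obtain T where T: "connectedin mtopology T" "x \<in> T" "z \<in> T"
    using assms(1) by (auto simp: connected_component_of_def)
  have "continuous_map mtopology euclidean (\<lambda>y. mdist (metric (M, d)) x y)"
    using assms(2) by (intro continuous_map_mdist) (auto simp: continuous_map_const)
  then have "connectedin euclidean ((\<lambda>y. d x y) ` T)"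
    using T(1) by (auto dest: connectedin_continuous_map_image)
  then have "connected ((\<lambda>y. d x y) ` T)" by simp
  moreover have "0 \<in> (\<lambda>y. d x y) ` T" using T(2) assms(2) by (force intro: image_eqI[of _ _ x])
  moreover have "d x z \<in> (\<lambda>y. d x y) ` T" using T(3) by blast
  ultimately have "t \<in> (\<lambda>y. d x y) ` T" using assms(3,4) connectedD_interval by blast
  moreover have "T \<subseteq> M" using connectedin_subset_topspace[OF T(1)] by simp
  ultimately show ?thesis by blast
qed

text \<open>The left side bounds the competitors of an ancilla: \<open>2 * w\<close> shells of
  bounded population. The summand 1 covers \<open>d < 1\<close>, where the power is largest at
  radius 1; the final \<open>- 1\<close> pays for the floor in the number of physical qudits. The
  left side grows like \<open>m powr (d - 1)\<close> or stays bounded, so a large \<open>m\<close>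
  suffices.\<close>

lemma enough_qudits:
  fixes c c' d :: real
  assumes "0 < c" "0 < c'" "0 < d"
  shows "\<exists>m::nat. 1 \<le> m \<and> w \<le> m \<and>
    real (2 * w) * (c' * (1 + real (16 * m) powr (d - 1))) < c * real m powr d - 1"
proof -
  define K where "K = 2 * real w * c'"
  have K: "0 \<le> K" using assms by (simp add: K_def)
  have "filterlim (\<lambda>m. real m powr d) at_top sequentially"
    using assms(3) by real_asymp
  \<comment> \<open>Each of the two thresholds keeps one part of the left side below half of
    \<open>c * m powr d\<close>; the extra 2 leaves a strict inequality after the
    \<open>- 1\<close>.\<close>
  then have "\<forall>\<^sub>F m in sequentially. 2 * (K + 2) / c \<le> real m powr d"
    unfolding filterlim_at_top by blast
  moreover have "\<forall>\<^sub>F m in sequentially. 2 * K * 16 powr (d - 1) / c \<le> real m"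
    using filterlim_real_sequentially unfolding filterlim_at_top by blast
  moreover have "\<forall>\<^sub>F m in sequentially. max 1 w \<le> m" by (rule eventually_ge_at_top)
  ultimately have "\<forall>\<^sub>F m in sequentially. 2 * (K + 2) / c \<le> real m powr d \<and>
      2 * K * 16 powr (d - 1) / c \<le> real m \<and> max 1 w \<le> m"
    by eventually_elim blast
  then obtain m where m: "2 * (K + 2) / c \<le> real m powr d" "2 * K * 16 powr (d - 1) / c \<le> real m" "1 \<le> m" "w \<le> m"
    using eventually_happens'[OF sequentially_bot] by fastforce
  have "2 * (K + 2) \<le> c * real m powr d" using m(1) assms(1) by (simp add: field_simps)
  moreover have "2 * K * 16 powr (d - 1) * real m powr (d - 1) \<le> c * real m powr d"
  proof -
    have "2 * K * 16 powr (d - 1) \<le> c * real m" using m(2) assms(1) by (simp add: field_simps)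
    then have "2 * K * 16 powr (d - 1) * real m powr (d - 1) \<le> (c * real m) * real m powr (d - 1)"
      by (intro mult_right_mono) auto
    also have "\<dots> = c * real m powr d" using m(3) by (simp add: powr_diff)
    finally show ?thesis .
  qed
  moreover have "real (16 * m) powr (d - 1) = 16 powr (d - 1) * real m powr (d - 1)" by (simp add: powr_mult)
  ultimately have "K * (1 + real (16 * m) powr (d - 1)) < c * real m powr d - 1" by (simp add: algebra_simps)
  then show ?thesis using m(3,4) by (auto simp: K_def mult.assoc)
qed


text \<open>Across a gate the delay varies by at most \<rho>. Hence \<kappa> exceeds
  \<open>2 * \<rho>\<close>, so that successive rounds on a common site keep their order, and
  \<open>w\<close> is large enough for delays differing by \<open>w\<close> to give disjoint time
  windows. The spacing \<open>16 * m\<close> of the net exceeds twice the distance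
  \<open>7 * m\<close> within which lenders are sought, and \<open>32 * m\<close> leaves room for
  \<open>16 * m + 7 * m\<close>.\<close>

lemma borrowing_exists:
  fixes \<rho> \<kappa> w m :: nat and c c' d :: real and C :: "'s circuit"
  assumes metric: "Metric_space X \<delta>" and large: "large_space X \<delta> R" and loc: "loc ` (P \<union> A) \<subseteq> X"
    and layers_ball: "\<forall>a\<in>{1..depth C}. \<forall>S\<in>layer C a.
      S \<noteq> {} \<and> S \<subseteq> P \<union> A \<and> (\<forall>i\<in>S. \<forall>j\<in>S. \<delta> (loc i) (loc j) \<le> real \<rho>)"
    and many: "many_physical X \<delta> P loc c d R" and few: "few_ancillas X \<delta> A loc c' d R"
    and \<kappa>: "\<kappa> = 2 * \<rho> + 1" and w: "w = 2 * \<rho> + \<kappa> * depth C" "1 \<le> m" "w \<le> m" and R: "real (32 * m) \<le> R"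
    and c': "0 < c'"
    and enough: "real (2 * w) * (c' * (1 + real (16 * m) powr (d - 1))) < c * real m powr d - 1"
  shows "\<exists>\<tau> f. causal_time C \<tau> \<and>
    (\<forall>a\<in>{1..depth C}. \<forall>S\<in>layer C a. 1 \<le> \<tau> S a \<and> \<tau> S a \<le> int (16 * m + \<kappa> * depth C)) \<and>
    f ` A \<subseteq> P \<and> (\<forall>j. j \<notin> A \<longrightarrow> f j = j) \<and>
    (\<forall>j\<in>A. \<forall>i. i = f j \<or> i \<in> A \<and> i \<noteq> j \<and> f i = f j \<longrightarrow>
      all_before (site_times C \<tau> j) (site_times C \<tau> i) \<or> all_before (site_times C \<tau> i) (site_times C \<tau> j)) \<and>
    (\<forall>j\<in>A. \<delta> (loc j) (loc (f j)) \<le> real (32 * m))"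
proof -
  interpret Metric_space X \<delta> by (rule metric)
  have layers: "S \<noteq> {} \<and> S \<subseteq> P \<union> A \<and> (\<forall>i\<in>S. \<forall>j\<in>S. \<delta> (loc i) (loc j) \<le> real \<rho>)"
    if "a \<in> {1..depth C}" "S \<in> layer C a" for a S
    using bspec[OF bspec[OF layers_ball that(1)] that(2)] .
  have locX: "loc i \<in> X" if "i \<in> P \<union> A" for i using loc that by blast
  have pos: "0 < real (16 * m)" using w(2) by simp
  obtain Net where Net: "Net \<subseteq> X" "\<forall>x\<in>Net. \<forall>y\<in>Net. x \<noteq> y \<longrightarrow> real (16 * m) \<le> \<delta> x y"
    "\<forall>p\<in>X. \<exists>x\<in>Net. \<delta> x p < real (16 * m)"
    using maximal_separated[OF pos] by (elim exE conjE)
  have net: "Net \<subseteq> X" "\<And>x y. x \<in> Net \<Longrightarrow> y \<in> Net \<Longrightarrow> x \<noteq> y \<Longrightarrow> real (16 * m) \<le> \<delta> x y"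
    "\<And>p. p \<in> X \<Longrightarrow> \<exists>x\<in>Net. \<delta> x p < real (16 * m)"
    by (fact Net(1), fact Net(2)[rule_format], fact Net(3)[rule_format])
  \<comment> \<open>The distance to the net, rounded up: times must be integers, and a positive
    value \<open>n\<close> places a site in the shell between \<open>n - 1\<close> and
    \<open>n\<close> around a nearest net point, matching \<open>few_ancillas\<close>.\<close>
  define h where "h p = (LEAST n::nat. \<exists>x\<in>Net. \<delta> x p \<le> real n)" for p
  have h_ex: "\<exists>x\<in>Net. \<delta> x p \<le> real (h p)" if "p \<in> X" for p
    unfolding h_def by (rule LeastI[of _ "16 * m"]) (use net(3)[OF that] in \<open>auto intro: less_imp_le\<close>)
  have h_le: "h p \<le> n" if "x \<in> Net" "\<delta> x p \<le> real n" for x p n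
    unfolding h_def by (rule Least_le) (use that in blast)
  have h_max: "h p \<le> 16 * m" if "p \<in> X" for p
    using net(3)[OF that] h_le by (meson less_imp_le)
  have h_lb: "real (h p) < \<delta> x p + 1" if "x \<in> Net" for x p
    using h_le[OF that, of p "nat \<lceil>\<delta> x p\<rceil>"] nonneg[of x p] by linarith
  have h_lip: "h p' \<le> h p + \<rho>" if pp: "p \<in> X" "p' \<in> X" "\<delta> p p' \<le> real \<rho>" for p p'
  proof -
    obtain x where x: "x \<in> Net" "\<delta> x p \<le> real (h p)" using h_ex[OF pp(1)] by blast
    have "\<delta> x p' \<le> \<delta> x p + \<delta> p p'" using x net(1) pp by (intro triangle) auto
    then show ?thesis using x pp(3) by (intro h_le[OF x(1)]) simp
  qed
  define hs where "hs j = h (loc j)" for j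
  \<comment> \<open>Any site of the gate may represent it: two choices on overlapping gates cost at
    most \<open>2 * \<rho>\<close>, less than the step \<kappa> between rounds.\<close>
  define \<tau> where "\<tau> S a = int (hs (SOME i. i \<in> S)) + int (\<kappa> * a)" for S and a :: nat
  have some: "(SOME i. i \<in> S) \<in> S" if "a \<in> {1..depth C}" "S \<in> layer C a" for S a
    using layers[OF that] by (intro some_in_eq[THEN iffD2]) auto
  have near: "hs i \<le> hs j + \<rho>" if S: "a \<in> {1..depth C}" "S \<in> layer C a" "i \<in> S" "j \<in> S" for a S i j
    unfolding hs_def using layers[OF S(1,2)] S(3,4) by (intro h_lip locX) auto
  have causal: "causal_time C \<tau>"
    unfolding causal_time_def
  proof (intro ballI impI)
    fix a b S T assume a: "a \<in> {1..depth C}" "b \<in> {1..depth C}" "S \<in> layer C a" "T \<in> layer C b" and ab: "a < b \<and> S \<inter> T \<noteq> {}"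
    then obtain i where i: "i \<in> S" "i \<in> T" by blast
    have "hs (SOME i. i \<in> S) \<le> hs i + \<rho>" by (rule near[OF a(1,3) some[OF a(1,3)] i(1)])
    moreover have "hs i \<le> hs (SOME i. i \<in> T) + \<rho>" by (rule near[OF a(2,4) i(2) some[OF a(2,4)]])
    moreover have "\<kappa> * a + \<kappa> \<le> \<kappa> * b" using ab mult_le_mono2[of "Suc a" b \<kappa>] by simp
    ultimately show "\<tau> S a < \<tau> T b" unfolding \<tau>_def using \<kappa> by linarith
  qed
  have range: "1 \<le> \<tau> S a \<and> \<tau> S a \<le> int (16 * m + \<kappa> * depth C)" if S: "a \<in> {1..depth C}" "S \<in> layer C a" for a S
  proof -
    have "hs (SOME i. i \<in> S) \<le> 16 * m"
      unfolding hs_def using some[OF S] layers[OF S] by (intro h_max locX) blast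
    moreover have "\<kappa> \<le> \<kappa> * a" "\<kappa> * a \<le> \<kappa> * depth C" using S(1) by auto
    ultimately show ?thesis unfolding \<tau>_def using \<kappa> by linarith
  qed
  have times: "int (hs j) - int \<rho> + int \<kappa> \<le> t \<and> t \<le> int (hs j) + int \<rho> + int (\<kappa> * depth C)"
    if tj: "t \<in> site_times C \<tau> j" for t j
  proof -
    obtain S a where S: "t = \<tau> S a" "a \<in> {1..depth C}" "S \<in> layer C a" "j \<in> S"
      using tj by (auto simp: site_times_def)
    have "hs (SOME i. i \<in> S) \<le> hs j + \<rho>" "hs j \<le> hs (SOME i. i \<in> S) + \<rho>"
      using near[OF S(2,3)] some[OF S(2,3)] S(4) by blast+
    moreover have "\<kappa> \<le> \<kappa> * a" "\<kappa> * a \<le> \<kappa> * depth C" using S(2) by auto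
    ultimately show ?thesis unfolding S(1) \<tau>_def by linarith
  qed
  have before: "all_before (site_times C \<tau> i) (site_times C \<tau> j)" if "hs i + w \<le> hs j" for i j
    unfolding all_before_def
  proof (intro ballI)
    fix s t assume st: "s \<in> site_times C \<tau> i" "t \<in> site_times C \<tau> j"
    show "s < t" using times[OF st(1)] times[OF st(2)] that w(1) \<kappa> by linarith
  qed
  \<comment> \<open>A place for lenders away from the net point, at a distance below
    \<open>R\<close>.\<close>
  have "\<exists>y\<in>X. \<delta> x y = real (6 * m)" if "x \<in> Net" for x
  proof -
    have x: "x \<in> X" using that net(1) by blast
    then obtain z where "connected_component_of mtopology x z" "R < \<delta> x z" using large by (auto simp: large_space_def)
    then show ?thesis using connected_component_distance[of x z "real (6 * m)"] x R by auto
  qed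
  then obtain far where far: "\<And>x. x \<in> Net \<Longrightarrow> far x \<in> X" "\<And>x. x \<in> Net \<Longrightarrow> \<delta> x (far x) = real (6 * m)" by metis
  have "\<exists>x\<in>Net. \<delta> x (loc j) \<le> real (hs j)" if "j \<in> A" for j
    unfolding hs_def using that by (intro h_ex locX) blast
  then obtain cen where cen: "\<And>j. j \<in> A \<Longrightarrow> cen j \<in> Net" "\<And>j. j \<in> A \<Longrightarrow> \<delta> (cen j) (loc j) \<le> real (hs j)" by metis
  \<comment> \<open>The physical qudits available to the ancilla of \<open>j\<close> lie around the net point if \<open>j\<close> is far from it, and
    around a point at distance \<open>6 m\<close> otherwise. In both cases \<open>h\<close> differs from \<open>h (loc j)\<close> by at least \<open>m\<close>.
    All are within \<open>7 m\<close> of the net point, so ancillas of different cells do not compete.\<close>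
  define mid where "mid j = (if hs j \<le> 4 * m then far (cen j) else cen j)" for j
  define Pal where "Pal j = {i \<in> P. \<delta> (mid j) (loc i) \<le> real m}" for j
  have mid: "mid j \<in> X" "\<delta> (cen j) (mid j) \<le> real (6 * m)" if "j \<in> A" for j
    using far cen(1)[OF that] net(1) by (auto simp: mid_def)
  have pal_near: "\<delta> (cen j) (loc i) \<le> real (7 * m)" if "j \<in> A" "i \<in> Pal j" for i j
  proof -
    have "\<delta> (cen j) (loc i) \<le> \<delta> (cen j) (mid j) + \<delta> (mid j) (loc i)"
      using cen(1)[OF that(1)] net(1) mid(1)[OF that(1)] that(2) locX by (intro triangle) (auto simp: Pal_def)
    then show ?thesis using mid(2)[OF that(1)] that(2) by (simp add: Pal_def)
  qed
  have pal_gap: "hs j + w \<le> hs i \<or> hs i + w \<le> hs j" if j: "j \<in> A" "i \<in> Pal j" for i j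
  proof (cases "hs j \<le> 4 * m")
    case True
    have i: "i \<in> P" "loc i \<in> X" "\<delta> (far (cen j)) (loc i) \<le> real m" using j locX True by (auto simp: Pal_def mid_def)
    have cX: "cen j \<in> X" using cen(1)[OF j(1)] net(1) by blast
    obtain x where x: "x \<in> Net" "\<delta> x (loc i) \<le> real (hs i)" unfolding hs_def using h_ex[OF i(2)] by blast
    \<comment> \<open>The own net point is at least \<open>6 * m - m\<close> away, any other one at
      least \<open>16 * m - 7 * m\<close>.\<close>
    have "real (5 * m) \<le> \<delta> x (loc i)"
    proof (cases "x = cen j")
      case True
      have "\<delta> x (far x) \<le> \<delta> x (loc i) + \<delta> (loc i) (far x)"
        using True cX i far(1)[OF x(1)] by (intro triangle) auto
      then show ?thesis using far(2)[OF x(1)] i(3) True by (simp add: commute)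
    next
      case False
      have "real (16 * m) \<le> \<delta> x (cen j)" by (rule net(2)[OF x(1) cen(1)[OF j(1)] False])
      also have "\<dots> \<le> \<delta> x (loc i) + \<delta> (loc i) (cen j)" using x(1) net(1) i cX by (intro triangle) auto
      finally show ?thesis using pal_near[OF j] by (simp add: commute)
    qed
    then have "5 * m \<le> hs i" using x(2) by linarith
    then show ?thesis using True w(3) by linarith
  next
    case False
    have "\<delta> (cen j) (loc i) \<le> real m" using False j(2) by (simp add: Pal_def mid_def)
    then have "hs i \<le> m" unfolding hs_def by (rule h_le[OF cen(1)[OF j(1)]])
    then show ?thesis using False w(3) by linarith
  qed
  have pal_cen: "cen j = cen k" if "j \<in> A" "k \<in> A" "i \<in> Pal j" "i \<in> Pal k" for i j k
  proof (rule ccontr)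
    assume "cen j \<noteq> cen k"
    then have "real (16 * m) \<le> \<delta> (cen j) (cen k)" using cen(1) that by (intro net(2)) auto
    also have "\<dots> \<le> \<delta> (cen j) (loc i) + \<delta> (loc i) (cen k)"
      using cen(1) that net(1) locX by (intro triangle) (auto simp: Pal_def)
    finally show False using pal_near[OF that(1,3)] pal_near[OF that(2,4)] w(2) by (simp add: commute)
  qed
  define B where "B = c' * (1 + real (16 * m) powr (d - 1))"
  define Ann where "Ann x n = {j \<in> A. \<delta> x (loc j) \<in> {real n - 1..real n}}" for x and n :: nat
  have Ann: "finite (Ann x n) \<and> real (card (Ann x n)) \<le> B" if x: "x \<in> X" "1 \<le> n" "n \<le> 16 * m" for x n
  proof -
    have "real n \<le> R" using x(3) R by linarith
    then have f: "finite {(s, l) \<in> anc_qudits A. \<delta> x (loc s) \<in> {real n - 1..real n}}"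
      "int (card {(s, l) \<in> anc_qudits A. \<delta> x (loc s) \<in> {real n - 1..real n}}) \<le> \<lfloor>c' * real n powr (d - 1)\<rfloor>"
      using few x unfolding few_ancillas_def Let_def by blast+
    have e: "{(s, l) \<in> anc_qudits A. \<delta> x (loc s) \<in> {real n - 1..real n}} = (\<lambda>s. (s, Anc)) ` Ann x n"
      by (auto simp: anc_qudits_def Ann_def)
    have inj: "inj_on (\<lambda>s. (s, Anc)) (Ann x n)" by (auto simp: inj_on_def)
    have "real n powr (d - 1) \<le> 1 + real (16 * m) powr (d - 1)"
    proof (cases "1 \<le> d")
      case True
      then have "real n powr (d - 1) \<le> real (16 * m) powr (d - 1)" using x(3) by (intro powr_mono2) auto
      then show ?thesis by simp
    next
      case False
      then have "real n powr (d - 1) \<le> real n powr 0" using x(2) by (intro powr_mono) auto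
      then show ?thesis using x(2) by (simp add: add_increasing2)
    qed
    then have "c' * real n powr (d - 1) \<le> B" unfolding B_def using c' by (intro mult_left_mono) auto
    then have "real (card (Ann x n)) \<le> B" using f(2) unfolding e card_image[OF inj] by linarith
    moreover have "finite (Ann x n)" using f(1) unfolding e by (rule finite_imageD[OF _ inj])
    ultimately show ?thesis by blast
  qed
  define cell where "cell x = {j \<in> A. cen j = x}" for x
  \<comment> \<open>At a net point the delay is 0, for which there is no shell; such a site belongs
    to the shell of radius 1, hence the \<open>max\<close>.\<close>
  have in_Ann: "j \<in> Ann x (max 1 (hs j)) \<and> max 1 (hs j) \<le> 16 * m" if "j \<in> cell x" for j x
  proof -
    have j: "j \<in> A" "cen j = x" "x \<in> Net" using that cen(1) by (auto simp: cell_def)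
    have "\<delta> x (loc j) \<le> real (hs j)" "real (hs j) < \<delta> x (loc j) + 1" "0 \<le> \<delta> x (loc j)"
      using cen(2)[OF j(1)] h_lb[OF j(3), of "loc j"] j(2) by (auto simp: hs_def)
    moreover have "hs j \<le> 16 * m" unfolding hs_def using j(1) by (intro h_max locX) auto
    ultimately show ?thesis using j(1) w(2) by (auto simp: Ann_def max_def)
  qed
  define conf where "conf j k \<longleftrightarrow> hs j < hs k + w \<and> hs k < hs j + w" for j k
  \<comment> \<open>Colours are lenders, and a conflict means that the time windows may overlap.
    Cells are finite and, by \<open>pal_cen\<close>, palettes of different cells are disjoint, so
    each cell is coloured on its own even if \<open>A\<close> is infinite.\<close>
  have "\<exists>g. (\<forall>j\<in>cell x. g j \<in> Pal j) \<and> (\<forall>j\<in>cell x. \<forall>k\<in>cell x. j \<noteq> k \<and> conf j k \<longrightarrow> g j \<noteq> g k)"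
    if x: "x \<in> Net" for x
  proof (rule list_colouring)
    have xX: "x \<in> X" using x net(1) by blast
    have "cell x \<subseteq> (\<Union>n\<in>{1..16 * m}. Ann x n)"
    proof
      fix j assume "j \<in> cell x"
      from in_Ann[OF this] show "j \<in> (\<Union>n\<in>{1..16 * m}. Ann x n)" by (intro UN_I[of "max 1 (hs j)"]) auto
    qed
    then show "finite (cell x)" using Ann[OF xX] by (intro finite_subset[of "cell x"]) auto
    show "conf k j" if "conf j k" for j k using that by (auto simp: conf_def)
    fix j assume j: "j \<in> cell x"
    then have jA: "j \<in> A" by (simp add: cell_def)
    let ?N = "{k \<in> cell x. k \<noteq> j \<and> conf j k}"
    \<comment> \<open>The shells that can contain a competitor of \<open>j\<close>: the delays
      within less than \<open>w\<close> of that of \<open>j\<close>.\<close>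
    define W where "W = (\<lambda>n. max 1 n) ` {hs j + 1 - w..<hs j + w} \<inter> {1..16 * m}"
    have W: "finite W" "card W \<le> 2 * w"
    proof -
      have "card W \<le> card ((\<lambda>n. max 1 n) ` {hs j + 1 - w..<hs j + w})" unfolding W_def by (intro card_mono) auto
      also have "\<dots> \<le> card {hs j + 1 - w..<hs j + w}" by (rule card_image_le) simp
      also have "\<dots> \<le> 2 * w" by simp
      finally show "card W \<le> 2 * w" .
    qed (simp add: W_def)
    have WA: "finite (Ann x n) \<and> real (card (Ann x n)) \<le> B" if "n \<in> W" for n
      using that by (intro Ann[OF xX]) (auto simp: W_def)
    have "?N \<subseteq> (\<Union>n\<in>W. Ann x n)"
    proof
      fix k assume k: "k \<in> ?N"
      then have "max 1 (hs k) \<in> W" using in_Ann[of k x] unfolding W_def conf_def by auto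
      then show "k \<in> (\<Union>n\<in>W. Ann x n)" using in_Ann[of k x] k by blast
    qed
    then have "card ?N \<le> card (\<Union>n\<in>W. Ann x n)" using W(1) WA by (intro card_mono) auto
    also have "\<dots> \<le> (\<Sum>n\<in>W. card (Ann x n))" by (rule card_UN_le[OF W(1)])
    finally have "real (card ?N) \<le> (\<Sum>n\<in>W. real (card (Ann x n)))" by (simp flip: of_nat_sum)
    also have "\<dots> \<le> (\<Sum>n\<in>W. B)" using WA by (intro sum_mono) blast
    also have "\<dots> = real (card W) * B" by simp
    also have "\<dots> \<le> real (2 * w) * B" using W(2) c' by (intro mult_right_mono) (auto simp: B_def)
    also have "\<dots> < c * real m powr d - 1" using enough by (simp add: B_def)
    finally have N: "real (card ?N) < c * real m powr d - 1" .
    let ?M = "{(s, l) \<in> phys_qudits P. \<delta> (mid j) (loc s) \<le> real m}"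
    have M: "infinite ?M \<or> \<lfloor>c * real m powr d\<rfloor> \<le> int (card ?M)"
      using many mid(1)[OF jA] w(2) R unfolding many_physical_def Let_def by auto
    have e: "?M = (\<lambda>s. (s, Phys)) ` Pal j" by (auto simp: phys_qudits_def Pal_def)
    have inj: "inj_on (\<lambda>s. (s, Phys)) (Pal j)" by (auto simp: inj_on_def)
    show "infinite (Pal j) \<or> card ?N < card (Pal j)"
    proof (cases "infinite (Pal j)")
      case False
      then have "\<lfloor>c * real m powr d\<rfloor> \<le> int (card (Pal j))" using M unfolding e card_image[OF inj] by simp
      then show ?thesis using N by linarith
    qed simp
  qed
  then obtain col where col: "\<And>x j. x \<in> Net \<Longrightarrow> j \<in> cell x \<Longrightarrow> col x j \<in> Pal j"
    "\<And>x j k. x \<in> Net \<Longrightarrow> j \<in> cell x \<Longrightarrow> k \<in> cell x \<Longrightarrow> j \<noteq> k \<Longrightarrow> conf j k \<Longrightarrow> col x j \<noteq> col x k" by metis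
  define f where "f j = (if j \<in> A then col (cen j) j else j)" for j
  have fPal: "f j \<in> Pal j" if "j \<in> A" for j using that cen(1)[OF that] col(1) by (simp add: f_def cell_def)
  have cmp: "all_before (site_times C \<tau> j) (site_times C \<tau> i) \<or> all_before (site_times C \<tau> i) (site_times C \<tau> j)"
    if j: "j \<in> A" and i: "i = f j \<or> i \<in> A \<and> i \<noteq> j \<and> f i = f j" for i j
  proof -
    have "hs j + w \<le> hs i \<or> hs i + w \<le> hs j"
    proof (cases "i = f j")
      case True
      then show ?thesis using pal_gap[OF j fPal[OF j]] by simp
    next
      case False
      then have i: "i \<in> A" "i \<noteq> j" "f i = f j" using i by auto
      have ce: "cen i = cen j" using pal_cen[OF i(1) j] fPal[OF i(1)] fPal[OF j] i(3) by metis
      then have "col (cen j) i = col (cen j) j" using i j by (simp add: f_def)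
      then have "\<not> conf i j" using col(2)[of "cen j" i j] cen(1)[OF j] i j ce by (auto simp: cell_def)
      then show ?thesis unfolding conf_def by linarith
    qed
    then show ?thesis using before by blast
  qed
  have dist: "\<delta> (loc j) (loc (f j)) \<le> real (32 * m)" if j: "j \<in> A" for j
  proof -
    have fj: "f j \<in> P" using fPal[OF j] by (simp add: Pal_def)
    have "\<delta> (loc j) (loc (f j)) \<le> \<delta> (loc j) (cen j) + \<delta> (cen j) (loc (f j))"
      using locX j fj cen(1)[OF j] net(1) by (intro triangle) auto
    moreover have "\<delta> (cen j) (loc j) \<le> real (hs j)" "hs j \<le> 16 * m"
      using cen(2)[OF j] h_max[OF locX] j by (auto simp: hs_def)
    moreover have "\<delta> (cen j) (loc (f j)) \<le> real (7 * m)" by (rule pal_near[OF j fPal[OF j]])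
    ultimately show ?thesis by (simp add: commute)
  qed
  have "f ` A \<subseteq> P" using fPal by (auto simp: Pal_def)
  moreover have "\<forall>j. j \<notin> A \<longrightarrow> f j = j" by (simp add: f_def)
  ultimately show ?thesis using causal range cmp dist by blast
qed

theorem theorem2p5:
  fixes c c' d r :: real and D :: nat
  assumes "0 < c" and "c \<le> c'" and "0 < d"
  shows "\<exists>L (D' :: nat) (r' :: real). \<forall>R \<ge> L.
    \<forall>(q :: nat) (X :: 'x set) \<delta> (P :: 's set) (A :: 's set) loc C.
      1 \<le> q \<and> Metric_space X \<delta> \<and> large_space X \<delta> R \<and>
      locally_finite_map X \<delta> (P \<union> A) loc \<and>
      is_circuit q P A \<delta> loc r C \<and> depth C = D \<and>
      many_physical X \<delta> P loc c d R \<and> few_ancillas X \<delta> A loc c' d R \<longrightarrow>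
      (\<exists>\<tau> f. causal_time C \<tau> \<and> borrowing_function P A C \<tau> f \<and>
         (\<forall>j\<in>P \<union> A. \<delta> (loc j) (loc (f j)) \<le> R) \<and>
         (\<exists>C'. is_circuit q P {} \<delta> loc r' C' \<and> depth C' \<le> D' \<and>
            borrowed_circuit q P A C \<tau> f C' \<and>
            (\<forall>V. finite (P \<union> A) \<and> implements_unitary q P A C V \<longrightarrow>
                 implements_unitary q P {} C' V) \<and>
            (\<forall>\<beta>. implements_action q P A C \<beta> \<longrightarrow> implements_action q P {} C' \<beta>)))"
proof -
  \<comment> \<open>An integer range, since the delay is integer valued.\<close>
  define \<rho> where "\<rho> = nat \<lceil>r\<rceil>"
  define \<kappa> where "\<kappa> = 2 * \<rho> + 1"
  define w where "w = 2 * \<rho> + \<kappa> * D"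
  have c': "0 < c'" using assms by simp
  obtain m :: nat where m: "1 \<le> m" "w \<le> m"
    "real (2 * w) * (c' * (1 + real (16 * m) powr (d - 1))) < c * real m powr d - 1"
    using enough_qudits[OF assms(1) c' assms(3), of w] by (elim exE conjE)
  define l where "l = real (32 * m)"
  show ?thesis
  \<comment> \<open>The depth is the largest possible time, a delay of at most \<open>16 * m\<close>
    plus \<kappa> for each round. Every lender is within \<open>l\<close> of its borrower, which
    widens a gate by at most \<open>l\<close> on either side.\<close>
  proof (rule exI[of _ l], rule exI[of _ "16 * m + \<kappa> * D"], rule exI[of _ "r + 2 * l"], intro allI impI, elim conjE)
    fix R q and X :: "'x set" and \<delta> and P A :: "'s set" and loc C
    assume R: "l \<le> R" and q: "1 \<le> q" and metric: "Metric_space X \<delta>" and large: "large_space X \<delta> R"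
      and loc: "locally_finite_map X \<delta> (P \<union> A) loc" and circ: "is_circuit q P A \<delta> loc r C" and D: "depth C = D"
      and many: "many_physical X \<delta> P loc c d R" and few: "few_ancillas X \<delta> A loc c' d R"
    interpret Metric_space X \<delta> by (rule metric)
    have locX: "loc ` (P \<union> A) \<subseteq> X" using loc by (simp add: locally_finite_map_def)
    have "r \<le> real \<rho>" unfolding \<rho>_def by linarith
    then have layers: "\<forall>a\<in>{1..depth C}. \<forall>S\<in>layer C a.
      S \<noteq> {} \<and> S \<subseteq> P \<union> A \<and> (\<forall>i\<in>S. \<forall>j\<in>S. \<delta> (loc i) (loc j) \<le> real \<rho>)"
      using circ unfolding is_circuit_def by (meson order_trans)
    have w: "w = 2 * \<rho> + \<kappa> * depth C" by (simp add: w_def D)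
    from borrowing_exists[OF metric large locX layers many few \<kappa>_def w m(1,2) R[unfolded l_def] c' m(3)]
    obtain \<tau> f where \<tau>: "causal_time C \<tau>"
        "\<forall>a\<in>{1..depth C}. \<forall>S\<in>layer C a. 1 \<le> \<tau> S a \<and> \<tau> S a \<le> int (16 * m + \<kappa> * depth C)"
      and fA: "f ` A \<subseteq> P" "\<forall>j. j \<notin> A \<longrightarrow> f j = j"
      and f_sep: "\<forall>j\<in>A. \<forall>i. i = f j \<or> i \<in> A \<and> i \<noteq> j \<and> f i = f j \<longrightarrow>
        all_before (site_times C \<tau> j) (site_times C \<tau> i) \<or> all_before (site_times C \<tau> i) (site_times C \<tau> j)"
      and near: "\<forall>j\<in>A. \<delta> (loc j) (loc (f j)) \<le> real (32 * m)"
      by (elim exE conjE)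
    interpret borrowing q P A \<delta> loc r C \<tau> f "16 * m + \<kappa> * D"
      using q circ \<tau> fA(1) f_sep D by unfold_locales blast+
    have f_near: "f j \<in> P \<and> \<delta> (loc j) (loc (f j)) \<le> l" if j: "j \<in> P \<union> A" for j
    proof (cases "j \<in> A")
      case True
      then show ?thesis using fA(1) near by (auto simp: l_def)
    next
      case False
      then show ?thesis using fA(2) j locX by (auto simp: l_def)
    qed
    have bf: "borrowing_function P A C \<tau> f"
      unfolding borrowing_function_def
    proof (intro conjI ballI impI)
      fix i j k assume jk: "j \<noteq> i \<and> k \<noteq> i \<and> j \<noteq> k \<and> f j = i \<and> f k = i"
      \<comment> \<open>Sites without ancilla are fixed by \<open>f\<close>, so they never borrow
        from another site.\<close>
      then have "j \<in> A" "k \<in> A" using fA(2) by metis+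
      then show "all_before (site_times C \<tau> j) (site_times C \<tau> k) \<or> all_before (site_times C \<tau> k) (site_times C \<tau> j)"
        using f_sep jk by metis
    next
      fix i j assume j: "j \<noteq> i \<and> f j = i"
      then have "j \<in> A" using fA(2) by metis
      then show "all_before (site_times C \<tau> j) (site_times C \<tau> i) \<or> all_before (site_times C \<tau> i) (site_times C \<tau> j)"
        using f_sep j by metis
    qed (use f_near in blast)
    have "\<delta> (loc i) (loc j) \<le> r + 2 * l" if g: "g \<in> gates" and ij: "i \<in> bs (fst g)" "j \<in> bs (fst g)" for g i j
    proof -
      have near_gate: "\<exists>i'\<in>fst g. \<delta> (loc i') (loc i) \<le> l" if i: "i \<in> bs (fst g)" for i
      proof (cases "i \<in> fst g")
        case True
        then have "loc i \<in> X" using gate_facts(3)[OF g] locX by blast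
        then show ?thesis using True by (intro bexI[of _ i]) (simp_all add: l_def)
      next
        case False
        then obtain i' where "i' \<in> fst g" "i' \<in> A" "i = f i'" using i by (auto simp: borrow_sites_def)
        then show ?thesis using f_near[of i'] by blast
      qed
      obtain i' j' where i': "i' \<in> fst g" "\<delta> (loc i') (loc i) \<le> l" and j': "j' \<in> fst g" "\<delta> (loc j') (loc j) \<le> l"
        using near_gate[OF ij(1)] near_gate[OF ij(2)] by blast
      have X: "loc i \<in> X" "loc j \<in> X" "loc i' \<in> X" "loc j' \<in> X"
        using bs_facts(3)[OF g] gate_facts(3)[OF g] ij i'(1) j'(1) locX by blast+
      have "\<delta> (loc i) (loc j) \<le> \<delta> (loc i) (loc i') + \<delta> (loc i') (loc j)" by (rule triangle) (use X in auto)
      also have "\<delta> (loc i') (loc j) \<le> \<delta> (loc i') (loc j') + \<delta> (loc j') (loc j)" by (rule triangle) (use X in auto)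
      finally show ?thesis using i'(2) j'(2) gate_facts(5)[OF g i'(1) j'(1)] by (simp add: commute)
    qed
    then have C': "is_circuit q P {} \<delta> loc (r + 2 * l) C'" by (rule is_circuit_C')
    show "\<exists>\<tau> f. causal_time C \<tau> \<and> borrowing_function P A C \<tau> f \<and>
         (\<forall>j\<in>P \<union> A. \<delta> (loc j) (loc (f j)) \<le> R) \<and>
         (\<exists>C'. is_circuit q P {} \<delta> loc (r + 2 * l) C' \<and> depth C' \<le> 16 * m + \<kappa> * D \<and>
            borrowed_circuit q P A C \<tau> f C' \<and>
            (\<forall>V. finite (P \<union> A) \<and> implements_unitary q P A C V \<longrightarrow>
                 implements_unitary q P {} C' V) \<and>
            (\<forall>\<beta>. implements_action q P A C \<beta> \<longrightarrow> implements_action q P {} C' \<beta>))"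
    proof (rule exI[of _ \<tau>], rule exI[of _ f], intro conjI)
      show "\<forall>j\<in>P \<union> A. \<delta> (loc j) (loc (f j)) \<le> R" using f_near R by force
      show "\<exists>C'. is_circuit q P {} \<delta> loc (r + 2 * l) C' \<and> depth C' \<le> 16 * m + \<kappa> * D \<and>
            borrowed_circuit q P A C \<tau> f C' \<and>
            (\<forall>V. finite (P \<union> A) \<and> implements_unitary q P A C V \<longrightarrow>
                 implements_unitary q P {} C' V) \<and>
            (\<forall>\<beta>. implements_action q P A C \<beta> \<longrightarrow> implements_action q P {} C' \<beta>)"
        using C' depth_C' borrowed implements_unitary_C' implements_action_C' by (intro exI[of _ C']) simp
    qed (fact \<tau>(1), fact bf)
  qed
qed

end
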